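(* Let $\mathcal C$ be any one of the following categories: small categories and functors; small groupoids and functors; or small semicategories and semifunctors. Then $\mathcal C$ admits a noetherian form inducing its strong-epimorphism--monomorphism factorization system and having complete algebraic modular fibres.
   Context: A semicategory has a set of objects, a set of arrows with source and target, and associative composition of composable arrows, with no identity requirement; semifunctors preserve this data. A complete lattice is algebraic when each element is a join of compact elements. Conventions: categories are locally small; "set" is relative to a fixed universe. A proper factorization system $(\mathcal E,\mathcal M)$ is an orthogonal factorization system with every morphism in $\mathcal E$ an epimorphism and every morphism in $\mathcal M$ a monomorphism. Forms. An (orean) form $\mathsf F$ on a category $\mathcal C$ assigns to each object $X$ a set-sized bounded lattice $\mathsf F(X)$ (the fibre over $X$; its elements are called clusters) and to each morphism $f:X\to Y$ monotone maps $f_!:\mathsf F(X)\to\mathsf F(Y)$ and $f^*:\mathsf F(Y)\to\mathsf F(X)$ with $f_!S\le T\iff S\le f^*T$, such that $(gf)_!=g_!f_!$, $(gf)^*=f^*g^*$, and identities act as identities. Put $\operatorname{Im}f=f_!\top_X$ and $\operatorname{Ker}f=f^*\bot_Y$. A cluster in $\mathsf F(X)$ is conormal if it is the image of some morphism of $\mathcal C$ with codomain $X$, and normal if it is the kernel of some morphism of $\mathcal C$ with domain $X$. An embedding of a conormal $S\in\mathsf F(X)$ is a morphism $\iota$ into $X$ with $\operatorname{Im}\iota=S$ such that every morphism $f$ into $X$ with $\operatorname{Im}f\le S$ factors as $f=\iota h$ for a unique $h$. A quotient of a normal $K\in\mathsf F(X)$ is a morphism $\pi$ out of $X$ with $\operatorname{Ker}\pi=K$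 such that every morphism $g$ out of $X$ with $K\le\operatorname{Ker}g$ factors as $g=h\pi$ for a unique $h$. The form is noetherian if: (N1) $f^*f_!S=S\vee\operatorname{Ker}f$ and $f_!f^*T=T\wedge\operatorname{Im}f$ for all $f,S,T$; (N2) every morphism $f$ factors as $f=me$ with $e$ a quotient of $\operatorname{Ker}f$ and $m$ an embedding of $\operatorname{Im}f$; (N3) the join of two normal clusters (in the same fibre) is normal, and the meet of two conormal clusters is conormal. For a noetherian form, the class of all quotients (of normal clusters) and the class of all embeddings (of conormal clusters) form a proper factorization system, the one induced by the form (quotients as left class, embeddings as right class). *)

theory Defs
  imports "HOL-Algebra.Complete_Lattice" "HOL-Library.FuncSet"
begin

unbundle cardinal_syntax

section \<open>Smallness relative to a universe\<close>

text \<open>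
  The universe is represented by a type \<open>'u\<close>: a set is small when its cardinality is below
  that of \<open>'u\<close>.  The predicate \<open>universe\<close> says that the cardinality of \<open>'u\<close> is strongly
  inaccessible (uncountable, a strong limit, regular), so that the small subsets of \<open>'u\<close> represent,
  up to bijection, exactly the members of a Grothendieck universe containing an infinite set.
\<close>

definition small :: "'u itself \<Rightarrow> 'a set \<Rightarrow> bool" where
  "small U A \<longleftrightarrow> |A| <o |UNIV :: 'u set|"

definition universe :: "'u itself \<Rightarrow> bool" where
  "universe U \<longleftrightarrow>
     (\<exists>A :: 'u set. infinite A \<and> small U A) \<and>
     (\<forall>A :: 'u set. small U A \<longrightarrow> small U (Pow A)) \<and>
     (\<forall>(A :: 'u set) (B :: 'u \<Rightarrow> 'u set).
        small U A \<longrightarrow> (\<forall>a\<in>A. small U (B a)) \<longrightarrow> small U (\<Union>a\<in>A. B a))"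

section \<open>Semicategories, categories and groupoids\<close>

text \<open>
  The same structures serve for the small (semi)categories themselves and for the large
  categories that they form.  \<open>Cmp C g f\<close> is the composite \<open>g f\<close>, first \<open>f\<close>, then \<open>g\<close>.
\<close>

record ('o, 'a) semicat =
  Obj :: "'o set"
  Arr :: "'a set"
  Src :: "'a \<Rightarrow> 'o"
  Tgt :: "'a \<Rightarrow> 'o"
  Cmp :: "'a \<Rightarrow> 'a \<Rightarrow> 'a"

definition Hom :: "('o, 'a) semicat \<Rightarrow> 'o \<Rightarrow> 'o \<Rightarrow> 'a set" where
  "Hom C X Y = {f \<in> Arr C. Src C f = X \<and> Tgt C f = Y}"

locale semicategory =
  fixes C :: "('o, 'a) semicat"
  assumes Src_closed: "f \<in> Arr C \<Longrightarrow> Src C f \<in> Obj C"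
    and Tgt_closed: "f \<in> Arr C \<Longrightarrow> Tgt C f \<in> Obj C"
    and Cmp_closed: "f \<in> Hom C X Y \<Longrightarrow> g \<in> Hom C Y Z \<Longrightarrow> Cmp C g f \<in> Hom C X Z"
    and Cmp_assoc: "f \<in> Hom C X Y \<Longrightarrow> g \<in> Hom C Y Z \<Longrightarrow> h \<in> Hom C Z W \<Longrightarrow>
      Cmp C h (Cmp C g f) = Cmp C (Cmp C h g) f"

definition is_ident :: "('o, 'a) semicat \<Rightarrow> 'o \<Rightarrow> 'a \<Rightarrow> bool" where
  "is_ident C X i \<longleftrightarrow> i \<in> Hom C X X \<and>
     (\<forall>f\<in>Arr C. Src C f = X \<longrightarrow> Cmp C f i = f) \<and>
     (\<forall>f\<in>Arr C. Tgt C f = X \<longrightarrow> Cmp C i f = f)"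

definition Ident :: "('o, 'a) semicat \<Rightarrow> 'o \<Rightarrow> 'a" where
  "Ident C X = (THE i. is_ident C X i)"

locale category = semicategory +
  assumes ident_exists: "X \<in> Obj C \<Longrightarrow> \<exists>i. is_ident C X i"

definition is_iso :: "('o, 'a) semicat \<Rightarrow> 'a \<Rightarrow> bool" where
  "is_iso C f \<longleftrightarrow> f \<in> Arr C \<and>
     (\<exists>g \<in> Hom C (Tgt C f) (Src C f).
        Cmp C g f = Ident C (Src C f) \<and> Cmp C f g = Ident C (Tgt C f))"

locale groupoid = category +
  assumes all_iso: "f \<in> Arr C \<Longrightarrow> is_iso C f"

section \<open>The categories of small semicategories, categories and groupoids\<close>

text \<open>
  Source, target and composition are pinned to \<open>undefined\<close> where they are meaningless, so that
  equality of records is equality of semicategories.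
\<close>

definition small_semicategory :: "('u, 'u) semicat \<Rightarrow> bool" where
  "small_semicategory A \<longleftrightarrow> semicategory A \<and>
     small TYPE('u) (Obj A) \<and> small TYPE('u) (Arr A) \<and>
     Src A \<in> extensional (Arr A) \<and> Tgt A \<in> extensional (Arr A) \<and>
     (\<forall>g f. \<not> (f \<in> Arr A \<and> g \<in> Arr A \<and> Src A g = Tgt A f) \<longrightarrow> Cmp A g f = undefined)"

definition small_category :: "('u, 'u) semicat \<Rightarrow> bool" where
  "small_category A \<longleftrightarrow> small_semicategory A \<and> category A"

definition small_groupoid :: "('u, 'u) semicat \<Rightarrow> bool" where
  "small_groupoid A \<longleftrightarrow> small_semicategory A \<and> groupoid A"

record 'u semimap =
  Dom :: "('u, 'u) semicat"
  Cod :: "('u, 'u) semicat"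
  OMap :: "'u \<Rightarrow> 'u"
  AMap :: "'u \<Rightarrow> 'u"

definition semifunctor :: "'u semimap \<Rightarrow> bool" where
  "semifunctor F \<longleftrightarrow>
     OMap F \<in> Obj (Dom F) \<rightarrow>\<^sub>E Obj (Cod F) \<and>
     AMap F \<in> Arr (Dom F) \<rightarrow>\<^sub>E Arr (Cod F) \<and>
     (\<forall>f\<in>Arr (Dom F). Src (Cod F) (AMap F f) = OMap F (Src (Dom F) f) \<and>
                      Tgt (Cod F) (AMap F f) = OMap F (Tgt (Dom F) f)) \<and>
     (\<forall>f\<in>Arr (Dom F). \<forall>g\<in>Arr (Dom F). Src (Dom F) g = Tgt (Dom F) f \<longrightarrow>
        AMap F (Cmp (Dom F) g f) = Cmp (Cod F) (AMap F g) (AMap F f))"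

definition functr :: "'u semimap \<Rightarrow> bool" where
  "functr F \<longleftrightarrow> semifunctor F \<and>
     (\<forall>X\<in>Obj (Dom F). AMap F (Ident (Dom F) X) = Ident (Cod F) (OMap F X))"

definition semimap_comp :: "'u semimap \<Rightarrow> 'u semimap \<Rightarrow> 'u semimap" where
  "semimap_comp G F = \<lparr>Dom = Dom F, Cod = Cod G,
     OMap = compose (Obj (Dom F)) (OMap G) (OMap F),
     AMap = compose (Arr (Dom F)) (AMap G) (AMap F)\<rparr>"

definition category_of ::
  "(('u, 'u) semicat \<Rightarrow> bool) \<Rightarrow> ('u semimap \<Rightarrow> bool) \<Rightarrow> (('u, 'u) semicat, 'u semimap) semicat"
  where
  "category_of P Q = \<lparr>Obj = {A. P A}, Arr = {F. P (Dom F) \<and> P (Cod F) \<and> Q F},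
     Src = Dom, Tgt = Cod, Cmp = semimap_comp\<rparr>"

definition SemiCat :: "(('u, 'u) semicat, 'u semimap) semicat" where
  "SemiCat = category_of small_semicategory semifunctor"

definition Cat :: "(('u, 'u) semicat, 'u semimap) semicat" where
  "Cat = category_of small_category functr"

definition Grpd :: "(('u, 'u) semicat, 'u semimap) semicat" where
  "Grpd = category_of small_groupoid functr"

section \<open>Factorization systems\<close>

definition monics :: "('o, 'a) semicat \<Rightarrow> 'a set" where
  "monics C = {m \<in> Arr C. \<forall>u\<in>Arr C. \<forall>v\<in>Arr C.
     Src C u = Src C v \<longrightarrow> Tgt C u = Src C m \<longrightarrow> Tgt C v = Src C m \<longrightarrow>
     Cmp C m u = Cmp C m v \<longrightarrow> u = v}"

definition epics :: "('o, 'a) semicat \<Rightarrow> 'a set" where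
  "epics C = {e \<in> Arr C. \<forall>u\<in>Arr C. \<forall>v\<in>Arr C.
     Tgt C u = Tgt C v \<longrightarrow> Src C u = Tgt C e \<longrightarrow> Src C v = Tgt C e \<longrightarrow>
     Cmp C u e = Cmp C v e \<longrightarrow> u = v}"

definition square :: "('o, 'a) semicat \<Rightarrow> 'a \<Rightarrow> 'a \<Rightarrow> 'a \<Rightarrow> 'a \<Rightarrow> bool" where
  "square C e m u v \<longleftrightarrow> u \<in> Hom C (Src C e) (Src C m) \<and> v \<in> Hom C (Tgt C e) (Tgt C m) \<and>
     Cmp C v e = Cmp C m u"

definition diagonal :: "('o, 'a) semicat \<Rightarrow> 'a \<Rightarrow> 'a \<Rightarrow> 'a \<Rightarrow> 'a \<Rightarrow> 'a \<Rightarrow> bool" where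
  "diagonal C e m u v d \<longleftrightarrow> d \<in> Hom C (Tgt C e) (Src C m) \<and> Cmp C d e = u \<and> Cmp C m d = v"

definition strong_epics :: "('o, 'a) semicat \<Rightarrow> 'a set" where
  "strong_epics C = {e \<in> epics C. \<forall>m\<in>monics C. \<forall>u v.
     square C e m u v \<longrightarrow> (\<exists>d. diagonal C e m u v d)}"

locale orthogonal_factorization_system = category C for C :: "('o, 'a) semicat" +
  fixes E M :: "'a set"
  assumes left_arrows: "E \<subseteq> Arr C"
    and right_arrows: "M \<subseteq> Arr C"
    and iso_left: "is_iso C f \<Longrightarrow> f \<in> E"
    and iso_right: "is_iso C f \<Longrightarrow> f \<in> M"
    and Cmp_left: "f \<in> E \<Longrightarrow> g \<in> E \<Longrightarrow> Src C g = Tgt C f \<Longrightarrow> Cmp C g f \<in> E"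
    and Cmp_right: "f \<in> M \<Longrightarrow> g \<in> M \<Longrightarrow> Src C g = Tgt C f \<Longrightarrow> Cmp C g f \<in> M"
    and factorization: "f \<in> Arr C \<Longrightarrow> \<exists>e\<in>E. \<exists>m\<in>M. Src C m = Tgt C e \<and> f = Cmp C m e"
    and orthogonality: "e \<in> E \<Longrightarrow> m \<in> M \<Longrightarrow> square C e m u v \<Longrightarrow> \<exists>!d. diagonal C e m u v d"

locale proper_factorization_system = orthogonal_factorization_system +
  assumes left_epi: "E \<subseteq> epics C"
    and right_mono: "M \<subseteq> monics C"

section \<open>Forms\<close>

text \<open>
  \<open>dimg F f\<close> is the direct image $f_!$ and \<open>iimg F f\<close> the inverse image $f^*$.
  The type of clusters doubles as the universe: every small lattice is isomorphic to one whose
  carrier is a small subset of \<open>'u\<close>.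
\<close>

record ('o, 'a, 'u) form =
  fib :: "'o \<Rightarrow> 'u gorder"
  dimg :: "'a \<Rightarrow> 'u \<Rightarrow> 'u"
  iimg :: "'a \<Rightarrow> 'u \<Rightarrow> 'u"

locale orean_form = category C for C :: "('o, 'a) semicat" +
  fixes F :: "('o, 'a, 'u) form"
  assumes locally_small: "X \<in> Obj C \<Longrightarrow> Y \<in> Obj C \<Longrightarrow> small TYPE('u) (Hom C X Y)"
    and fib_small: "X \<in> Obj C \<Longrightarrow> small TYPE('u) (carrier (fib F X))"
    and fib_lattice: "X \<in> Obj C \<Longrightarrow> bounded_lattice (fib F X)"
    and dimg_closed: "f \<in> Hom C X Y \<Longrightarrow> dimg F f \<in> carrier (fib F X) \<rightarrow> carrier (fib F Y)"
    and iimg_closed: "f \<in> Hom C X Y \<Longrightarrow> iimg F f \<in> carrier (fib F Y) \<rightarrow> carrier (fib F X)"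
    and dimg_mono: "f \<in> Hom C X Y \<Longrightarrow> isotone (fib F X) (fib F Y) (dimg F f)"
    and iimg_mono: "f \<in> Hom C X Y \<Longrightarrow> isotone (fib F Y) (fib F X) (iimg F f)"
    and adjunction: "f \<in> Hom C X Y \<Longrightarrow> S \<in> carrier (fib F X) \<Longrightarrow> T \<in> carrier (fib F Y) \<Longrightarrow>
      dimg F f S \<sqsubseteq>\<^bsub>fib F Y\<^esub> T \<longleftrightarrow> S \<sqsubseteq>\<^bsub>fib F X\<^esub> iimg F f T"
    and dimg_Cmp: "f \<in> Hom C X Y \<Longrightarrow> g \<in> Hom C Y Z \<Longrightarrow> S \<in> carrier (fib F X) \<Longrightarrow>
      dimg F (Cmp C g f) S = dimg F g (dimg F f S)"
    and iimg_Cmp: "f \<in> Hom C X Y \<Longrightarrow> g \<in> Hom C Y Z \<Longrightarrow> T \<in> carrier (fib F Z) \<Longrightarrow>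
      iimg F (Cmp C g f) T = iimg F f (iimg F g T)"
    and dimg_Ident: "X \<in> Obj C \<Longrightarrow> S \<in> carrier (fib F X) \<Longrightarrow> dimg F (Ident C X) S = S"
    and iimg_Ident: "X \<in> Obj C \<Longrightarrow> S \<in> carrier (fib F X) \<Longrightarrow> iimg F (Ident C X) S = S"

definition Im :: "('o, 'a) semicat \<Rightarrow> ('o, 'a, 'u) form \<Rightarrow> 'a \<Rightarrow> 'u" where
  "Im C F f = dimg F f \<top>\<^bsub>fib F (Src C f)\<^esub>"

definition Ker :: "('o, 'a) semicat \<Rightarrow> ('o, 'a, 'u) form \<Rightarrow> 'a \<Rightarrow> 'u" where
  "Ker C F f = iimg F f \<bottom>\<^bsub>fib F (Tgt C f)\<^esub>"

definition conormal :: "('o, 'a) semicat \<Rightarrow> ('o, 'a, 'u) form \<Rightarrow> 'o \<Rightarrow> 'u \<Rightarrow> bool" where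
  "conormal C F X S \<longleftrightarrow> (\<exists>f\<in>Arr C. Tgt C f = X \<and> S = Im C F f)"

definition normal :: "('o, 'a) semicat \<Rightarrow> ('o, 'a, 'u) form \<Rightarrow> 'o \<Rightarrow> 'u \<Rightarrow> bool" where
  "normal C F X K \<longleftrightarrow> (\<exists>f\<in>Arr C. Src C f = X \<and> K = Ker C F f)"

definition is_embedding ::
  "('o, 'a) semicat \<Rightarrow> ('o, 'a, 'u) form \<Rightarrow> 'o \<Rightarrow> 'u \<Rightarrow> 'a \<Rightarrow> bool" where
  "is_embedding C F X S i \<longleftrightarrow> i \<in> Arr C \<and> Tgt C i = X \<and> Im C F i = S \<and>
     (\<forall>f\<in>Arr C. Tgt C f = X \<longrightarrow> Im C F f \<sqsubseteq>\<^bsub>fib F X\<^esub> S \<longrightarrow>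
        (\<exists>!h. h \<in> Hom C (Src C f) (Src C i) \<and> f = Cmp C i h))"

definition is_quotient ::
  "('o, 'a) semicat \<Rightarrow> ('o, 'a, 'u) form \<Rightarrow> 'o \<Rightarrow> 'u \<Rightarrow> 'a \<Rightarrow> bool" where
  "is_quotient C F X K p \<longleftrightarrow> p \<in> Arr C \<and> Src C p = X \<and> Ker C F p = K \<and>
     (\<forall>g\<in>Arr C. Src C g = X \<longrightarrow> K \<sqsubseteq>\<^bsub>fib F X\<^esub> Ker C F g \<longrightarrow>
        (\<exists>!h. h \<in> Hom C (Tgt C p) (Tgt C g) \<and> g = Cmp C h p))"

locale noetherian_form = orean_form +
  assumes iimg_dimg: "f \<in> Hom C X Y \<Longrightarrow> S \<in> carrier (fib F X) \<Longrightarrow>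
      iimg F f (dimg F f S) = S \<squnion>\<^bsub>fib F X\<^esub> Ker C F f"
    and dimg_iimg: "f \<in> Hom C X Y \<Longrightarrow> T \<in> carrier (fib F Y) \<Longrightarrow>
      dimg F f (iimg F f T) = T \<sqinter>\<^bsub>fib F Y\<^esub> Im C F f"
    and quotient_embedding: "f \<in> Hom C X Y \<Longrightarrow>
      \<exists>e m. is_quotient C F X (Ker C F f) e \<and> is_embedding C F Y (Im C F f) m \<and>
            Src C m = Tgt C e \<and> f = Cmp C m e"
    and normal_join: "X \<in> Obj C \<Longrightarrow> normal C F X K \<Longrightarrow> normal C F X L \<Longrightarrow>
      normal C F X (K \<squnion>\<^bsub>fib F X\<^esub> L)"
    and conormal_meet: "X \<in> Obj C \<Longrightarrow> conormal C F X S \<Longrightarrow> conormal C F X T \<Longrightarrow>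
      conormal C F X (S \<sqinter>\<^bsub>fib F X\<^esub> T)"

definition quotients :: "('o, 'a) semicat \<Rightarrow> ('o, 'a, 'u) form \<Rightarrow> 'a set" where
  "quotients C F = {p. \<exists>X\<in>Obj C. \<exists>K. normal C F X K \<and> is_quotient C F X K p}"

definition embeddings :: "('o, 'a) semicat \<Rightarrow> ('o, 'a, 'u) form \<Rightarrow> 'a set" where
  "embeddings C F = {i. \<exists>X\<in>Obj C. \<exists>S. conormal C F X S \<and> is_embedding C F X S i}"

definition induces :: "('o, 'a) semicat \<Rightarrow> ('o, 'a, 'u) form \<Rightarrow> 'a set \<Rightarrow> 'a set \<Rightarrow> bool" where
  "induces C F E M \<longleftrightarrow> proper_factorization_system C E M \<and>
     quotients C F = E \<and> embeddings C F = M"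

section \<open>Algebraic and modular lattices\<close>

definition compact_element :: "'c gorder \<Rightarrow> 'c \<Rightarrow> bool" where
  "compact_element L x \<longleftrightarrow> x \<in> carrier L \<and>
     (\<forall>A \<subseteq> carrier L. x \<sqsubseteq>\<^bsub>L\<^esub> \<Squnion>\<^bsub>L\<^esub>A \<longrightarrow> (\<exists>B \<subseteq> A. finite B \<and> x \<sqsubseteq>\<^bsub>L\<^esub> \<Squnion>\<^bsub>L\<^esub>B))"

locale algebraic_lattice = complete_lattice L for L :: "'c gorder" (structure) +
  assumes join_of_compact: "x \<in> carrier L \<Longrightarrow> \<exists>K \<subseteq> Collect (compact_element L). x = \<Squnion>K"

locale modular_lattice = lattice L for L :: "'c gorder" (structure) +
  assumes modular: "x \<in> carrier L \<Longrightarrow> y \<in> carrier L \<Longrightarrow> z \<in> carrier L \<Longrightarrow> x \<sqsubseteq> z \<Longrightarrow>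
    x \<squnion> (y \<sqinter> z) = (x \<squnion> y) \<sqinter> z"

end

theory Submission
  imports Defs "HOL-Library.Poly_Mapping" "HOL-Library.Countable"
begin

text \<open>
  A functor \<open>V\<close> into abelian groups gives a form whose fibres are the subgroup lattices of the \<open>V X\<close>,
  with direct and inverse images; these lattices are algebraic and modular, and (N1) is automatic.
  Take \<open>V X\<close> to be the free abelian group on a set \<open>T X\<close>, with \<open>T\<close> a functor.  The image of
  \<open>f\<close> is then the subgroup generated by the image of \<open>T f\<close>, and its kernel is generated by the
  differences of points identified by \<open>T f\<close>, so (N2) and (N3) become statements about \<open>T\<close>.  What is
  needed is that \<open>T\<close> sends monomorphisms to injections and strong epimorphisms to surjections.

  Strong epimorphisms \<open>A \<rightarrow> B\<close> are not surjective on arrows: the arrows of \<open>B\<close> are merely composites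
  of images, possibly of arrows that do not compose in \<open>A\<close>.  This is repaired by letting \<open>T A\<close> consist of
  the objects of \<open>A\<close> and of the elements of the semigroup generated by the arrows of \<open>A\<close> subject to the
  relations of \<open>A\<close>.  Its elements have normal forms, the words without adjacent composable letters, which
  shows that \<open>T\<close> preserves injectivity.  The functors sending \<open>A\<close> to its set of objects and to its
  semigroup are left adjoints and so preserve pushouts; hence joins of kernels are kernels.
\<close>

section \<open>Closure properties of smallness\<close>

text \<open>Linearising serves to put images and kernels into one lattice: a subset of
  \<open>T X\<close> and an equivalence relation on \<open>T X\<close> both become subgroups, of
  combinations over the subset and of differences of related points. A sum of two kernels is then a
  kernel only if some morphism realises the join of the two equivalence relations exactly, and this
  is the hard point. Objects have to be points besides words, since words forget endpoints: a
  morphism can identify objects that carry no arrows, and gluing objects makes new pairs composable.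
  The arrows of the pushout are therefore cut out of triples of target class, word class and source
  class. Two estimates compare its kernel on words with the join: projecting to the middle component
  bounds it above, factoring through the given images bounds it below. The unit adjoined to the
  semigroup is the empty word, a point of every object fixed by all morphisms, hence harmless. The
  three cases differ only in identities and inverses, and these pass to whatever is generated by
  images, so one argument with two flags covers them.\<close>

lemma small_inj: "inj_on f A \<Longrightarrow> f ` A \<subseteq> B \<Longrightarrow> small U B \<Longrightarrow> small U A"
  unfolding small_def by (rule ordLeq_ordLess_trans[of _ "|B|"]) (auto simp flip: card_of_ordLeq)

lemma small_subset: "A \<subseteq> B \<Longrightarrow> small U B \<Longrightarrow> small U A"
  by (rule small_inj[of id]) auto

lemma small_image: "small U A \<Longrightarrow> small U (f ` A)"
  unfolding small_def by (rule ordLeq_ordLess_trans[OF card_of_image])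

lemma small_obtain_inj:
  assumes "small TYPE('u) (A :: 'a set)"
  obtains f :: "'a \<Rightarrow> 'u" where "inj_on f A"
proof -
  have "|A| \<le>o |UNIV :: 'u set|" using assms unfolding small_def by (rule ordLess_imp_ordLeq)
  then show ?thesis using that by (subst (asm) card_of_ordLeq[symmetric]) blast
qed

lemma universe_infinite: "universe TYPE('u) \<Longrightarrow> infinite (UNIV :: 'u set)"
  unfolding universe_def by (elim conjE exE) (rule infinite_super[OF subset_UNIV])

lemma small_nat: "universe TYPE('u) \<Longrightarrow> small TYPE('u) (A :: nat set)"
proof -
  assume "universe TYPE('u)"
  then obtain B :: "'u set" where "infinite B" "small TYPE('u) B" unfolding universe_def by blast
  then have "|UNIV :: nat set| \<le>o |B|" "|B| <o |UNIV :: 'u set|"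
    by (simp_all add: infinite_iff_card_of_nat small_def)
  then have "small TYPE('u) (UNIV :: nat set)" unfolding small_def by (rule ordLeq_ordLess_trans)
  then show ?thesis by (rule small_subset[OF subset_UNIV])
qed

lemma small_int: "universe TYPE('u) \<Longrightarrow> small TYPE('u) (A :: int set)"
proof -
  assume U: "universe TYPE('u)"
  have "inj_on to_nat A" by (rule inj_on_subset[OF inj_to_nat]) simp
  then show ?thesis by (rule small_inj[OF _ subset_UNIV small_nat[OF U]])
qed

lemma small_Plus:
  "universe TYPE('u) \<Longrightarrow> small TYPE('u) A \<Longrightarrow> small TYPE('u) B \<Longrightarrow> small TYPE('u) (A <+> B)"
  using card_of_Plus_ordLess_infinite[OF universe_infinite] unfolding small_def by blast

lemma small_Pow:
  assumes "universe TYPE('u)" "small TYPE('u) (A :: 'a set)"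
  shows "small TYPE('u) (Pow A)"
proof -
  obtain f :: "'a \<Rightarrow> 'u" where f: "inj_on f A" using small_obtain_inj[OF assms(2)] .
  have "small TYPE('u) (Pow (f ` A))"
    using assms small_image[OF assms(2), of f] unfolding universe_def by blast
  show ?thesis
  proof (rule small_inj)
    show "inj_on (image f) (Pow A)" using f by (rule inj_on_image_Pow)
    show "image f ` Pow A \<subseteq> Pow (f ` A)" by blast
  qed fact
qed

text \<open>Reduces to power sets: a pair is coded as the subset \<open>{Inl a, Inr b}\<close> of
  the disjoint sum, where the tags keep the order.\<close>

lemma small_Times:
  assumes U: "universe TYPE('u)" and "small TYPE('u) A" "small TYPE('u) B"
  shows "small TYPE('u) (A \<times> B)"
  by (rule small_inj[where f = "\<lambda>(a, b). {Inl a, Inr b}", OF _ _ small_Pow[OF U small_Plus[OF assms]]])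
    (auto simp: inj_on_def doubleton_eq_iff)

text \<open>A word is determined by its length and its graph, and such pairs live in a product of
  sets already known to be small.\<close>

lemma small_lists:
  assumes U: "universe TYPE('u)" and A: "small TYPE('u) A"
  shows "small TYPE('u) (lists A)"
proof (rule small_inj)
  let ?f = "\<lambda>w :: 'a list. (length w, (\<lambda>i. (i, w ! i)) ` {..<length w})"
  show "inj_on ?f (lists A)"
  proof (rule inj_onI)
    fix v w :: "'a list" assume eq: "?f v = ?f w"
    then have len: "length v = length w" by simp
    show "v = w"
    proof (rule nth_equalityI[OF len])
      fix i assume i: "i < length v"
      then have "(i, v ! i) \<in> snd (?f v)" by simp
      then have "(i, v ! i) \<in> snd (?f w)" unfolding eq .
      then show "v ! i = w ! i" by auto
    qed
  qed
  show "?f ` lists A \<subseteq> (UNIV :: nat set) \<times> Pow ((UNIV :: nat set) \<times> A)"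
    by (auto simp: in_lists_conv_set)
  show "small TYPE('u) ((UNIV :: nat set) \<times> Pow ((UNIV :: nat set) \<times> A))"
    by (intro small_Pow small_Times small_nat U A)
qed

text \<open>Coefficients vanish off \<open>A\<close>, so the graph over \<open>A\<close> determines
  an element. This keeps the free abelian groups, and then their sets of subgroups, within the
  universe.\<close>

lemma small_frag:
  assumes U: "universe TYPE('u)" and A: "small TYPE('u) A"
  shows "small TYPE('u) {c :: 'c \<Rightarrow>\<^sub>0 int. Poly_Mapping.keys c \<subseteq> A}"
proof (rule small_inj)
  let ?f = "\<lambda>c :: 'c \<Rightarrow>\<^sub>0 int. (\<lambda>x. (x, Poly_Mapping.lookup c x)) ` A"
  show "inj_on ?f {c. Poly_Mapping.keys c \<subseteq> A}"
  proof (rule inj_onI, rule poly_mapping_eqI)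
    fix c d :: "'c \<Rightarrow>\<^sub>0 int" and x
    assume cd: "c \<in> {c. Poly_Mapping.keys c \<subseteq> A}" "d \<in> {c. Poly_Mapping.keys c \<subseteq> A}" "?f c = ?f d"
    show "Poly_Mapping.lookup c x = Poly_Mapping.lookup d x"
    proof (cases "x \<in> A")
      case True
      then have "(x, Poly_Mapping.lookup c x) \<in> ?f c" by blast
      then have "(x, Poly_Mapping.lookup c x) \<in> ?f d" unfolding cd(3) .
      then show ?thesis by blast
    next
      case False
      then have "x \<notin> Poly_Mapping.keys c" "x \<notin> Poly_Mapping.keys d" using cd by auto
      then show ?thesis by (simp add: in_keys_iff)
    qed
  qed
  show "?f ` {c. Poly_Mapping.keys c \<subseteq> A} \<subseteq> Pow (A \<times> (UNIV :: int set))" by blast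
  show "small TYPE('u) (Pow (A \<times> (UNIV :: int set)))" by (intro small_Pow small_Times small_int U A)
qed

section \<open>Lattices of subgroups\<close>

text \<open>The one-step subgroup test. \<open>G\<close> is an arbitrary bounding set here; that it
  is a group itself is expressed by \<open>G \<in> subgroups_of G\<close>.\<close>

definition subgroups_of :: "'g :: ab_group_add set \<Rightarrow> 'g set set" where
  "subgroups_of G = {S. S \<subseteq> G \<and> 0 \<in> S \<and> (\<forall>a\<in>S. \<forall>b\<in>S. a - b \<in> S)}"

lemma subgroups_ofI:
  "S \<subseteq> G \<Longrightarrow> 0 \<in> S \<Longrightarrow> (\<And>a b. a \<in> S \<Longrightarrow> b \<in> S \<Longrightarrow> a - b \<in> S) \<Longrightarrow> S \<in> subgroups_of G"
  by (simp add: subgroups_of_def)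

lemma subgroups_ofD:
  assumes "S \<in> subgroups_of G"
  shows "S \<subseteq> G" "0 \<in> S" "a \<in> S \<Longrightarrow> b \<in> S \<Longrightarrow> a - b \<in> S"
  using assms by (auto simp: subgroups_of_def)

lemma subgroups_of_minus: "S \<in> subgroups_of G \<Longrightarrow> a \<in> S \<Longrightarrow> - a \<in> S"
  using subgroups_ofD(2)[of S G] subgroups_ofD(3)[of S G 0 a] by simp

lemma subgroups_of_add: "S \<in> subgroups_of G \<Longrightarrow> a \<in> S \<Longrightarrow> b \<in> S \<Longrightarrow> a + b \<in> S"
  using subgroups_ofD(3)[of S G a "- b"] subgroups_of_minus[of S G b] by simp

inductive_set gspan :: "'g :: ab_group_add set \<Rightarrow> 'g set" for S where
  zero: "0 \<in> gspan S"
| base: "a \<in> S \<Longrightarrow> a \<in> gspan S"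
| diff: "a \<in> gspan S \<Longrightarrow> b \<in> gspan S \<Longrightarrow> a - b \<in> gspan S"

lemma gspan_least: "T \<in> subgroups_of G \<Longrightarrow> S \<subseteq> T \<Longrightarrow> gspan S \<subseteq> T"
proof
  fix a assume "T \<in> subgroups_of G" "S \<subseteq> T" "a \<in> gspan S"
  show "a \<in> T"
    using \<open>a \<in> gspan S\<close> by induction (use \<open>T \<in> subgroups_of G\<close> \<open>S \<subseteq> T\<close> in \<open>auto dest: subgroups_ofD\<close>)
qed

lemma gspan_mono: "S \<subseteq> T \<Longrightarrow> gspan S \<subseteq> gspan T"
  by (rule gspan_least[of _ UNIV]) (auto intro: gspan.intros subgroups_ofI)

lemma gspan_subgroup: "G \<in> subgroups_of G \<Longrightarrow> S \<subseteq> G \<Longrightarrow> gspan S \<in> subgroups_of G"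
  by (rule subgroups_ofI) (auto intro: gspan.intros dest: gspan_least)

text \<open>A derivation of membership uses finitely many generators. This is the source of the
  compactness of cyclic subgroups.\<close>

lemma gspan_Union_finite:
  "a \<in> gspan (\<Union>A) \<Longrightarrow> \<exists>B\<subseteq>A. finite B \<and> a \<in> gspan (\<Union>B)"
proof (induction rule: gspan.induct)
  case zero
  show ?case by (intro exI[of _ "{}"]) (auto intro: gspan.zero)
next
  case (base a)
  then obtain S where "a \<in> S" "S \<in> A" by blast
  then show ?case by (intro exI[of _ "{S}"]) (auto intro: gspan.base)
next
  case (diff a b)
  then obtain B B' where B: "B \<subseteq> A" "finite B" "a \<in> gspan (\<Union>B)"
    "B' \<subseteq> A" "finite B'" "b \<in> gspan (\<Union>B')" by blast
  have "gspan (\<Union>B) \<subseteq> gspan (\<Union>(B \<union> B'))" "gspan (\<Union>B') \<subseteq> gspan (\<Union>(B \<union> B'))"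
    by (intro gspan_mono; blast)+
  then have "a - b \<in> gspan (\<Union>(B \<union> B'))" using B by (auto intro: gspan.diff)
  with B show ?case by (intro exI[of _ "B \<union> B'"]) simp
qed

definition gsum :: "'g :: ab_group_add set \<Rightarrow> 'g set \<Rightarrow> 'g set" where
  "gsum S T = {a + b |a b. a \<in> S \<and> b \<in> T}"

lemma gsum_subgroup:
  assumes "G \<in> subgroups_of G" "S \<in> subgroups_of G" "T \<in> subgroups_of G"
  shows "gsum S T \<in> subgroups_of G"
proof (rule subgroups_ofI)
  show "gsum S T \<subseteq> G"
    using subgroups_ofD(1)[OF assms(2)] subgroups_ofD(1)[OF assms(3)] subgroups_of_add[OF assms(1)]
    by (auto simp: gsum_def)
  show "0 \<in> gsum S T"
    unfolding gsum_def using subgroups_ofD(2)[OF assms(2)] subgroups_ofD(2)[OF assms(3)] by force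
  fix a b assume "a \<in> gsum S T" "b \<in> gsum S T"
  then obtain s t s' t' where st: "s \<in> S" "t \<in> T" "s' \<in> S" "t' \<in> T" "a = s + t" "b = s' + t'"
    by (auto simp: gsum_def)
  then have "a - b = (s - s') + (t - t')" by simp
  moreover have "s - s' \<in> S" "t - t' \<in> T"
    using st subgroups_ofD(3) assms by blast+
  ultimately show "a - b \<in> gsum S T" unfolding gsum_def by blast
qed

text \<open>The group is abelian, so sums of elements of two subgroups form a subgroup. Binary joins
  thus have the explicit form on which (N1) and modularity rest.\<close>

lemma gspan_Un:
  assumes "G \<in> subgroups_of G" "S \<in> subgroups_of G" "T \<in> subgroups_of G"
  shows "gspan (S \<union> T) = gsum S T"
proof
  have "S \<subseteq> gsum S T" unfolding gsum_def using subgroups_ofD(2)[OF assms(3)] by force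
  moreover have "T \<subseteq> gsum S T" unfolding gsum_def using subgroups_ofD(2)[OF assms(2)] by force
  ultimately show "gspan (S \<union> T) \<subseteq> gsum S T" by (intro gspan_least[OF gsum_subgroup[OF assms]]) simp
  have "gspan (S \<union> T) \<in> subgroups_of UNIV"
    by (auto intro: gspan.intros subgroups_ofI)
  then show "gsum S T \<subseteq> gspan (S \<union> T)"
    unfolding gsum_def by (auto intro!: subgroups_of_add[of "gspan (S \<union> T)" UNIV] intro: gspan.base)
qed

text \<open>The clusters of a form are elements of \<open>'u\<close>, so the lattice of subgroups is transported along an
  injection \<open>enc\<close> into \<open>'u\<close>.\<close>

definition sublattice :: "('g :: ab_group_add set \<Rightarrow> 'u) \<Rightarrow> 'g set \<Rightarrow> 'u gorder" where
  "sublattice enc G = \<lparr>carrier = enc ` subgroups_of G, eq = (=),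
     le = \<lambda>a b. inv_into (subgroups_of G) enc a \<subseteq> inv_into (subgroups_of G) enc b\<rparr>"

locale encoded_subgroups =
  fixes G :: "'g :: ab_group_add set" and enc :: "'g set \<Rightarrow> 'u"
  assumes G_subgroup: "G \<in> subgroups_of G"
    and enc_inj: "inj_on enc (subgroups_of G)"
begin

abbreviation (input) "L \<equiv> sublattice enc G"

lemma carrier_L [simp]: "carrier L = enc ` subgroups_of G"
  by (simp add: sublattice_def)

lemma eq_L [simp]: "eq L = (=)"
  by (simp add: sublattice_def)

lemma dec_enc: "S \<in> subgroups_of G \<Longrightarrow> inv_into (subgroups_of G) enc (enc S) = S"
  by (rule inv_into_f_f[OF enc_inj])

lemma le_L [simp]:
  "S \<in> subgroups_of G \<Longrightarrow> T \<in> subgroups_of G \<Longrightarrow> enc S \<sqsubseteq>\<^bsub>L\<^esub> enc T \<longleftrightarrow> S \<subseteq> T"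
  by (simp add: sublattice_def dec_enc)

lemma zero_subgroup [simp]: "{0} \<in> subgroups_of G"
  using subgroups_ofD[OF G_subgroup] by (intro subgroups_ofI) auto

lemma po: "partial_order L"
  by unfold_locales (auto simp: set_eq_def)

lemma lub:
  assumes "A \<subseteq> subgroups_of G"
  shows "is_lub L (enc (gspan (\<Union>A))) (enc ` A)"
proof (rule least_UpperI)
  have "\<Union>A \<subseteq> G" using assms by (auto dest: subgroups_ofD)
  then have span: "gspan (\<Union>A) \<in> subgroups_of G" by (rule gspan_subgroup[OF G_subgroup])
  show "enc (gspan (\<Union>A)) \<in> carrier L" using span by simp
  show "enc ` A \<subseteq> carrier L" using assms by auto
  show "x \<sqsubseteq>\<^bsub>L\<^esub> enc (gspan (\<Union>A))" if x: "x \<in> enc ` A" for x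
  proof -
    obtain S where "S \<in> A" "x = enc S" using x by blast
    moreover have "S \<subseteq> gspan (\<Union>A)" using \<open>S \<in> A\<close> by (auto intro: gspan.base)
    ultimately show ?thesis using assms span by auto
  qed
  fix y assume y: "y \<in> Upper L (enc ` A)"
  then obtain T where T: "y = enc T" "T \<in> subgroups_of G" by (auto simp: Upper_def)
  have "\<Union>A \<subseteq> T" using y T assms by (auto simp: Upper_def subset_iff)
  then show "enc (gspan (\<Union>A)) \<sqsubseteq>\<^bsub>L\<^esub> y"
    using T span by (simp add: gspan_least)
qed

text \<open>Intersecting with \<open>G\<close> matters for the empty family, whose intersection is
  the whole type while its greatest lower bound must be \<open>G\<close>.\<close>

lemma glb:
  assumes "A \<subseteq> subgroups_of G"
  shows "is_glb L (enc (G \<inter> \<Inter>A)) (enc ` A)"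
proof (rule greatest_LowerI)
  have int: "G \<inter> \<Inter>A \<in> subgroups_of G"
    using assms subgroups_ofD[OF G_subgroup] by (auto simp: subgroups_of_def subset_iff)
  show "enc (G \<inter> \<Inter>A) \<in> carrier L" using int by simp
  show "enc ` A \<subseteq> carrier L" using assms by auto
  show "enc (G \<inter> \<Inter>A) \<sqsubseteq>\<^bsub>L\<^esub> x" if x: "x \<in> enc ` A" for x
  proof -
    obtain S where "S \<in> A" "x = enc S" using x by blast
    then show ?thesis using assms int by (simp add: subset_iff)
  qed
  fix y assume y: "y \<in> Lower L (enc ` A)"
  then obtain T where T: "y = enc T" "T \<in> subgroups_of G" by (auto simp: Lower_def)
  have "T \<subseteq> G \<inter> \<Inter>A" using y T assms by (auto simp: Lower_def subset_iff dest: subgroups_ofD)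
  then show "y \<sqsubseteq>\<^bsub>L\<^esub> enc (G \<inter> \<Inter>A)" using T int by simp
qed

lemma complete: "complete_lattice L"
proof (rule partial_order.complete_latticeI[OF po])
  fix A assume "A \<subseteq> carrier L"
  then obtain B where "B \<subseteq> subgroups_of G" "A = enc ` B" by (auto simp: subset_image_iff)
  then show "\<exists>s. is_lub L s A" "\<exists>s. is_glb L s A" using lub glb by blast+
qed

sublocale complete_lattice L
  by (rule complete)

lemma Sup_enc: "A \<subseteq> subgroups_of G \<Longrightarrow> \<Squnion>\<^bsub>L\<^esub>(enc ` A) = enc (gspan (\<Union>A))"
  by (rule least_unique[OF sup_lub lub]) auto

lemma join_enc:
  assumes "S \<in> subgroups_of G" "T \<in> subgroups_of G"
  shows "enc S \<squnion>\<^bsub>L\<^esub> enc T = enc (gsum S T)"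
proof -
  have "\<Squnion>\<^bsub>L\<^esub>(enc ` {S, T}) = enc (gspan (\<Union>{S, T}))" by (rule Sup_enc) (use assms in auto)
  then show ?thesis using gspan_Un[OF G_subgroup assms] by (simp add: join_def)
qed

lemma meet_enc:
  assumes "S \<in> subgroups_of G" "T \<in> subgroups_of G"
  shows "enc S \<sqinter>\<^bsub>L\<^esub> enc T = enc (S \<inter> T)"
proof -
  have "\<Sqinter>\<^bsub>L\<^esub>(enc ` {S, T}) = enc (G \<inter> \<Inter>{S, T})"
    by (rule greatest_unique[OF inf_glb glb]) (use assms in auto)
  moreover have "G \<inter> \<Inter>{S, T} = S \<inter> T" using assms by (auto dest: subgroups_ofD)
  ultimately show ?thesis by (simp add: meet_def)
qed

lemma bounded: "bounded_lattice L"
  by unfold_locales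

lemma top_enc: "\<top>\<^bsub>L\<^esub> = enc G"
proof (rule bounded_lattice.top_eq[OF bounded, symmetric])
  show "enc G \<in> carrier L" using G_subgroup by simp
  fix x assume "x \<in> carrier L"
  then obtain S where "S \<in> subgroups_of G" "x = enc S" by auto
  then show "x \<sqsubseteq>\<^bsub>L\<^esub> enc G" using G_subgroup subgroups_ofD(1) by simp
qed

lemma bottom_enc: "\<bottom>\<^bsub>L\<^esub> = enc {0}"
proof (rule bounded_lattice.bottom_eq[OF bounded, symmetric])
  show "enc {0} \<in> carrier L" by simp
  fix x assume "x \<in> carrier L"
  then obtain S where "S \<in> subgroups_of G" "x = enc S" by auto
  then show "enc {0} \<sqsubseteq>\<^bsub>L\<^esub> x" using subgroups_ofD(2) by simp
qed

text \<open>The generator lies in the join of finitely many members of the family, and a subgroup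
  containing the generator contains the cyclic subgroup.\<close>

lemma cyclic_compact:
  assumes "a \<in> G"
  shows "compact_element L (enc (gspan {a}))"
proof -
  have sub: "gspan {a} \<in> subgroups_of G"
    using assms by (intro gspan_subgroup[OF G_subgroup]) simp
  have "\<exists>B\<subseteq>A. finite B \<and> enc (gspan {a}) \<sqsubseteq>\<^bsub>L\<^esub> \<Squnion>\<^bsub>L\<^esub>B"
    if A: "A \<subseteq> carrier L" "enc (gspan {a}) \<sqsubseteq>\<^bsub>L\<^esub> \<Squnion>\<^bsub>L\<^esub>A" for A
  proof -
    obtain A' where A': "A' \<subseteq> subgroups_of G" "A = enc ` A'" using A(1) unfolding carrier_L subset_image_iff by blast
    have span: "gspan (\<Union>D) \<in> subgroups_of G" if "D \<subseteq> A'" for D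
      using A' that by (intro gspan_subgroup[OF G_subgroup]) (auto dest!: subgroups_ofD(1) subsetD)
    have "gspan {a} \<subseteq> gspan (\<Union>A')"
      using A(2) A' sub span[of A'] by (simp add: Sup_enc)
    then have "a \<in> gspan (\<Union>A')" by (auto intro: gspan.base)
    from gspan_Union_finite[OF this]
    obtain B where B: "B \<subseteq> A'" "finite B" "a \<in> gspan (\<Union>B)" by blast
    then have "gspan {a} \<subseteq> gspan (\<Union>B)" by (intro gspan_least[OF span]) auto
    then have "enc (gspan {a}) \<sqsubseteq>\<^bsub>L\<^esub> \<Squnion>\<^bsub>L\<^esub>(enc ` B)"
      using B A' sub span[of B] by (subst Sup_enc) auto
    then show ?thesis using B A' by (intro exI[of _ "enc ` B"]) auto
  qed
  then show ?thesis using sub unfolding compact_element_def by simp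
qed

lemma algebraic: "algebraic_lattice L"
proof (intro algebraic_lattice.intro complete algebraic_lattice_axioms.intro)
  fix x assume "x \<in> carrier L"
  then obtain S where S: "x = enc S" "S \<in> subgroups_of G" by auto
  let ?K = "(\<lambda>a. gspan {a}) ` S"
  have S_G: "S \<subseteq> G" using S subgroups_ofD by blast
  have K: "?K \<subseteq> subgroups_of G"
    using S_G by (auto intro!: gspan_subgroup[OF G_subgroup])
  have "gspan (\<Union>?K) = S"
  proof
    show "gspan (\<Union>?K) \<subseteq> S" by (intro gspan_least[OF S(2)]) (use gspan_least[OF S(2)] in blast)
    show "S \<subseteq> gspan (\<Union>?K)" by (auto intro: gspan.base)
  qed
  then have "x = \<Squnion>\<^bsub>L\<^esub>(enc ` ?K)" using Sup_enc[OF K] S by simp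
  moreover have "enc ` ?K \<subseteq> Collect (compact_element L)" using S_G cyclic_compact by auto
  ultimately show "\<exists>K\<subseteq>Collect (compact_element L). x = \<Squnion>\<^bsub>L\<^esub>K" by blast
qed

lemma modular_law:
  assumes "S \<in> subgroups_of G" "T \<in> subgroups_of G" "R \<in> subgroups_of G" "S \<subseteq> R"
  shows "gsum S (T \<inter> R) = gsum S T \<inter> R"
proof
  show "gsum S (T \<inter> R) \<subseteq> gsum S T \<inter> R"
    using assms by (auto simp: gsum_def intro: subgroups_of_add[OF assms(3)])
  show "gsum S T \<inter> R \<subseteq> gsum S (T \<inter> R)"
  proof
    fix a assume "a \<in> gsum S T \<inter> R"
    then obtain s t where st: "s \<in> S" "t \<in> T" "a = s + t" "s + t \<in> R" by (auto simp: gsum_def)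
    \<comment> \<open>Since \<open>S \<subseteq> R\<close>, the summand \<open>s\<close> can be
      subtracted within \<open>R\<close>, which leaves \<open>t\<close> in \<open>R\<close>.\<close>
    then have "s + t - s \<in> R" using assms by (intro subgroups_ofD(3)[OF assms(3)]) auto
    then show "a \<in> gsum S (T \<inter> R)" using st by (auto simp: gsum_def)
  qed
qed

lemma modular: "modular_lattice L"
proof (intro modular_lattice.intro modular_lattice_axioms.intro)
  show "lattice L" by unfold_locales
  fix x y z
  assume "x \<in> carrier L" "y \<in> carrier L" "z \<in> carrier L" and le: "x \<sqsubseteq>\<^bsub>L\<^esub> z"
  then obtain S T R where STR: "S \<in> subgroups_of G" "T \<in> subgroups_of G" "R \<in> subgroups_of G"
    "x = enc S" "y = enc T" "z = enc R" by auto
  moreover have "T \<inter> R \<in> subgroups_of G"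
    using STR by (intro subgroups_ofI) (auto dest: subgroups_ofD)
  moreover have "S \<subseteq> R" using le STR by simp
  ultimately show "x \<squnion>\<^bsub>L\<^esub> (y \<sqinter>\<^bsub>L\<^esub> z) = (x \<squnion>\<^bsub>L\<^esub> y) \<sqinter>\<^bsub>L\<^esub> z"
    using modular_law by (simp add: meet_enc join_enc gsum_subgroup[OF G_subgroup])
qed

end

section \<open>Forms in which every monomorphism is an embedding\<close>

lemma is_ident_unique:
  assumes i: "is_ident C X i" and j: "is_ident C X j"
  shows "i = j"
proof -
  have "Cmp C i j = i" "Cmp C i j = j" using i j unfolding is_ident_def Hom_def by blast+
  then show "i = j" by simp
qed

lemma Ident_eqI: "is_ident C X i \<Longrightarrow> Ident C X = i"
  unfolding Ident_def by (blast intro: is_ident_unique)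

lemma HomI: "f \<in> Arr C \<Longrightarrow> f \<in> Hom C (Src C f) (Tgt C f)"
  by (simp add: Hom_def)

lemma HomD:
  assumes "f \<in> Hom C X Y"
  shows "f \<in> Arr C" "Src C f = X" "Tgt C f = Y"
  using assms by (simp_all add: Hom_def)

lemma (in semicategory) Hom_Obj:
  assumes "f \<in> Hom C X Y"
  shows "X \<in> Obj C" "Y \<in> Obj C"
  using assms Src_closed Tgt_closed by (auto simp: Hom_def)

context category
begin

lemma Ident_is_ident: "X \<in> Obj C \<Longrightarrow> is_ident C X (Ident C X)"
  using ident_exists Ident_eqI by metis

lemma Ident_Hom: "X \<in> Obj C \<Longrightarrow> Ident C X \<in> Hom C X X"
  using Ident_is_ident by (simp add: is_ident_def)

lemma Cmp_Ident: "f \<in> Hom C X Y \<Longrightarrow> Cmp C f (Ident C X) = f"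
  using Ident_is_ident[of X] Hom_Obj by (auto simp: is_ident_def Hom_def)

lemma Ident_Cmp: "f \<in> Hom C X Y \<Longrightarrow> Cmp C (Ident C Y) f = f"
  using Ident_is_ident[of Y] Hom_Obj by (auto simp: is_ident_def Hom_def)

lemma monicsI:
  assumes "m \<in> Hom C X Y"
    and "\<And>W u v. u \<in> Hom C W X \<Longrightarrow> v \<in> Hom C W X \<Longrightarrow> Cmp C m u = Cmp C m v \<Longrightarrow> u = v"
  shows "m \<in> monics C"
  unfolding monics_def
proof (intro CollectI conjI ballI impI)
  show "m \<in> Arr C" using HomD[OF assms(1)] by simp
  fix u v assume "u \<in> Arr C" "v \<in> Arr C" "Src C u = Src C v" "Tgt C u = Src C m" "Tgt C v = Src C m"
    "Cmp C m u = Cmp C m v"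
  then show "u = v" using HomD[OF assms(1)] by (intro assms(2)[of u "Src C v" v]) (auto simp: Hom_def)
qed

lemma monicsD:
  assumes "m \<in> monics C"
  shows "m \<in> Arr C" "m \<in> Hom C X Y \<Longrightarrow> u \<in> Hom C W X \<Longrightarrow> v \<in> Hom C W X \<Longrightarrow> Cmp C m u = Cmp C m v \<Longrightarrow> u = v"
  using assms unfolding monics_def by (auto simp: Hom_def)

lemma epicsI:
  assumes "e \<in> Hom C X Y"
    and "\<And>W u v. u \<in> Hom C Y W \<Longrightarrow> v \<in> Hom C Y W \<Longrightarrow> Cmp C u e = Cmp C v e \<Longrightarrow> u = v"
  shows "e \<in> epics C"
  unfolding epics_def
proof (intro CollectI conjI ballI impI)
  show "e \<in> Arr C" using HomD[OF assms(1)] by simp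
  fix u v assume "u \<in> Arr C" "v \<in> Arr C" "Tgt C u = Tgt C v" "Src C u = Tgt C e" "Src C v = Tgt C e"
    "Cmp C u e = Cmp C v e"
  then show "u = v" using HomD[OF assms(1)] by (intro assms(2)[of u "Tgt C v" v]) (auto simp: Hom_def)
qed

lemma epicsD:
  assumes "e \<in> epics C"
  shows "e \<in> Arr C" "e \<in> Hom C X Y \<Longrightarrow> u \<in> Hom C Y W \<Longrightarrow> v \<in> Hom C Y W \<Longrightarrow> Cmp C u e = Cmp C v e \<Longrightarrow> u = v"
  using assms unfolding epics_def by (auto simp: Hom_def)

lemma strong_epicsD:
  assumes "e \<in> strong_epics C" "m \<in> monics C" "e \<in> Hom C X Y" "m \<in> Hom C Z W"
    "u \<in> Hom C X Z" "v \<in> Hom C Y W" "Cmp C v e = Cmp C m u"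
  obtains d where "d \<in> Hom C Y Z" "Cmp C d e = u" "Cmp C m d = v"
proof -
  have "square C e m u v"
    using assms HomD[OF assms(3)] HomD[OF assms(4)] by (simp add: square_def)
  then obtain d where "diagonal C e m u v d"
    using assms(1,2) unfolding strong_epics_def by blast
  then show thesis
    using that HomD[OF assms(3)] HomD[OF assms(4)] unfolding diagonal_def by blast
qed

lemma strong_epicsI:
  assumes "e \<in> epics C" "e \<in> Hom C X Y"
    and "\<And>Z W m u v. m \<in> monics C \<Longrightarrow> m \<in> Hom C Z W \<Longrightarrow> u \<in> Hom C X Z \<Longrightarrow> v \<in> Hom C Y W \<Longrightarrow>
      Cmp C v e = Cmp C m u \<Longrightarrow> \<exists>d. d \<in> Hom C Y Z \<and> Cmp C d e = u \<and> Cmp C m d = v"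
  shows "e \<in> strong_epics C"
  unfolding strong_epics_def square_def diagonal_def
proof (intro CollectI conjI ballI allI impI)
  show "e \<in> epics C" by fact
  fix m u v
  assume m: "m \<in> monics C"
    and "u \<in> Hom C (Src C e) (Src C m) \<and> v \<in> Hom C (Tgt C e) (Tgt C m) \<and> Cmp C v e = Cmp C m u"
  then show "\<exists>d. d \<in> Hom C (Tgt C e) (Src C m) \<and> Cmp C d e = u \<and> Cmp C m d = v"
    using assms(3)[OF m HomI[OF monicsD(1)[OF m]]] HomD[OF assms(2)] by simp
qed

lemma iso_monic:
  assumes "is_iso C f" shows "f \<in> monics C"
proof -
  have f: "f \<in> Hom C (Src C f) (Tgt C f)" using assms by (simp add: is_iso_def HomI)
  obtain g where g: "g \<in> Hom C (Tgt C f) (Src C f)"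
    and gf: "Cmp C g f = Ident C (Src C f)"
    using assms unfolding is_iso_def by blast
  show ?thesis
  proof (rule monicsI[OF f])
    fix W u v assume u: "u \<in> Hom C W (Src C f)" and v: "v \<in> Hom C W (Src C f)" and eq: "Cmp C f u = Cmp C f v"
    have "u = Cmp C g (Cmp C f u)" using Cmp_assoc[OF u f g] gf Ident_Cmp[OF u] by simp
    also have "\<dots> = v" unfolding eq using Cmp_assoc[OF v f g] gf Ident_Cmp[OF v] by simp
    finally show "u = v" .
  qed
qed

lemma iso_strong_epic:
  assumes "is_iso C f" shows "f \<in> strong_epics C"
proof -
  have f: "f \<in> Hom C (Src C f) (Tgt C f)" using assms by (simp add: is_iso_def HomI)
  obtain g where g: "g \<in> Hom C (Tgt C f) (Src C f)"
    and gf: "Cmp C g f = Ident C (Src C f)" and fg: "Cmp C f g = Ident C (Tgt C f)"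
    using assms unfolding is_iso_def by blast
  have "f \<in> epics C"
  proof (rule epicsI[OF f])
    fix W u v assume u: "u \<in> Hom C (Tgt C f) W" and v: "v \<in> Hom C (Tgt C f) W" and eq: "Cmp C u f = Cmp C v f"
    have "u = Cmp C (Cmp C u f) g" using Cmp_assoc[OF g f u] fg Cmp_Ident[OF u] by simp
    also have "\<dots> = v" unfolding eq using Cmp_assoc[OF g f v] fg Cmp_Ident[OF v] by simp
    finally show "u = v" .
  qed
  then show ?thesis
  proof (rule strong_epicsI[OF _ f])
    fix Z W m u v
    assume m: "m \<in> Hom C Z W" and u: "u \<in> Hom C (Src C f) Z" and v: "v \<in> Hom C (Tgt C f) W"
      and eq: "Cmp C v f = Cmp C m u"
    \<comment> \<open>The diagonal is \<open>u\<close> after the inverse \<open>g\<close> of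
      \<open>f\<close>.\<close>
    have "Cmp C (Cmp C u g) f = u" using Cmp_assoc[OF f g u] gf Cmp_Ident[OF u] by simp
    moreover have "Cmp C m (Cmp C u g) = v"
      using Cmp_assoc[OF g u m] Cmp_assoc[OF g f v] eq fg Cmp_Ident[OF v] by simp
    ultimately show "\<exists>d. d \<in> Hom C (Tgt C f) Z \<and> Cmp C d f = u \<and> Cmp C m d = v"
      using Cmp_closed[OF g u] by blast
  qed
qed

lemma monics_Cmp:
  assumes "f \<in> monics C" "g \<in> monics C" "f \<in> Hom C X Y" "g \<in> Hom C Y Z"
  shows "Cmp C g f \<in> monics C"
proof (rule monicsI[OF Cmp_closed[OF assms(3,4)]])
  fix W u v assume u: "u \<in> Hom C W X" and v: "v \<in> Hom C W X"
    and eq: "Cmp C (Cmp C g f) u = Cmp C (Cmp C g f) v"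
  then have "Cmp C g (Cmp C f u) = Cmp C g (Cmp C f v)"
    using Cmp_assoc[OF u assms(3,4)] Cmp_assoc[OF v assms(3,4)] by simp
  then have "Cmp C f u = Cmp C f v"
    by (rule monicsD(2)[OF assms(2,4) Cmp_closed[OF u assms(3)] Cmp_closed[OF v assms(3)]])
  then show "u = v" by (rule monicsD(2)[OF assms(1,3) u v])
qed

lemma epics_Cmp:
  assumes "f \<in> epics C" "g \<in> epics C" "f \<in> Hom C X Y" "g \<in> Hom C Y Z"
  shows "Cmp C g f \<in> epics C"
proof (rule epicsI[OF Cmp_closed[OF assms(3,4)]])
  fix W u v assume u: "u \<in> Hom C Z W" and v: "v \<in> Hom C Z W"
    and eq: "Cmp C u (Cmp C g f) = Cmp C v (Cmp C g f)"
  then have "Cmp C (Cmp C u g) f = Cmp C (Cmp C v g) f"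
    using Cmp_assoc[OF assms(3,4) u] Cmp_assoc[OF assms(3,4) v] by simp
  then have "Cmp C u g = Cmp C v g"
    by (rule epicsD(2)[OF assms(1,3) Cmp_closed[OF assms(4) u] Cmp_closed[OF assms(4) v]])
  then show "u = v" by (rule epicsD(2)[OF assms(2,4) u v])
qed

text \<open>Two liftings in succession: the diagonal obtained for \<open>f\<close> serves as the
  upper edge of the square for \<open>g\<close>.\<close>

lemma strong_epics_Cmp:
  assumes "f \<in> strong_epics C" "g \<in> strong_epics C" and f: "f \<in> Hom C X Y" and g: "g \<in> Hom C Y Z"
  shows "Cmp C g f \<in> strong_epics C"
proof (rule strong_epicsI)
  show "Cmp C g f \<in> epics C"
    using assms by (intro epics_Cmp[OF _ _ f g]) (auto simp: strong_epics_def)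
  show "Cmp C g f \<in> Hom C X Z" by (rule Cmp_closed[OF f g])
  fix V W m u v
  assume mm: "m \<in> monics C" and m: "m \<in> Hom C V W" and u: "u \<in> Hom C X V" and v: "v \<in> Hom C Z W"
    and eq: "Cmp C v (Cmp C g f) = Cmp C m u"
  have "Cmp C (Cmp C v g) f = Cmp C m u" using eq Cmp_assoc[OF f g v] by simp
  from strong_epicsD[OF assms(1) mm f m u Cmp_closed[OF g v] this]
  obtain d where d: "d \<in> Hom C Y V" "Cmp C d f = u" "Cmp C m d = Cmp C v g" .
  from strong_epicsD[OF assms(2) mm g m d(1) v d(3)[symmetric]]
  obtain d' where d': "d' \<in> Hom C Z V" "Cmp C d' g = d" "Cmp C m d' = v" .
  then show "\<exists>d. d \<in> Hom C Z V \<and> Cmp C d (Cmp C g f) = u \<and> Cmp C m d = v"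
    using d Cmp_assoc[OF f g d'(1)] by auto
qed

text \<open>Lifting is part of the definition of a strong epimorphism, and the diagonal is unique
  because \<open>m\<close> is monic. What remains to be supplied is the existence of
  factorizations.\<close>

lemma strong_epi_mono_factorization_system:
  assumes "\<And>f. f \<in> Arr C \<Longrightarrow> \<exists>e\<in>strong_epics C. \<exists>m\<in>monics C. Src C m = Tgt C e \<and> f = Cmp C m e"
  shows "proper_factorization_system C (strong_epics C) (monics C)"
proof unfold_locales
  show E: "strong_epics C \<subseteq> epics C" by (auto simp: strong_epics_def)
  then show "strong_epics C \<subseteq> Arr C" by (auto simp: epics_def)
  show "monics C \<subseteq> Arr C" by (auto simp: monics_def)
  fix f g e m u v
  show "is_iso C f \<Longrightarrow> f \<in> strong_epics C" "is_iso C f \<Longrightarrow> f \<in> monics C"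
    by (rule iso_strong_epic iso_monic; assumption)+
  show "f \<in> Arr C \<Longrightarrow> \<exists>e\<in>strong_epics C. \<exists>m\<in>monics C. Src C m = Tgt C e \<and> f = Cmp C m e" by (rule assms)
  { assume "f \<in> strong_epics C" "g \<in> strong_epics C" "Src C g = Tgt C f"
    then show "Cmp C g f \<in> strong_epics C"
      using \<open>strong_epics C \<subseteq> Arr C\<close> by (intro strong_epics_Cmp) (auto simp: Hom_def) }
  { assume "f \<in> monics C" "g \<in> monics C" "Src C g = Tgt C f"
    then show "Cmp C g f \<in> monics C"
      using \<open>monics C \<subseteq> Arr C\<close> by (intro monics_Cmp) (auto simp: Hom_def) }
  assume e: "e \<in> strong_epics C" and m: "m \<in> monics C" and sq: "square C e m u v"
  then obtain d where d: "diagonal C e m u v d" unfolding strong_epics_def by blast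
  moreover have "d' = d" if "diagonal C e m u v d'" for d'
    using that d monicsD(2)[OF m HomI[OF monicsD(1)[OF m]], of d' "Tgt C e" d]
    unfolding diagonal_def by simp
  ultimately show "\<exists>!d. diagonal C e m u v d" by blast
qed simp

end

section \<open>Quotients and embeddings of a noetherian form\<close>

context noetherian_form
begin

lemma top_carrier: "X \<in> Obj C \<Longrightarrow> \<top>\<^bsub>fib F X\<^esub> \<in> carrier (fib F X)"
  using fib_lattice[of X] by (metis bounded_lattice.axioms(3) weak_partial_order_top.top_closed)

lemma bottom_carrier: "X \<in> Obj C \<Longrightarrow> \<bottom>\<^bsub>fib F X\<^esub> \<in> carrier (fib F X)"
  using fib_lattice[of X] by (metis bounded_lattice.axioms(2) weak_partial_order_bottom.bottom_closed)

lemma le_top: "X \<in> Obj C \<Longrightarrow> S \<in> carrier (fib F X) \<Longrightarrow> S \<sqsubseteq>\<^bsub>fib F X\<^esub> \<top>\<^bsub>fib F X\<^esub>"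
  using fib_lattice[of X] by (metis bounded_lattice.axioms(3) weak_partial_order_top.top_higher)

lemma bottom_le: "X \<in> Obj C \<Longrightarrow> S \<in> carrier (fib F X) \<Longrightarrow> \<bottom>\<^bsub>fib F X\<^esub> \<sqsubseteq>\<^bsub>fib F X\<^esub> S"
  using fib_lattice[of X] by (metis bounded_lattice.axioms(2) weak_partial_order_bottom.bottom_lower)

lemma fib_antisym:
  assumes "X \<in> Obj C" "S \<in> carrier (fib F X)" "T \<in> carrier (fib F X)"
    "S \<sqsubseteq>\<^bsub>fib F X\<^esub> T" "T \<sqsubseteq>\<^bsub>fib F X\<^esub> S"
  shows "S = T"
proof -
  interpret bounded_lattice "fib F X" using fib_lattice[OF assms(1)] .
  show ?thesis using assms by (intro le_antisym)
qed

lemma fib_refl: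
  assumes "X \<in> Obj C" "S \<in> carrier (fib F X)"
  shows "S \<sqsubseteq>\<^bsub>fib F X\<^esub> S"
proof -
  interpret bounded_lattice "fib F X" using fib_lattice[OF assms(1)] .
  show ?thesis using assms by simp
qed

lemma Im_carrier: "f \<in> Hom C X Y \<Longrightarrow> Im C F f \<in> carrier (fib F Y)"
  using dimg_closed[of f X Y] top_carrier[of X] Hom_Obj[of f X Y] by (auto simp: Im_def dest: HomD)

lemma Ker_carrier: "f \<in> Hom C X Y \<Longrightarrow> Ker C F f \<in> carrier (fib F X)"
  using iimg_closed[of f X Y] bottom_carrier[of Y] Hom_Obj[of f X Y] by (auto simp: Ker_def dest: HomD)

lemma Im_Cmp_le:
  assumes f: "f \<in> Hom C X Y" and g: "g \<in> Hom C Y Z"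
  shows "Im C F (Cmp C g f) \<sqsubseteq>\<^bsub>fib F Z\<^esub> Im C F g"
proof -
  have "Im C F (Cmp C g f) = dimg F g (Im C F f)"
    using HomD[OF f] HomD[OF Cmp_closed[OF f g]] dimg_Cmp[OF f g top_carrier] Hom_Obj[OF f] by (simp add: Im_def)
  moreover have "Im C F g = dimg F g \<top>\<^bsub>fib F Y\<^esub>" using HomD[OF g] by (simp add: Im_def)
  ultimately show ?thesis
    using dimg_mono[OF g] Im_carrier[OF f] Hom_Obj[OF f] by (simp add: isotone_def top_carrier le_top)
qed

lemma Ker_Cmp_ge:
  assumes f: "f \<in> Hom C X Y" and g: "g \<in> Hom C Y Z"
  shows "Ker C F f \<sqsubseteq>\<^bsub>fib F X\<^esub> Ker C F (Cmp C g f)"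
proof -
  have "Ker C F (Cmp C g f) = iimg F f (Ker C F g)"
    using HomD[OF g] HomD[OF Cmp_closed[OF f g]] iimg_Cmp[OF f g bottom_carrier] Hom_Obj[OF g] by (simp add: Ker_def)
  moreover have "Ker C F f = iimg F f \<bottom>\<^bsub>fib F Y\<^esub>" using HomD[OF f] by (simp add: Ker_def)
  ultimately show ?thesis
    using iimg_mono[OF f] Ker_carrier[OF g] Hom_Obj[OF f] by (simp add: isotone_def bottom_carrier bottom_le)
qed

lemma Im_Ident: "X \<in> Obj C \<Longrightarrow> Im C F (Ident C X) = \<top>\<^bsub>fib F X\<^esub>"
  using HomD[OF Ident_Hom] by (simp add: Im_def dimg_Ident top_carrier)

lemma embedding_factor:
  assumes "is_embedding C F X S i" "i \<in> Hom C I X" "f \<in> Hom C W X" "Im C F f \<sqsubseteq>\<^bsub>fib F X\<^esub> S"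
  shows "\<exists>!h. h \<in> Hom C W I \<and> f = Cmp C i h"
  using assms unfolding is_embedding_def by (metis HomD)

lemma quotient_factor:
  assumes "is_quotient C F X K p" "p \<in> Hom C X Q" "f \<in> Hom C X W" "K \<sqsubseteq>\<^bsub>fib F X\<^esub> Ker C F f"
  shows "\<exists>!h. h \<in> Hom C Q W \<and> f = Cmp C h p"
  using assms unfolding is_quotient_def by (metis HomD)

text \<open>Both \<open>u\<close> and \<open>v\<close> factor the same morphism through
  \<open>i\<close>, and such factorizations are unique.\<close>

lemma embedding_monic:
  assumes "is_embedding C F X S i" shows "i \<in> monics C"
proof -
  have i: "i \<in> Hom C (Src C i) X" and S: "S = Im C F i" using assms by (auto simp: is_embedding_def Hom_def)
  show ?thesis
  proof (rule monicsI[OF i])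
    fix W u v assume u: "u \<in> Hom C W (Src C i)" and v: "v \<in> Hom C W (Src C i)" and eq: "Cmp C i u = Cmp C i v"
    show "u = v"
      using embedding_factor[OF assms i Cmp_closed[OF u i]] Im_Cmp_le[OF u i] u v eq S by blast
  qed
qed

lemma quotient_epic:
  assumes "is_quotient C F X K p" shows "p \<in> epics C"
proof -
  have p: "p \<in> Hom C X (Tgt C p)" and K: "K = Ker C F p" using assms by (auto simp: is_quotient_def Hom_def)
  show ?thesis
  proof (rule epicsI[OF p])
    fix W u v assume u: "u \<in> Hom C (Tgt C p) W" and v: "v \<in> Hom C (Tgt C p) W" and eq: "Cmp C u p = Cmp C v p"
    show "u = v"
      using quotient_factor[OF assms p Cmp_closed[OF p u]] Ker_Cmp_ge[OF p u] u v eq K by blast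
  qed
qed

text \<open>By (N2), \<open>p = m e\<close> with \<open>e\<close> a quotient of the same kernel, so
  \<open>e = h p\<close>. Cancelling the epimorphism \<open>p\<close> gives \<open>m h = 1\<close>;
  hence \<open>Im m\<close>, which equals \<open>Im p\<close>, is everything.\<close>

lemma quotient_Im:
  assumes "is_quotient C F X K p" shows "Im C F p = \<top>\<^bsub>fib F (Tgt C p)\<^esub>"
proof -
  have p: "p \<in> Hom C X (Tgt C p)" and K: "K = Ker C F p" using assms by (auto simp: is_quotient_def Hom_def)
  obtain e m where e: "is_quotient C F X K e" and m: "is_embedding C F (Tgt C p) (Im C F p) m"
    and em: "Src C m = Tgt C e" "p = Cmp C m e"
    using quotient_embedding[OF p] K by blast
  have e': "e \<in> Hom C X (Tgt C e)" using e by (auto simp: is_quotient_def Hom_def)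
  have m': "m \<in> Hom C (Tgt C e) (Tgt C p)" using m em by (auto simp: is_embedding_def Hom_def)
  have "K \<sqsubseteq>\<^bsub>fib F X\<^esub> Ker C F e" using e Ker_carrier[OF e'] Hom_Obj[OF p] by (simp add: is_quotient_def fib_refl)
  then obtain h where h: "h \<in> Hom C (Tgt C p) (Tgt C e)" "e = Cmp C h p"
    using quotient_factor[OF assms p e'] by blast
  have "Cmp C (Cmp C m h) p = Cmp C (Ident C (Tgt C p)) p"
    using Cmp_assoc[OF p h(1) m'] em(2)[symmetric] h(2)[symmetric] Ident_Cmp[OF p] by simp
  then have mh: "Cmp C m h = Ident C (Tgt C p)"
    using epicsD(2)[OF quotient_epic[OF assms] p Cmp_closed[OF h(1) m'] Ident_Hom] Hom_Obj[OF p] by simp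
  have "\<top>\<^bsub>fib F (Tgt C p)\<^esub> \<sqsubseteq>\<^bsub>fib F (Tgt C p)\<^esub> Im C F m"
    using Im_Cmp_le[OF h(1) m'] mh Im_Ident Hom_Obj[OF p] by simp
  moreover have "Im C F m = Im C F p" using m by (simp add: is_embedding_def)
  ultimately show ?thesis
    using fib_antisym[OF _ Im_carrier[OF p] top_carrier] le_top[OF _ Im_carrier[OF p]] Hom_Obj[OF p] by simp
qed

text \<open>A quotient \<open>p\<close> has full image, so in a square \<open>v p = m u\<close> the
  image of \<open>v\<close> equals that of \<open>v p\<close> and lies below \<open>Im m\<close>;
  the embedding \<open>m\<close> then yields the diagonal. Conversely, a strong epimorphism
  \<open>e = m q\<close>, factored by (N2), lifts against \<open>m\<close>; this gives
  \<open>d\<close> with \<open>d e = q\<close>, through which \<open>e\<close> inherits the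
  universal property of \<open>q\<close>.\<close>

lemma induces_strong_epics_monics:
  assumes M: "\<And>m. m \<in> monics C \<Longrightarrow> is_embedding C F (Tgt C m) (Im C F m) m"
  shows "induces C F (strong_epics C) (monics C)"
proof -
  have strong: "p \<in> strong_epics C" if p: "is_quotient C F X K p" for X K p
  proof (rule strong_epicsI[OF quotient_epic[OF p]])
    show p': "p \<in> Hom C X (Tgt C p)" using p by (simp add: is_quotient_def Hom_def)
    fix Z W m u v
    assume mm: "m \<in> monics C" and m: "m \<in> Hom C Z W" and u: "u \<in> Hom C X Z" and v: "v \<in> Hom C (Tgt C p) W"
      and eq: "Cmp C v p = Cmp C m u"
    have "Im C F v = Im C F (Cmp C v p)"
      using HomD[OF p'] HomD[OF v] HomD[OF Cmp_closed[OF p' v]] quotient_Im[OF p]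
        dimg_Cmp[OF p' v top_carrier] Hom_Obj[OF p'] by (simp add: Im_def)
    then have "Im C F v \<sqsubseteq>\<^bsub>fib F W\<^esub> Im C F m" using Im_Cmp_le[OF u m] eq by simp
    then obtain d where d: "d \<in> Hom C (Tgt C p) Z" "v = Cmp C m d"
      using embedding_factor[OF M[OF mm]] m v HomD[OF m] by blast
    have "Cmp C m (Cmp C d p) = Cmp C m u" using Cmp_assoc[OF p' d(1) m] d(2) eq by simp
    then have "Cmp C d p = u" by (rule monicsD(2)[OF mm m Cmp_closed[OF p' d(1)] u])
    then show "\<exists>d. d \<in> Hom C (Tgt C p) Z \<and> Cmp C d p = u \<and> Cmp C m d = v" using d by blast
  qed
  have fact: "\<exists>e\<in>strong_epics C. \<exists>m\<in>monics C. Src C m = Tgt C e \<and> f = Cmp C m e" if f: "f \<in> Arr C" for f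
    using quotient_embedding[OF HomI[OF f]] strong embedding_monic by blast
  have quot: "is_quotient C F (Src C e) (Ker C F e) e" if ee: "e \<in> strong_epics C" for e
  proof -
    have epi: "e \<in> epics C" using ee by (simp add: strong_epics_def)
    then have e: "e \<in> Hom C (Src C e) (Tgt C e)" by (simp add: epics_def HomI)
    obtain q m where q: "is_quotient C F (Src C e) (Ker C F e) q"
      and m: "is_embedding C F (Tgt C e) (Im C F e) m" and qm: "Src C m = Tgt C q" "e = Cmp C m q"
      using quotient_embedding[OF e] by blast
    have q': "q \<in> Hom C (Src C e) (Tgt C q)" using q by (auto simp: is_quotient_def Hom_def)
    have m': "m \<in> Hom C (Tgt C q) (Tgt C e)" using m qm by (auto simp: is_embedding_def Hom_def)
    have mm: "m \<in> monics C" by (rule embedding_monic[OF m])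
    have id: "Ident C (Tgt C e) \<in> Hom C (Tgt C e) (Tgt C e)" using Ident_Hom Hom_Obj[OF e] by simp
    have "Cmp C (Ident C (Tgt C e)) e = Cmp C m q" using Ident_Cmp[OF e] qm(2)[symmetric] by simp
    from strong_epicsD[OF ee mm e m' q' id this]
    obtain d where d: "d \<in> Hom C (Tgt C e) (Tgt C q)" "Cmp C d e = q" by blast
    show ?thesis
      unfolding is_quotient_def
    proof (intro conjI ballI impI refl)
      show "e \<in> Arr C" using HomD[OF e] by simp
      fix g assume g: "g \<in> Arr C" "Src C g = Src C e" "Ker C F e \<sqsubseteq>\<^bsub>fib F (Src C e)\<^esub> Ker C F g"
      then have g': "g \<in> Hom C (Src C e) (Tgt C g)" by (simp add: Hom_def)
      obtain h where h: "h \<in> Hom C (Tgt C q) (Tgt C g)" "g = Cmp C h q"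
        using quotient_factor[OF q q' g' g(3)] by blast
      have "g = Cmp C (Cmp C h d) e" using Cmp_assoc[OF e d(1) h(1)] h(2) d(2) by simp
      moreover have "k = k'" if "k \<in> Hom C (Tgt C e) (Tgt C g)" "k' \<in> Hom C (Tgt C e) (Tgt C g)"
        "g = Cmp C k e" "g = Cmp C k' e" for k k'
        using epicsD(2)[OF epi e that(1,2)] that(3,4) by simp
      ultimately show "\<exists>!h. h \<in> Hom C (Tgt C e) (Tgt C g) \<and> g = Cmp C h e"
        using Cmp_closed[OF d(1) h(1)] by blast
    qed
  qed
  have "quotients C F = strong_epics C"
  proof
    show "quotients C F \<subseteq> strong_epics C" using strong by (auto simp: quotients_def)
    show "strong_epics C \<subseteq> quotients C F"
    proof
      fix e assume e: "e \<in> strong_epics C"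
      then have "e \<in> Arr C" by (simp add: strong_epics_def epics_def)
      then show "e \<in> quotients C F"
        using quot[OF e] Src_closed unfolding quotients_def normal_def by blast
    qed
  qed
  moreover have "embeddings C F = monics C"
  proof
    show "embeddings C F \<subseteq> monics C" using embedding_monic by (auto simp: embeddings_def)
    show "monics C \<subseteq> embeddings C F"
    proof
      fix m assume m: "m \<in> monics C"
      then have "m \<in> Arr C" by (simp add: monics_def)
      then show "m \<in> embeddings C F"
        using M[OF m] Tgt_closed unfolding embeddings_def conormal_def by blast
    qed
  qed
  ultimately show ?thesis
    unfolding induces_def using strong_epi_mono_factorization_system[OF fact] by blast
qed

end

section \<open>The form of a set-valued representation\<close>

definition free_on :: "'c set \<Rightarrow> ('c \<Rightarrow>\<^sub>0 int) set" where
  "free_on T = {c. Poly_Mapping.keys c \<subseteq> T}"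

definition free_map :: "('c \<Rightarrow> 'd) \<Rightarrow> ('c \<Rightarrow>\<^sub>0 int) \<Rightarrow> ('d \<Rightarrow>\<^sub>0 int)" where
  "free_map f = frag_extend (frag_of \<circ> f)"

definition fkernel :: "'c set \<Rightarrow> ('c \<Rightarrow> 'd) \<Rightarrow> ('c \<Rightarrow>\<^sub>0 int) set" where
  "fkernel T f = {c \<in> free_on T. free_map f c = 0}"

lemma free_on_diff: "a \<in> free_on T \<Longrightarrow> b \<in> free_on T \<Longrightarrow> a - b \<in> free_on T"
  unfolding free_on_def using keys_diff[of a b] by blast

lemma free_on_zero: "0 \<in> free_on T"
  by (simp add: free_on_def)

lemma free_on_of: "frag_of x \<in> free_on T \<longleftrightarrow> x \<in> T"
  by (simp add: free_on_def)

lemma free_on_subgroup: "free_on T \<in> subgroups_of (free_on T)"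
  by (intro subgroups_ofI subset_refl free_on_zero free_on_diff)

lemma free_map_diff: "free_map f (a - b) = free_map f a - free_map f b"
  by (simp add: free_map_def frag_extend_diff)

lemma free_map_zero: "free_map f 0 = 0"
  by (simp add: free_map_def)

lemma free_map_of: "free_map f (frag_of x) = frag_of (f x)"
  by (simp add: free_map_def)

lemma free_map_add: "free_map f (a + b) = free_map f a + free_map f b"
  by (simp add: free_map_def frag_extend_add)

lemma free_map_cong: "c \<in> free_on T \<Longrightarrow> (\<And>x. x \<in> T \<Longrightarrow> f x = g x) \<Longrightarrow> free_map f c = free_map g c"
  unfolding free_map_def free_on_def by (rule frag_extend_eq) auto

lemma free_map_free_map: "free_map g (free_map f c) = free_map (g \<circ> f) c"
  by (simp add: free_map_def frag_extend_compose comp_assoc)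

lemma free_map_id: "c \<in> free_on T \<Longrightarrow> (\<And>x. x \<in> T \<Longrightarrow> f x = x) \<Longrightarrow> free_map f c = c"
  using free_map_cong[of c T f id] frag_expansion[of c] by (simp add: free_map_def)

lemma free_map_closed:
  assumes "c \<in> free_on T" "f ` T \<subseteq> T'"
  shows "free_map f c \<in> free_on T'"
proof -
  have "Poly_Mapping.keys (free_map f c) \<subseteq> (\<Union>x\<in>Poly_Mapping.keys c. Poly_Mapping.keys (frag_of (f x)))"
    unfolding free_map_def using keys_frag_extend[of "frag_of \<circ> f" c] by simp
  then show ?thesis using assms by (auto simp: free_on_def)
qed

text \<open>Combinations of image points are lifted along the section
  \<open>inv_into T f\<close>.\<close>

lemma free_map_image: "free_map f ` free_on T = free_on (f ` T)"
proof
  show "free_map f ` free_on T \<subseteq> free_on (f ` T)" using free_map_closed by blast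
  show "free_on (f ` T) \<subseteq> free_map f ` free_on T"
  proof
    fix c assume c: "c \<in> free_on (f ` T)"
    have "free_map f (free_map (inv_into T f) c) = c"
      unfolding free_map_free_map by (rule free_map_id[OF c]) (simp add: f_inv_into_f)
    moreover have "free_map (inv_into T f) c \<in> free_on T"
      by (rule free_map_closed[OF c]) (auto intro: inv_into_into)
    ultimately show "c \<in> free_map f ` free_on T" by force
  qed
qed

lemma free_on_subset_iff: "free_on S \<subseteq> free_on T \<longleftrightarrow> S \<subseteq> T"
proof
  assume sub: "free_on S \<subseteq> free_on T"
  show "S \<subseteq> T"
  proof
    fix x assume "x \<in> S"
    then have "frag_of x \<in> free_on S" by (simp only: free_on_of)
    with sub have "frag_of x \<in> free_on T" by (rule subsetD)
    then show "x \<in> T" by (simp only: free_on_of)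
  qed
next
  assume "S \<subseteq> T"
  then show "free_on S \<subseteq> free_on T" unfolding free_on_def by (intro Collect_mono impI) (rule subset_trans)
qed

lemma free_on_Int: "free_on (S \<inter> T) = free_on S \<inter> free_on T"
  by (auto simp: free_on_def)

lemma fkernel_subgroup: "fkernel T f \<in> subgroups_of (free_on T)"
  by (rule subgroups_ofI) (auto simp: fkernel_def free_map_zero free_map_diff free_on_zero free_on_diff)

lemma diff_in_fkernel:
  "x \<in> T \<Longrightarrow> y \<in> T \<Longrightarrow> frag_of x - frag_of y \<in> fkernel T f \<longleftrightarrow> f x = f y"
  by (simp add: fkernel_def free_on_diff free_on_of free_map_diff free_map_of frag_of_eq)

text \<open>Choosing a section of \<open>f\<close>, every \<open>c\<close> is congruent, modulo the differences of identified
  generators, to its image under an endomorphism that factors through \<open>f\<close>.\<close>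

lemma fkernel_eq_gspan:
  "fkernel T f = gspan {frag_of x - frag_of y |x y. x \<in> T \<and> y \<in> T \<and> f x = f y}"
  (is "_ = gspan ?D")
proof
  show "gspan ?D \<subseteq> fkernel T f"
    by (rule gspan_least[OF fkernel_subgroup]) (auto simp: diff_in_fkernel)
  define s where "s = inv_into T f \<circ> f"
  have s: "s x \<in> T" "f (s x) = f x" if "x \<in> T" for x
    using that by (auto simp: s_def inv_into_into f_inv_into_f)
  have *: "c - free_map s c \<in> gspan ?D" if "Poly_Mapping.keys c \<subseteq> T" for c
    using that
  proof (induction c rule: frag_induction)
    case zero
    show ?case by (simp add: free_map_zero gspan.zero)
  next
    case (one x)
    then show ?case using s by (intro gspan.base) (force simp: free_map_of)
  next
    case (diff a b)
    have "a - b - free_map s (a - b) = (a - free_map s a) - (b - free_map s b)"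
      by (simp add: free_map_diff)
    then show ?case using gspan.diff[OF diff] by (simp only:)
  qed
  show "fkernel T f \<subseteq> gspan ?D"
  proof
    fix c assume c: "c \<in> fkernel T f"
    then have "free_map s c = 0"
      by (simp add: s_def fkernel_def free_map_zero flip: free_map_free_map)
    with *[of c] c show "c \<in> gspan ?D" by (simp add: fkernel_def free_on_def)
  qed
qed

text \<open>Kernels are generated by differences of identified points, and a single difference lies
  in a kernel exactly when its two points are identified. Inclusion of kernels thereby becomes
  inclusion of equivalence relations.\<close>

lemma fkernel_subset_iff:
  "fkernel T f \<subseteq> fkernel T g \<longleftrightarrow> (\<forall>x\<in>T. \<forall>y\<in>T. f x = f y \<longrightarrow> g x = g y)"
proof
  assume sub: "fkernel T f \<subseteq> fkernel T g"
  show "\<forall>x\<in>T. \<forall>y\<in>T. f x = f y \<longrightarrow> g x = g y"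
  proof (intro ballI impI)
    fix x y assume xy: "x \<in> T" "y \<in> T" "f x = f y"
    then have "frag_of x - frag_of y \<in> fkernel T f" by (simp add: diff_in_fkernel)
    with sub have "frag_of x - frag_of y \<in> fkernel T g" by (rule subsetD)
    then show "g x = g y" using xy by (simp add: diff_in_fkernel)
  qed
next
  assume "\<forall>x\<in>T. \<forall>y\<in>T. f x = f y \<longrightarrow> g x = g y"
  then show "fkernel T f \<subseteq> fkernel T g"
    unfolding fkernel_eq_gspan by (intro gspan_mono) blast
qed

text \<open>The relation is symmetric, so its closure is the join of the two equivalence relations.
  A chain from \<open>x\<close> to \<open>y\<close> writes the difference of its ends as a
  telescoping sum of differences, each in one of the two kernels.\<close>

lemma fkernel_join:
  assumes k: "\<And>x y. x \<in> T \<Longrightarrow> y \<in> T \<Longrightarrow>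
    k x = k y \<longleftrightarrow> (x, y) \<in> {(x, y). x \<in> T \<and> y \<in> T \<and> (f x = f y \<or> g x = g y)}\<^sup>*"
      (is "\<And>x y. _ \<Longrightarrow> _ \<Longrightarrow> _ \<longleftrightarrow> _ \<in> ?R\<^sup>*")
  shows "fkernel T k = gsum (fkernel T f) (fkernel T g)"
proof
  let ?J = "gsum (fkernel T f) (fkernel T g)"
  have J: "?J \<in> subgroups_of (free_on T)"
    by (intro gsum_subgroup free_on_subgroup fkernel_subgroup)
  have "fkernel T f \<subseteq> fkernel T k" "fkernel T g \<subseteq> fkernel T k"
    unfolding fkernel_subset_iff using k by blast+
  then show "?J \<subseteq> fkernel T k"
    using subgroups_of_add[OF fkernel_subgroup[of T k]] by (auto simp: gsum_def)
  have diff_J: "frag_of y - frag_of z \<in> ?J" if "(y, z) \<in> ?R" for y z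
    using that
  proof (elim CollectE case_prodE conjE disjE Pair_inject)
    fix a b assume "y = a" "z = b" "a \<in> T" "b \<in> T" "f a = f b"
    then have "frag_of y - frag_of z \<in> fkernel T f" by (simp add: diff_in_fkernel)
    moreover have "0 \<in> fkernel T g" using subgroups_ofD(2)[OF fkernel_subgroup] .
    ultimately show ?thesis unfolding gsum_def by force
  next
    fix a b assume "y = a" "z = b" "a \<in> T" "b \<in> T" "g a = g b"
    then have "frag_of y - frag_of z \<in> fkernel T g" by (simp add: diff_in_fkernel)
    moreover have "0 \<in> fkernel T f" using subgroups_ofD(2)[OF fkernel_subgroup] .
    ultimately show ?thesis unfolding gsum_def by force
  qed
  have "frag_of x - frag_of y \<in> ?J" if "(x, y) \<in> ?R\<^sup>*" for x y
    using that
  proof induction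
    case base
    show ?case using subgroups_ofD(2)[OF J] by simp
  next
    case (step y z)
    have "frag_of x - frag_of z = (frag_of x - frag_of y) + (frag_of y - frag_of z)" by simp
    then show ?case using subgroups_of_add[OF J step.IH diff_J[OF step.hyps(2)]] by simp
  qed
  then show "fkernel T k \<subseteq> ?J"
    unfolding fkernel_eq_gspan[of T k] by (intro gspan_least[OF J]) (auto simp: k)
qed

text \<open>Functoriality, (N2) and (N3), restated for a set-valued functor \<open>T\<close> with
  action \<open>t\<close>: kernels have become equivalence relations and images subsets, and
  \<open>t_join\<close> asks for a morphism whose kernel relation is exactly the join. The maps
  \<open>enc\<close> only move subgroups into the type of clusters.\<close>

locale set_representation = category C for C :: "('o, 'a) semicat" +
  fixes T :: "'o \<Rightarrow> 'c set" and t :: "'a \<Rightarrow> 'c \<Rightarrow> 'c"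
    and enc :: "'o \<Rightarrow> ('c \<Rightarrow>\<^sub>0 int) set \<Rightarrow> 'u"
  assumes t_closed: "f \<in> Hom C X Y \<Longrightarrow> x \<in> T X \<Longrightarrow> t f x \<in> T Y"
    and t_Cmp: "f \<in> Hom C X Y \<Longrightarrow> g \<in> Hom C Y Z \<Longrightarrow> x \<in> T X \<Longrightarrow> t (Cmp C g f) x = t g (t f x)"
    and t_Ident: "X \<in> Obj C \<Longrightarrow> x \<in> T X \<Longrightarrow> t (Ident C X) x = x"
    and enc_inj: "X \<in> Obj C \<Longrightarrow> inj_on (enc X) (subgroups_of (free_on (T X)))"
    and small_subgroups: "X \<in> Obj C \<Longrightarrow> small TYPE('u) (subgroups_of (free_on (T X)))"
    and small_Hom: "X \<in> Obj C \<Longrightarrow> Y \<in> Obj C \<Longrightarrow> small TYPE('u) (Hom C X Y)"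
    and t_factorization: "f \<in> Hom C X Y \<Longrightarrow> \<exists>I e m. e \<in> Hom C X I \<and> m \<in> Hom C I Y \<and> f = Cmp C m e \<and>
      t e ` T X = T I \<and> inj_on (t m) (T I) \<and>
      (\<forall>Z. \<forall>g\<in>Hom C X Z. (\<forall>x\<in>T X. \<forall>y\<in>T X. t e x = t e y \<longrightarrow> t g x = t g y) \<longrightarrow>
        (\<exists>!h. h \<in> Hom C I Z \<and> g = Cmp C h e)) \<and>
      (\<forall>W. \<forall>g\<in>Hom C W Y. t g ` T W \<subseteq> t m ` T I \<longrightarrow> (\<exists>!h. h \<in> Hom C W I \<and> g = Cmp C m h))"
    and t_join: "f \<in> Hom C X Y \<Longrightarrow> g \<in> Hom C X Z \<Longrightarrow> \<exists>W. \<exists>k\<in>Hom C X W. \<forall>x\<in>T X. \<forall>y\<in>T X.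
      t k x = t k y \<longleftrightarrow> (x, y) \<in> {(x, y). x \<in> T X \<and> y \<in> T X \<and> (t f x = t f y \<or> t g x = t g y)}\<^sup>*"
    and t_meet: "f \<in> Hom C Y X \<Longrightarrow> g \<in> Hom C Z X \<Longrightarrow> \<exists>W. \<exists>k\<in>Hom C W X.
      t k ` T W = t f ` T Y \<inter> t g ` T Z"
    and t_monic: "m \<in> monics C \<Longrightarrow> inj_on (t m) (T (Src C m))"
begin

abbreviation Sub :: "'o \<Rightarrow> ('c \<Rightarrow>\<^sub>0 int) set set" where
  "Sub X \<equiv> subgroups_of (free_on (T X))"

definition dec :: "'o \<Rightarrow> 'u \<Rightarrow> ('c \<Rightarrow>\<^sub>0 int) set" where
  "dec X = inv_into (Sub X) (enc X)"

definition pull :: "'a \<Rightarrow> ('c \<Rightarrow>\<^sub>0 int) set \<Rightarrow> ('c \<Rightarrow>\<^sub>0 int) set" where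
  "pull f S = {c \<in> free_on (T (Src C f)). free_map (t f) c \<in> S}"

definition subgroup_form :: "('o, 'a, 'u) form" where
  "subgroup_form = \<lparr>fib = \<lambda>X. sublattice (enc X) (free_on (T X)),
     dimg = \<lambda>f a. enc (Tgt C f) (free_map (t f) ` dec (Src C f) a),
     iimg = \<lambda>f b. enc (Src C f) (pull f (dec (Tgt C f) b))\<rparr>"

abbreviation (input) "F \<equiv> subgroup_form"

lemma fib_F: "fib F X = sublattice (enc X) (free_on (T X))"
  by (simp add: subgroup_form_def)

lemma encoded: "X \<in> Obj C \<Longrightarrow> encoded_subgroups (free_on (T X)) (enc X)"
  by (intro encoded_subgroups.intro free_on_subgroup enc_inj)

lemma carrier_F: "carrier (fib F X) = enc X ` Sub X"
  by (simp add: fib_F sublattice_def)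

lemma dec_enc: "X \<in> Obj C \<Longrightarrow> S \<in> Sub X \<Longrightarrow> dec X (enc X S) = S"
  by (simp add: dec_def enc_inj)

lemma le_F: "X \<in> Obj C \<Longrightarrow> S \<in> Sub X \<Longrightarrow> S' \<in> Sub X \<Longrightarrow> enc X S \<sqsubseteq>\<^bsub>fib F X\<^esub> enc X S' \<longleftrightarrow> S \<subseteq> S'"
  unfolding fib_F by (rule encoded_subgroups.le_L[OF encoded])

lemma push_closed:
  assumes "f \<in> Hom C X Y" "S \<in> Sub X"
  shows "free_map (t f) ` S \<in> Sub Y"
proof (rule subgroups_ofI)
  show "free_map (t f) ` S \<subseteq> free_on (T Y)"
    using subgroups_ofD(1)[OF assms(2)] t_closed[OF assms(1)] by (blast intro: free_map_closed)
  show "0 \<in> free_map (t f) ` S"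
    using subgroups_ofD(2)[OF assms(2)] free_map_zero by (metis imageI)
  show "a - b \<in> free_map (t f) ` S" if "a \<in> free_map (t f) ` S" "b \<in> free_map (t f) ` S" for a b
    using that subgroups_ofD(3)[OF assms(2)] by (auto simp: free_map_diff[symmetric])
qed

lemma pull_closed:
  assumes "f \<in> Hom C X Y" "S \<in> Sub Y"
  shows "pull f S \<in> Sub X"
  using HomD[OF assms(1)] subgroups_ofD(2,3)[OF assms(2)]
  by (intro subgroups_ofI) (auto simp: pull_def free_map_zero free_map_diff free_on_zero free_on_diff)

lemma dimg_enc: "f \<in> Hom C X Y \<Longrightarrow> S \<in> Sub X \<Longrightarrow> dimg F f (enc X S) = enc Y (free_map (t f) ` S)"
  using Hom_Obj[of f X Y] HomD[of f C X Y] by (simp add: subgroup_form_def dec_enc)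

lemma iimg_enc: "f \<in> Hom C X Y \<Longrightarrow> S \<in> Sub Y \<Longrightarrow> iimg F f (enc Y S) = enc X (pull f S)"
  using Hom_Obj[of f X Y] HomD[of f C X Y] by (simp add: subgroup_form_def dec_enc)

lemma Im_F:
  assumes "f \<in> Hom C X Y" shows "Im C F f = enc Y (free_on (t f ` T X))"
proof -
  have "\<top>\<^bsub>fib F X\<^esub> = enc X (free_on (T X))"
    unfolding fib_F by (rule encoded_subgroups.top_enc[OF encoded]) (use Hom_Obj[OF assms] in simp)
  then show ?thesis
    using dimg_enc[OF assms free_on_subgroup] HomD[OF assms] by (simp add: Im_def free_map_image)
qed

lemma Ker_F:
  assumes "f \<in> Hom C X Y" shows "Ker C F f = enc X (fkernel (T X) (t f))"
proof -
  have Y: "Y \<in> Obj C" using Hom_Obj[OF assms] by simp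
  have "\<bottom>\<^bsub>fib F Y\<^esub> = enc Y {0}"
    unfolding fib_F by (rule encoded_subgroups.bottom_enc[OF encoded[OF Y]])
  then show ?thesis
    using iimg_enc[OF assms encoded_subgroups.zero_subgroup[OF encoded[OF Y]]] HomD[OF assms]
    by (simp add: Ker_def pull_def fkernel_def)
qed

lemma Im_subgroup: "f \<in> Hom C X Y \<Longrightarrow> free_on (t f ` T X) \<in> Sub Y"
  using push_closed[OF _ free_on_subgroup] by (simp add: free_map_image)

lemma Im_le_iff:
  assumes "f \<in> Hom C X Y" "g \<in> Hom C Z Y"
  shows "Im C F f \<sqsubseteq>\<^bsub>fib F Y\<^esub> Im C F g \<longleftrightarrow> t f ` T X \<subseteq> t g ` T Z"
  using assms Hom_Obj[OF assms(1)] by (simp add: Im_F le_F Im_subgroup free_on_subset_iff)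

lemma Ker_le_iff:
  assumes "f \<in> Hom C X Y" "g \<in> Hom C X Z"
  shows "Ker C F f \<sqsubseteq>\<^bsub>fib F X\<^esub> Ker C F g \<longleftrightarrow> (\<forall>x\<in>T X. \<forall>y\<in>T X. t f x = t f y \<longrightarrow> t g x = t g y)"
  using assms Hom_Obj[OF assms(1)] by (simp add: Ker_F le_F fkernel_subgroup fkernel_subset_iff)

lemma orean_form: "orean_form C F"
proof (intro orean_form.intro orean_form_axioms.intro category_axioms)
  fix X Y assume "X \<in> Obj C" "Y \<in> Obj C"
  then show "small TYPE('u) (Hom C X Y)" by (rule small_Hom)
next
  fix X assume X: "X \<in> Obj C"
  show "small TYPE('u) (carrier (fib F X))"
    unfolding carrier_F by (intro small_image small_subgroups X)
  show "bounded_lattice (fib F X)"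
    unfolding fib_F by (rule encoded_subgroups.bounded[OF encoded[OF X]])
  fix S assume "S \<in> carrier (fib F X)"
  then obtain S' where S: "S = enc X S'" "S' \<in> Sub X" by (auto simp: carrier_F)
  then have "free_map (t (Ident C X)) c = c" if "c \<in> free_on (T X)" for c
    using that by (intro free_map_id) (auto simp: t_Ident X)
  then have "free_map (t (Ident C X)) ` S' = S'" "pull (Ident C X) S' = S'"
    using subgroups_ofD(1)[OF S(2)] HomD[OF Ident_Hom[OF X]] by (force simp: pull_def)+
  then show "dimg F (Ident C X) S = S" "iimg F (Ident C X) S = S"
    using S dimg_enc[OF Ident_Hom] iimg_enc[OF Ident_Hom] X by simp_all
next
  fix f X Y assume f: "f \<in> Hom C X Y"
  have XY: "X \<in> Obj C" "Y \<in> Obj C" using Hom_Obj[OF f] by simp_all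
  show "dimg F f \<in> carrier (fib F X) \<rightarrow> carrier (fib F Y)"
    using push_closed[OF f] by (auto simp: carrier_F dimg_enc[OF f])
  show "iimg F f \<in> carrier (fib F Y) \<rightarrow> carrier (fib F X)"
    using pull_closed[OF f] by (auto simp: carrier_F iimg_enc[OF f])
  have wpo: "weak_partial_order (fib F Z)" if "Z \<in> Obj C" for Z
    unfolding fib_F using encoded_subgroups.po[OF encoded[OF that]] by (simp add: partial_order_def)
  show "isotone (fib F X) (fib F Y) (dimg F f)"
  proof (rule isotoneI)
    fix a b assume "a \<in> carrier (fib F X)" "b \<in> carrier (fib F X)" "a \<sqsubseteq>\<^bsub>fib F X\<^esub> b"
    then show "dimg F f a \<sqsubseteq>\<^bsub>fib F Y\<^esub> dimg F f b"
      using push_closed[OF f] XY by (auto simp: carrier_F dimg_enc[OF f] le_F image_mono)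
  qed (rule wpo XY)+
  show "isotone (fib F Y) (fib F X) (iimg F f)"
  proof (rule isotoneI)
    fix a b assume "a \<in> carrier (fib F Y)" "b \<in> carrier (fib F Y)" "a \<sqsubseteq>\<^bsub>fib F Y\<^esub> b"
    then show "iimg F f a \<sqsubseteq>\<^bsub>fib F X\<^esub> iimg F f b"
      using pull_closed[OF f] XY by (auto simp: carrier_F iimg_enc[OF f] le_F) (auto simp: pull_def)
  qed (rule wpo XY)+
  fix S S' assume "S \<in> carrier (fib F X)" "S' \<in> carrier (fib F Y)"
  then obtain A B where A: "S = enc X A" "A \<in> Sub X" and B: "S' = enc Y B" "B \<in> Sub Y"
    by (auto simp: carrier_F)
  have "free_map (t f) ` A \<subseteq> B \<longleftrightarrow> A \<subseteq> pull f B"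
    using subgroups_ofD(1)[OF A(2)] HomD[OF f] by (auto simp: pull_def)
  then show "dimg F f S \<sqsubseteq>\<^bsub>fib F Y\<^esub> S' \<longleftrightarrow> S \<sqsubseteq>\<^bsub>fib F X\<^esub> iimg F f S'"
    using A B XY push_closed[OF f A(2)] pull_closed[OF f B(2)] by (simp add: dimg_enc[OF f] iimg_enc[OF f] le_F)
next
  fix f X Y g Z S assume f: "f \<in> Hom C X Y" and g: "g \<in> Hom C Y Z"
  have gf: "Cmp C g f \<in> Hom C X Z" by (rule Cmp_closed[OF f g])
  have *: "free_map (t (Cmp C g f)) c = free_map (t g) (free_map (t f) c)" if "c \<in> free_on (T X)" for c
    unfolding free_map_free_map using that by (rule free_map_cong) (simp add: t_Cmp[OF f g])
  { assume "S \<in> carrier (fib F X)"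
    then obtain A where A: "S = enc X A" "A \<in> Sub X" by (auto simp: carrier_F)
    have "free_map (t (Cmp C g f)) ` A = free_map (t g) ` free_map (t f) ` A"
      unfolding image_image using subgroups_ofD(1)[OF A(2)] by (intro image_cong refl *) auto
    then show "dimg F (Cmp C g f) S = dimg F g (dimg F f S)"
      using A by (simp add: dimg_enc[OF f] dimg_enc[OF g] dimg_enc[OF gf] push_closed[OF f]) }
  { assume "S \<in> carrier (fib F Z)"
    then obtain A where A: "S = enc Z A" "A \<in> Sub Z" by (auto simp: carrier_F)
    have "free_map (t f) c \<in> free_on (T Y)" if "c \<in> free_on (T X)" for c
      using t_closed[OF f] by (intro free_map_closed[OF that]) auto
    then have "pull (Cmp C g f) A = pull f (pull g A)"
      using HomD[OF f] HomD[OF g] HomD[OF gf] * by (auto simp: pull_def)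
    then show "iimg F (Cmp C g f) S = iimg F f (iimg F g S)"
      using A by (simp add: iimg_enc[OF f] iimg_enc[OF g] iimg_enc[OF gf] pull_closed[OF g]) }
qed

text \<open>Injectivity of \<open>t m\<close> makes \<open>f\<close> and \<open>e\<close> identify
  the same points, and surjectivity of \<open>t e\<close> gives \<open>f\<close> and
  \<open>m\<close> the same image. The two universal properties therefore concern
  \<open>Ker f\<close> and \<open>Im f\<close>.\<close>

lemma t_factorization_form:
  assumes f: "f \<in> Hom C X Y"
  obtains I e m where "e \<in> Hom C X I" "m \<in> Hom C I Y" "f = Cmp C m e"
    "is_quotient C F X (Ker C F f) e" "is_embedding C F Y (Im C F f) m"
    "\<And>x y. x \<in> T X \<Longrightarrow> y \<in> T X \<Longrightarrow> t e x = t e y \<longleftrightarrow> t f x = t f y"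
proof -
  from t_factorization[OF f] obtain I e m where e: "e \<in> Hom C X I" and m: "m \<in> Hom C I Y"
    and fme: "f = Cmp C m e" and surj: "t e ` T X = T I" and inj: "inj_on (t m) (T I)"
    and quot: "\<forall>Z. \<forall>g\<in>Hom C X Z. (\<forall>x\<in>T X. \<forall>y\<in>T X. t e x = t e y \<longrightarrow> t g x = t g y) \<longrightarrow>
        (\<exists>!h. h \<in> Hom C I Z \<and> g = Cmp C h e)"
    and emb: "\<forall>W. \<forall>g\<in>Hom C W Y. t g ` T W \<subseteq> t m ` T I \<longrightarrow> (\<exists>!h. h \<in> Hom C W I \<and> g = Cmp C m h)"
    by (elim exE conjE) (rule that)
  have tf: "t f x = t m (t e x)" if "x \<in> T X" for x using that unfolding fme by (rule t_Cmp[OF e m])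
  have tf_eq: "t e x = t e y \<longleftrightarrow> t f x = t f y" if "x \<in> T X" "y \<in> T X" for x y
    using that t_closed[OF e] inj_on_eq_iff[OF inj] by (simp add: tf)
  have "fkernel (T X) (t f) = fkernel (T X) (t e)"
    by (intro equalityI) (simp_all add: fkernel_subset_iff tf_eq)
  then have Ker: "Ker C F f = Ker C F e" by (simp add: Ker_F[OF e] Ker_F[OF f])
  have "t f ` T X = t m ` T I" unfolding surj[symmetric] image_image by (intro image_cong refl tf)
  then have Im: "Im C F f = Im C F m" by (simp add: Im_F[OF m] Im_F[OF f])
  have "is_quotient C F X (Ker C F f) e"
    unfolding is_quotient_def Ker
  proof (intro conjI ballI impI)
    fix g assume g: "g \<in> Arr C" "Src C g = X" "Ker C F e \<sqsubseteq>\<^bsub>fib F X\<^esub> Ker C F g"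
    then have g': "g \<in> Hom C X (Tgt C g)" by (simp add: Hom_def)
    show "\<exists>!h. h \<in> Hom C (Tgt C e) (Tgt C g) \<and> g = Cmp C h e"
      unfolding HomD(3)[OF e]
      by (rule mp[OF bspec[OF spec[OF quot] g']]) (rule g(3)[unfolded Ker_le_iff[OF e g']])
  qed (use HomD[OF e] in auto)
  moreover have "is_embedding C F Y (Im C F f) m"
    unfolding is_embedding_def Im
  proof (intro conjI ballI impI)
    fix g assume g: "g \<in> Arr C" "Tgt C g = Y" "Im C F g \<sqsubseteq>\<^bsub>fib F Y\<^esub> Im C F m"
    then have g': "g \<in> Hom C (Src C g) Y" by (simp add: Hom_def)
    show "\<exists>!h. h \<in> Hom C (Src C g) (Src C m) \<and> g = Cmp C m h"
      unfolding HomD(2)[OF m]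
      by (rule mp[OF bspec[OF spec[OF emb] g']]) (rule g(3)[unfolded Im_le_iff[OF g' m]])
  qed (use HomD[OF m] in auto)
  ultimately show thesis using that[OF e m fme] tf_eq by blast
qed

lemma noetherian_form: "noetherian_form C F"
proof (intro noetherian_form.intro orean_form noetherian_form_axioms.intro)
  fix f X Y S assume f: "f \<in> Hom C X Y"
  have XY: "X \<in> Obj C" "Y \<in> Obj C" using Hom_Obj[OF f] by simp_all
  { assume "S \<in> carrier (fib F X)"
    then obtain A where A: "S = enc X A" "A \<in> Sub X" by (auto simp: carrier_F)
    have A_sub: "A \<subseteq> free_on (T X)" by (rule subgroups_ofD(1)[OF A(2)])
    have "pull f (free_map (t f) ` A) = gsum A (fkernel (T X) (t f))"
    proof
      show "pull f (free_map (t f) ` A) \<subseteq> gsum A (fkernel (T X) (t f))"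
      proof
        fix c assume "c \<in> pull f (free_map (t f) ` A)"
        then obtain a where a: "a \<in> A" "free_map (t f) c = free_map (t f) a" "c \<in> free_on (T X)"
          using HomD[OF f] by (auto simp: pull_def)
        \<comment> \<open>Elements with equal images differ by an element of the kernel; this is the
          first half of (N1) for groups.\<close>
        then have "c - a \<in> fkernel (T X) (t f)"
          using A_sub by (auto simp: fkernel_def free_map_diff intro: free_on_diff)
        then show "c \<in> gsum A (fkernel (T X) (t f))" using a unfolding gsum_def by force
      qed
      show "gsum A (fkernel (T X) (t f)) \<subseteq> pull f (free_map (t f) ` A)"
        using A_sub HomD[OF f] subgroups_of_add[OF free_on_subgroup]
        by (auto simp: gsum_def fkernel_def pull_def free_map_add)
    qed
    then show "iimg F f (dimg F f S) = S \<squnion>\<^bsub>fib F X\<^esub> Ker C F f"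
      using A push_closed[OF f A(2)] encoded_subgroups.join_enc[OF encoded[OF XY(1)] A(2) fkernel_subgroup[of _ "t f"]]
      by (simp add: dimg_enc[OF f] iimg_enc[OF f] Ker_F[OF f] fib_F) }
  { assume "S \<in> carrier (fib F Y)"
    then obtain A where A: "S = enc Y A" "A \<in> Sub Y" by (auto simp: carrier_F)
    have "free_map (t f) ` pull f A = A \<inter> free_on (t f ` T X)"
      using HomD[OF f] by (auto simp: pull_def free_map_image[symmetric])
    then show "dimg F f (iimg F f S) = S \<sqinter>\<^bsub>fib F Y\<^esub> Im C F f"
      using A pull_closed[OF f A(2)] encoded_subgroups.meet_enc[OF encoded[OF XY(2)] A(2) Im_subgroup[OF f]]
      by (simp add: dimg_enc[OF f] iimg_enc[OF f] Im_F[OF f] fib_F) }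
  show "\<exists>e m. is_quotient C F X (Ker C F f) e \<and> is_embedding C F Y (Im C F f) m \<and>
            Src C m = Tgt C e \<and> f = Cmp C m e"
  proof (rule t_factorization_form[OF f])
    fix I e m assume "e \<in> Hom C X I" "m \<in> Hom C I Y" "f = Cmp C m e"
    "is_quotient C F X (Ker C F f) e" "is_embedding C F Y (Im C F f) m"
    then show ?thesis by (intro exI[of _ e] exI[of _ m]) (auto simp: Hom_def)
  qed
next
  fix X K K' assume X: "X \<in> Obj C" and "normal C F X K" "normal C F X K'"
  then obtain f g where f: "f \<in> Hom C X (Tgt C f)" "K = Ker C F f" and g: "g \<in> Hom C X (Tgt C g)" "K' = Ker C F g"
    by (auto simp: normal_def Hom_def)
  from t_join[OF f(1) g(1)] obtain W k where k: "k \<in> Hom C X W"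
    "\<And>x y. x \<in> T X \<Longrightarrow> y \<in> T X \<Longrightarrow>
      t k x = t k y \<longleftrightarrow> (x, y) \<in> {(x, y). x \<in> T X \<and> y \<in> T X \<and> (t f x = t f y \<or> t g x = t g y)}\<^sup>*" by blast
  have "K \<squnion>\<^bsub>fib F X\<^esub> K' = Ker C F k"
    using fkernel_join[OF k(2)] encoded_subgroups.join_enc[OF encoded[OF X] fkernel_subgroup[of _ "t f"] fkernel_subgroup[of _ "t g"]]
    by (simp add: f(2) g(2) Ker_F[OF f(1)] Ker_F[OF g(1)] Ker_F[OF k(1)] fib_F)
  then show "normal C F X (K \<squnion>\<^bsub>fib F X\<^esub> K')"
    unfolding normal_def using HomD[OF k(1)] by auto
next
  fix X S S' assume X: "X \<in> Obj C" and "conormal C F X S" "conormal C F X S'"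
  then obtain f g where f: "f \<in> Hom C (Src C f) X" "S = Im C F f" and g: "g \<in> Hom C (Src C g) X" "S' = Im C F g"
    by (auto simp: conormal_def Hom_def)
  from t_meet[OF f(1) g(1)] obtain W k where k: "k \<in> Hom C W X"
    "t k ` T W = t f ` T (Src C f) \<inter> t g ` T (Src C g)" by blast
  have "S \<sqinter>\<^bsub>fib F X\<^esub> S' = Im C F k"
    using encoded_subgroups.meet_enc[OF encoded[OF X] Im_subgroup[OF f(1)] Im_subgroup[OF g(1)]]
    by (simp add: f(2) g(2) Im_F[OF f(1)] Im_F[OF g(1)] Im_F[OF k(1)] fib_F k(2) free_on_Int)
  then show "conormal C F X (S \<sqinter>\<^bsub>fib F X\<^esub> S')"
    unfolding conormal_def using HomD[OF k(1)] by auto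
qed

text \<open>Since \<open>t m\<close> is injective, \<open>Ker m\<close> lies below the kernel of the
  identity, so the identity factors through the quotient part \<open>e\<close> of \<open>m\<close>.
  Being split monic and epic, \<open>e\<close> is invertible, and \<open>m\<close> is the embedding
  \<open>n\<close> up to this isomorphism.\<close>

lemma monic_embedding:
  assumes m: "m \<in> monics C"
  shows "is_embedding C F (Tgt C m) (Im C F m) m"
proof -
  interpret noetherian_form C F by (rule noetherian_form)
  have m': "m \<in> Hom C (Src C m) (Tgt C m)" using monicsD(1)[OF m] by (rule HomI)
  define X where "X = Src C m"
  have X: "X \<in> Obj C" and mX: "m \<in> Hom C X (Tgt C m)" using Hom_Obj[OF m'] m' by (simp_all add: X_def)
  obtain I e n where e: "e \<in> Hom C X I" and n: "n \<in> Hom C I (Tgt C m)" and mne: "m = Cmp C n e"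
    and quot: "is_quotient C F X (Ker C F m) e" and emb: "is_embedding C F (Tgt C m) (Im C F m) n"
    and te: "\<And>x y. x \<in> T X \<Longrightarrow> y \<in> T X \<Longrightarrow> t e x = t e y \<longleftrightarrow> t m x = t m y"
    by (rule t_factorization_form[OF mX]) (rule that)
  have "Ker C F m \<sqsubseteq>\<^bsub>fib F X\<^esub> Ker C F (Ident C X)"
    unfolding Ker_le_iff[OF mX Ident_Hom[OF X]] using t_monic[OF m] t_Ident[OF X] by (simp add: X_def inj_on_eq_iff)
  then obtain h where h: "h \<in> Hom C I X" "Ident C X = Cmp C h e"
    using quotient_factor[OF quot e Ident_Hom[OF X]] by blast
  have "Cmp C (Cmp C e h) e = Cmp C (Ident C I) e"
    using Cmp_assoc[OF e h(1) e] h(2)[symmetric] Cmp_Ident[OF e] Ident_Cmp[OF e] by simp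
  then have eh: "Cmp C e h = Ident C I"
    using epicsD(2)[OF quotient_epic[OF quot] e Cmp_closed[OF h(1) e] Ident_Hom] Hom_Obj[OF e] by simp
  show ?thesis
    unfolding is_embedding_def
  proof (intro conjI ballI impI refl)
    show "m \<in> Arr C" using HomD[OF mX] by simp
    fix f assume f: "f \<in> Arr C" "Tgt C f = Tgt C m" "Im C F f \<sqsubseteq>\<^bsub>fib F (Tgt C m)\<^esub> Im C F m"
    then have f': "f \<in> Hom C (Src C f) (Tgt C m)" by (simp add: Hom_def)
    obtain k where k: "k \<in> Hom C (Src C f) I" "f = Cmp C n k"
      using embedding_factor[OF emb n f' f(3)] by blast
    have hk: "Cmp C h k \<in> Hom C (Src C f) X" by (rule Cmp_closed[OF k(1) h(1)])
    have "Cmp C m (Cmp C h k) = Cmp C n (Cmp C e (Cmp C h k))"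
      unfolding mne by (rule Cmp_assoc[OF hk e n, symmetric])
    also have "Cmp C e (Cmp C h k) = k"
      using Cmp_assoc[OF k(1) h(1) e] eh Ident_Cmp[OF k(1)] by simp
    finally have "f = Cmp C m (Cmp C h k)" using k(2) by simp
    then show "\<exists>!h. h \<in> Hom C (Src C f) (Src C m) \<and> f = Cmp C m h"
      using hk monicsD(2)[OF m mX] unfolding X_def by (intro ex1I[of _ "Cmp C h k"]) auto
  qed
qed

theorem induces_strong_epi_mono: "induces C F (strong_epics C) (monics C)"
  by (rule noetherian_form.induces_strong_epics_monics[OF noetherian_form monic_embedding])

lemma algebraic_fibre: "X \<in> Obj C \<Longrightarrow> algebraic_lattice (fib F X)"
  unfolding fib_F by (rule encoded_subgroups.algebraic[OF encoded])

lemma modular_fibre: "X \<in> Obj C \<Longrightarrow> modular_lattice (fib F X)"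
  unfolding fib_F by (rule encoded_subgroups.modular[OF encoded])

end

section \<open>Reduced words\<close>

text \<open>The reduced words over a semicategory form the semigroup (with a unit adjoined) that it generates
  when all of its objects are identified: two adjacent letters are multiplied whenever they compose.\<close>

definition rcons :: "('o, 'a) semicat \<Rightarrow> 'a \<Rightarrow> 'a list \<Rightarrow> 'a list" where
  "rcons A a w = (case w of [] \<Rightarrow> [a] | b # v \<Rightarrow> if Src A a = Tgt A b then Cmp A a b # v else a # b # v)"

definition red :: "('o, 'a) semicat \<Rightarrow> 'a list \<Rightarrow> 'a list" where
  "red A w = foldr (rcons A) w []"

lemma red_simps [simp]: "red A [] = []" "red A (a # w) = rcons A a (red A w)"
  by (simp_all add: red_def)

lemma rcons_simps:
  "rcons A a [] = [a]"
  "Src A a = Tgt A b \<Longrightarrow> rcons A a (b # v) = Cmp A a b # v"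
  "Src A a \<noteq> Tgt A b \<Longrightarrow> rcons A a (b # v) = a # b # v"
  by (simp_all add: rcons_def)

text \<open>A semifunctor as a bare pair of functions: no domain or codomain is stored, no
  extensionality is asked, and the types on the two sides may differ, as happens for pullbacks and
  \<open>joincat\<close>.\<close>

definition sfun :: "('o, 'a) semicat \<Rightarrow> ('p, 'b) semicat \<Rightarrow> ('o \<Rightarrow> 'p) \<Rightarrow> ('a \<Rightarrow> 'b) \<Rightarrow> bool" where
  "sfun A B \<phi> \<psi> \<longleftrightarrow> \<phi> ` Obj A \<subseteq> Obj B \<and>
     (\<forall>f\<in>Arr A. \<psi> f \<in> Hom B (\<phi> (Src A f)) (\<phi> (Tgt A f))) \<and>
     (\<forall>f\<in>Arr A. \<forall>g\<in>Arr A. Src A g = Tgt A f \<longrightarrow> \<psi> (Cmp A g f) = Cmp B (\<psi> g) (\<psi> f))"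

lemma sfunI:
  assumes "\<And>x. x \<in> Obj A \<Longrightarrow> \<phi> x \<in> Obj B"
    and "\<And>f. f \<in> Arr A \<Longrightarrow> \<psi> f \<in> Arr B"
    and "\<And>f. f \<in> Arr A \<Longrightarrow> Src B (\<psi> f) = \<phi> (Src A f)"
    and "\<And>f. f \<in> Arr A \<Longrightarrow> Tgt B (\<psi> f) = \<phi> (Tgt A f)"
    and "\<And>f g. f \<in> Arr A \<Longrightarrow> g \<in> Arr A \<Longrightarrow> Src A g = Tgt A f \<Longrightarrow> \<psi> (Cmp A g f) = Cmp B (\<psi> g) (\<psi> f)"
  shows "sfun A B \<phi> \<psi>"
  using assms by (auto simp: sfun_def Hom_def)

lemma sfunD:
  assumes "sfun A B \<phi> \<psi>"
  shows "x \<in> Obj A \<Longrightarrow> \<phi> x \<in> Obj B"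
    and "f \<in> Arr A \<Longrightarrow> \<psi> f \<in> Arr B"
    and "f \<in> Arr A \<Longrightarrow> Src B (\<psi> f) = \<phi> (Src A f)"
    and "f \<in> Arr A \<Longrightarrow> Tgt B (\<psi> f) = \<phi> (Tgt A f)"
    and "f \<in> Arr A \<Longrightarrow> g \<in> Arr A \<Longrightarrow> Src A g = Tgt A f \<Longrightarrow> \<psi> (Cmp A g f) = Cmp B (\<psi> g) (\<psi> f)"
  using assms by (auto simp: sfun_def Hom_def)

lemma sfun_Hom: "sfun A B \<phi> \<psi> \<Longrightarrow> f \<in> Hom A X Y \<Longrightarrow> \<psi> f \<in> Hom B (\<phi> X) (\<phi> Y)"
  by (auto simp: sfun_def Hom_def)

lemma sfun_compose:
  assumes "sfun A B \<phi> \<psi>" "sfun B D \<phi>' \<psi>'"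
  shows "sfun A D (\<phi>' \<circ> \<phi>) (\<psi>' \<circ> \<psi>)"
  using sfunD[OF assms(1)] sfunD[OF assms(2)] by (intro sfunI) auto

lemma sfun_cong:
  assumes "semicategory A" "sfun A B \<phi> \<psi>"
    and "\<And>x. x \<in> Obj A \<Longrightarrow> \<phi>' x = \<phi> x" "\<And>f. f \<in> Arr A \<Longrightarrow> \<psi>' f = \<psi> f"
  shows "sfun A B \<phi>' \<psi>'"
proof -
  interpret semicategory A by fact
  have "Cmp A g f \<in> Arr A" if "f \<in> Arr A" "g \<in> Arr A" "Src A g = Tgt A f" for f g
    using Cmp_closed[of f "Src A f" "Tgt A f" g "Tgt A g"] that by (simp add: Hom_def)
  then show ?thesis
    using sfunD[OF assms(2)] assms(3,4) Src_closed Tgt_closed by (intro sfunI) auto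
qed

context semicategory
begin

lemma Cmp_Arr:
  assumes "f \<in> Arr C" "g \<in> Arr C" "Src C g = Tgt C f"
  shows "Cmp C g f \<in> Arr C" "Src C (Cmp C g f) = Src C f" "Tgt C (Cmp C g f) = Tgt C g"
  using Cmp_closed[of f "Src C f" "Tgt C f" g "Tgt C g"] assms by (simp_all add: Hom_def)

lemma assoc:
  assumes "f \<in> Arr C" "g \<in> Arr C" "h \<in> Arr C" "Src C g = Tgt C f" "Src C h = Tgt C g"
  shows "Cmp C h (Cmp C g f) = Cmp C (Cmp C h g) f"
  using Cmp_assoc[of f "Src C f" "Tgt C f" g "Tgt C g" h "Tgt C h"] assms by (simp add: Hom_def)

lemma rcons_closed: "a \<in> Arr C \<Longrightarrow> w \<in> lists (Arr C) \<Longrightarrow> rcons C a w \<in> lists (Arr C)"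
  by (auto simp: rcons_def Cmp_Arr split: list.split)

lemma red_closed: "w \<in> lists (Arr C) \<Longrightarrow> red C w \<in> lists (Arr C)"
  by (induction w rule: list.induct) (simp, metis red_simps(2) rcons_closed Cons_in_lists_iff)

text \<open>Associativity in disguise. It makes letters act on reduced words compatibly with
  composition; from this it follows, without any confluence argument, that reduction respects
  concatenation.\<close>

lemma rcons_Cmp:
  assumes "a \<in> Arr C" "b \<in> Arr C" "w \<in> lists (Arr C)" "Src C a = Tgt C b"
  shows "rcons C a (rcons C b w) = rcons C (Cmp C a b) w"
  using assms by (cases w) (auto simp: rcons_def Cmp_Arr assoc)

lemma red_rcons_append:
  assumes "a \<in> Arr C" "w \<in> lists (Arr C)" "v \<in> lists (Arr C)"
  shows "red C (rcons C a w @ v) = rcons C a (red C (w @ v))"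
proof (cases w)
  case (Cons b u)
  then have "b \<in> Arr C" "red C (u @ v) \<in> lists (Arr C)"
    using assms by (auto intro!: red_closed)
  then show ?thesis using Cons assms by (auto simp: rcons_simps rcons_Cmp rcons_def[of C a "b # u"])
qed (simp add: rcons_simps)

lemma red_red_append:
  assumes "w \<in> lists (Arr C)" "v \<in> lists (Arr C)"
  shows "red C (red C w @ v) = red C (w @ v)"
  using assms
proof (induction w)
  case (Cons a w)
  then show ?case using red_rcons_append[of a "red C w" v] red_closed[of w] by simp
qed simp

lemma red_append_red: "red C (w @ red C v) = red C (w @ v)" if "v \<in> lists (Arr C)"
  by (induction w) (use red_red_append[OF that, of "[]"] in simp_all)

lemma red_red: "w \<in> lists (Arr C) \<Longrightarrow> red C (red C w) = red C w"
  using red_red_append[of w "[]"] by simp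

lemma red_append:
  "w \<in> lists (Arr C) \<Longrightarrow> v \<in> lists (Arr C) \<Longrightarrow> red C (w @ v) = red C (red C w @ red C v)"
  by (simp add: red_red_append red_append_red red_closed)

text \<open>Functoriality of the semigroup: endpoints are preserved, so a product taken in
  \<open>C\<close> before mapping is also available in \<open>D\<close> after it. More letters may
  compose in \<open>D\<close>, which is why the outer \<open>red D\<close> stays on both
  sides.\<close>

lemma red_map_red:
  assumes D: "semicategory D" and F: "sfun C D \<phi> \<psi>" and w: "w \<in> lists (Arr C)"
  shows "red D (map \<psi> (red C w)) = red D (map \<psi> w)"
proof -
  interpret D: semicategory D by (rule D)
  have \<psi>: "map \<psi> w \<in> lists (Arr D)" if "w \<in> lists (Arr C)" for w
    using that sfunD(2)[OF F] by auto
  have step: "red D (map \<psi> (rcons C a w)) = rcons D (\<psi> a) (red D (map \<psi> w))"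
    if "a \<in> Arr C" "w \<in> lists (Arr C)" for a w
  proof (cases w)
    case (Cons b u)
    then show ?thesis
      using that sfunD[OF F] D.rcons_Cmp[of "\<psi> a" "\<psi> b" "red D (map \<psi> u)"] D.red_closed[OF \<psi>[of u]]
      by (auto simp: rcons_simps rcons_def[of C a "b # u"])
  qed (simp add: rcons_simps)
  show ?thesis
    using w
  proof (induction w)
    case (Cons a w)
    then show ?case using step[of a "red C w"] red_closed[of w] by simp
  qed simp
qed

end

section \<open>Generating semifunctors\<close>

inductive_set generated :: "('o, 'a) semicat \<Rightarrow> 'a set \<Rightarrow> 'a set" for B S where
  base: "a \<in> S \<Longrightarrow> a \<in> generated B S"
| step: "a \<in> generated B S \<Longrightarrow> b \<in> generated B S \<Longrightarrow> Src B b = Tgt B a \<Longrightarrow> Cmp B b a \<in> generated B S"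

lemma (in semicategory) generated_Arr: "a \<in> generated C S \<Longrightarrow> S \<subseteq> Arr C \<Longrightarrow> a \<in> Arr C"
  by (induction rule: generated.induct) (auto simp: Cmp_Arr)

definition generating :: "('o, 'a) semicat \<Rightarrow> ('p, 'b) semicat \<Rightarrow> ('o \<Rightarrow> 'p) \<Rightarrow> ('a \<Rightarrow> 'b) \<Rightarrow> bool" where
  "generating A B \<phi> \<psi> \<longleftrightarrow> \<phi> ` Obj A = Obj B \<and> Arr B = generated B (\<psi> ` Arr A)"

text \<open>A composite of images is encoded by a word over \<open>A\<close> even if its letters do
  not compose in \<open>A\<close>: mapped to \<open>B\<close>, the word reduces to a single letter.
  Composition corresponds to concatenation, the later arrow standing on the left.\<close>

lemma generated_word:
  assumes "semicategory B" "sfun A B \<phi> \<psi>" "b \<in> generated B (\<psi> ` Arr A)"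
  obtains u where "u \<in> lists (Arr A)" "red B (map \<psi> u) = [b]"
proof -
  interpret semicategory B by fact
  have "\<exists>u\<in>lists (Arr A). red B (map \<psi> u) = [b]"
    using assms(3)
  proof induction
    case (base b)
    then obtain a where "a \<in> Arr A" "b = \<psi> a" by blast
    then show ?case by (intro bexI[of _ "[a]"]) (simp_all add: rcons_simps)
  next
    case (step b c)
    then obtain u v where u: "u \<in> lists (Arr A)" "red B (map \<psi> u) = [b]"
      and v: "v \<in> lists (Arr A)" "red B (map \<psi> v) = [c]" by blast
    have "map \<psi> u \<in> lists (Arr B)" "map \<psi> v \<in> lists (Arr B)" using u v sfunD(2)[OF assms(2)] by auto
    then have "red B (map \<psi> (v @ u)) = [Cmp B c b]"
      using u v step by (simp add: red_append rcons_simps)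
    then show ?case using u v by (intro bexI[of _ "v @ u"]) auto
  qed
  then show thesis using that by blast
qed

text \<open>The universal property of a generating semifunctor, with the kernel condition in terms
  of objects and words. The value at \<open>b\<close> is the first letter of the reduced image in
  \<open>D\<close> of any word over \<open>A\<close> representing \<open>b\<close>;
  \<open>word\<close> makes the choice irrelevant.\<close>

lemma generated_factor:
  assumes B: "semicategory B" and D: "semicategory D"
    and e: "sfun A B \<phi> \<psi>" "generating A B \<phi> \<psi>" and g: "sfun A D \<phi>' \<psi>'"
    and obj: "\<And>x y. x \<in> Obj A \<Longrightarrow> y \<in> Obj A \<Longrightarrow> \<phi> x = \<phi> y \<Longrightarrow> \<phi>' x = \<phi>' y"
    and word: "\<And>u v. u \<in> lists (Arr A) \<Longrightarrow> v \<in> lists (Arr A) \<Longrightarrow>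
      red B (map \<psi> u) = red B (map \<psi> v) \<Longrightarrow> red D (map \<psi>' u) = red D (map \<psi>' v)"
    and A: "semicategory A"
  obtains \<phi>h \<psi>h where "sfun B D \<phi>h \<psi>h" "\<And>x. x \<in> Obj A \<Longrightarrow> \<phi>h (\<phi> x) = \<phi>' x"
    "\<And>a. a \<in> Arr A \<Longrightarrow> \<psi>h (\<psi> a) = \<psi>' a"
proof -
  interpret A: semicategory A by fact
  interpret B: semicategory B by fact
  interpret D: semicategory D by fact
  define \<phi>h where "\<phi>h y = \<phi>' (SOME x. x \<in> Obj A \<and> \<phi> x = y)" for y
  have \<phi>h: "\<phi>h (\<phi> x) = \<phi>' x" if "x \<in> Obj A" for x
    unfolding \<phi>h_def by (rule someI2[of _ x]) (use that in simp, use that in \<open>blast intro: obj\<close>)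
  define \<psi>h where "\<psi>h b = hd (red D (map \<psi>' (SOME u. u \<in> lists (Arr A) \<and> red B (map \<psi> u) = [b])))" for b
  have \<psi>h: "\<psi>h b = d" if "u \<in> lists (Arr A)" "red B (map \<psi> u) = [b]" "red D (map \<psi>' u) = [d]" for u b d
    unfolding \<psi>h_def
  proof (rule someI2[of _ u])
    show "u \<in> lists (Arr A) \<and> red B (map \<psi> u) = [b]" using that by simp
    show "hd (red D (map \<psi>' v)) = d" if v: "v \<in> lists (Arr A) \<and> red B (map \<psi> v) = [b]" for v
      using word[of v u] v \<open>u \<in> lists (Arr A)\<close> \<open>red B (map \<psi> u) = [b]\<close> \<open>red D (map \<psi>' u) = [d]\<close> by simp
  qed
  have map_lists: "map \<psi> u \<in> lists (Arr B)" "map \<psi>' u \<in> lists (Arr D)" if "u \<in> lists (Arr A)" for u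
    using that sfunD(2)[OF e(1)] sfunD(2)[OF g] by auto
  \<comment> \<open>That the reduced word in \<open>D\<close> has a single letter is proved along
    the generation of \<open>b\<close>: endpoints in \<open>D\<close> are the
    \<open>\<phi>h\<close>-images of endpoints in \<open>B\<close>, so what composes in
    \<open>B\<close> composes in \<open>D\<close>. One representing word suffices, since by
    \<open>word\<close> all others reduce to the same result.\<close>
  have *: "\<exists>u\<in>lists (Arr A). red B (map \<psi> u) = [b] \<and> (\<exists>d\<in>Arr D. red D (map \<psi>' u) = [d] \<and>
      Src D d = \<phi>h (Src B b) \<and> Tgt D d = \<phi>h (Tgt B b))" if "b \<in> Arr B" for b
  proof -
    have "b \<in> generated B (\<psi> ` Arr A)" using that e(2) by (simp add: generating_def)
    then show ?thesis
    proof induction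
      case (base b)
      then obtain a where "a \<in> Arr A" "b = \<psi> a" by blast
      then show ?case
        using sfunD[OF e(1)] sfunD[OF g] \<phi>h A.Src_closed A.Tgt_closed
        by (intro bexI[of _ "[a]"]) (simp_all add: rcons_simps)
    next
      case (step b c)
      then obtain u v d d' where u: "u \<in> lists (Arr A)" "red B (map \<psi> u) = [b]"
        and v: "v \<in> lists (Arr A)" "red B (map \<psi> v) = [c]"
        and d: "d \<in> Arr D" "red D (map \<psi>' u) = [d]" "Src D d = \<phi>h (Src B b)" "Tgt D d = \<phi>h (Tgt B b)"
        and d': "d' \<in> Arr D" "red D (map \<psi>' v) = [d']" "Src D d' = \<phi>h (Src B c)" "Tgt D d' = \<phi>h (Tgt B c)"
        by blast
      have bc: "b \<in> Arr B" "c \<in> Arr B"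
        using step.hyps B.generated_Arr[of _ "\<psi> ` Arr A"] sfunD(2)[OF e(1)] by auto
      have "red B (map \<psi> (v @ u)) = [Cmp B c b]" "red D (map \<psi>' (v @ u)) = [Cmp D d' d]"
        using u v d d' step map_lists by (simp_all add: B.red_append D.red_append rcons_simps)
      moreover have "v @ u \<in> lists (Arr A)" using u v by auto
      ultimately show ?case
        using d d' step bc by (intro bexI[of _ "v @ u"]) (auto simp: D.Cmp_Arr B.Cmp_Arr)
    qed
  qed
  have "sfun B D \<phi>h \<psi>h"
  proof (rule sfunI)
    fix y assume "y \<in> Obj B"
    then obtain x where "x \<in> Obj A" "y = \<phi> x" using e(2) by (auto simp: generating_def)
    then show "\<phi>h y \<in> Obj D" using \<phi>h sfunD(1)[OF g] by simp
  next
    fix b assume "b \<in> Arr B"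
    from *[OF this] obtain u d where u: "u \<in> lists (Arr A)" "red B (map \<psi> u) = [b]" "d \<in> Arr D"
      "red D (map \<psi>' u) = [d]" and d: "Src D d = \<phi>h (Src B b)" "Tgt D d = \<phi>h (Tgt B b)" by blast
    have "\<psi>h b = d" using u by (intro \<psi>h)
    then show "\<psi>h b \<in> Arr D" "Src D (\<psi>h b) = \<phi>h (Src B b)" "Tgt D (\<psi>h b) = \<phi>h (Tgt B b)"
      using u d by simp_all
  next
    fix b c assume b: "b \<in> Arr B" and c: "c \<in> Arr B" and cb: "Src B c = Tgt B b"
    from *[OF b] obtain u d where u: "u \<in> lists (Arr A)" "red B (map \<psi> u) = [b]" "d \<in> Arr D"
      "red D (map \<psi>' u) = [d]" "Tgt D d = \<phi>h (Tgt B b)" by blast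
    from *[OF c] obtain v d' where v: "v \<in> lists (Arr A)" "red B (map \<psi> v) = [c]" "d' \<in> Arr D"
      "red D (map \<psi>' v) = [d']" "Src D d' = \<phi>h (Src B c)" by blast
    have "red B (map \<psi> (v @ u)) = [Cmp B c b]" "red D (map \<psi>' (v @ u)) = [Cmp D d' d]"
      using u v cb map_lists by (simp_all add: B.red_append D.red_append rcons_simps)
    moreover have "v @ u \<in> lists (Arr A)" using u v by auto
    ultimately have "\<psi>h (Cmp B c b) = Cmp D d' d" by (intro \<psi>h)
    then show "\<psi>h (Cmp B c b) = Cmp D (\<psi>h c) (\<psi>h b)"
      using \<psi>h[OF u(1,2,4)] \<psi>h[OF v(1,2,4)] by simp
  qed
  moreover have "\<psi>h (\<psi> a) = \<psi>' a" if "a \<in> Arr A" for a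
    using that by (intro \<psi>h[of "[a]"]) (simp_all add: rcons_simps)
  ultimately show thesis using that \<phi>h by blast
qed

lemma generating_unique:
  assumes e: "sfun A B \<phi> \<psi>" "generating A B \<phi> \<psi>" and B: "semicategory B"
    and h: "sfun B D \<phi>1 \<psi>1" "sfun B D \<phi>2 \<psi>2"
    and \<psi>: "\<And>a. a \<in> Arr A \<Longrightarrow> \<psi>1 (\<psi> a) = \<psi>2 (\<psi> a)" and b: "b \<in> Arr B"
  shows "\<psi>1 b = \<psi>2 b"
proof -
  interpret semicategory B by fact
  have "b \<in> generated B (\<psi> ` Arr A)" using b e(2) by (simp add: generating_def)
  then show ?thesis
  proof induction
    case (base b)
    then show ?case using \<psi> by auto
  next
    case (step b c)
    then have "b \<in> Arr B" "c \<in> Arr B"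
      using generated_Arr[of _ "\<psi> ` Arr A"] sfunD(2)[OF e(1)] by auto
    then show ?case using step sfunD(5)[OF h(1)] sfunD(5)[OF h(2)] by simp
  qed
qed

section \<open>Transfer of identities and inverses along generating semifunctors\<close>

lemma (in category) is_isoI:
  assumes "f \<in> Hom C X Y" "g \<in> Hom C Y X" "Cmp C g f = Ident C X" "Cmp C f g = Ident C Y"
  shows "is_iso C f"
  using assms HomD[OF assms(1)] unfolding is_iso_def by blast

lemma (in category) is_isoE:
  assumes "is_iso C f" "f \<in> Hom C X Y"
  obtains g where "g \<in> Hom C Y X" "Cmp C g f = Ident C X" "Cmp C f g = Ident C Y"
  using assms HomD[OF assms(2)] unfolding is_iso_def by blast

lemma (in category) is_iso_Cmp:
  assumes "is_iso C f" "is_iso C g" and f: "f \<in> Hom C X Y" and g: "g \<in> Hom C Y Z"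
  shows "is_iso C (Cmp C g f)"
proof -
  obtain f' where f': "f' \<in> Hom C Y X" "Cmp C f' f = Ident C X" "Cmp C f f' = Ident C Y"
    by (rule is_isoE[OF assms(1) f])
  obtain g' where g': "g' \<in> Hom C Z Y" "Cmp C g' g = Ident C Y" "Cmp C g g' = Ident C Z"
    by (rule is_isoE[OF assms(2) g])
  note gf = Cmp_closed[OF f g] and fg' = Cmp_closed[OF g'(1) f'(1)]
  show ?thesis
  proof (rule is_isoI[OF gf fg'])
    have "Cmp C (Cmp C f' g') (Cmp C g f) = Cmp C f' (Cmp C (Cmp C g' g) f)"
      using Cmp_assoc[OF gf g'(1) f'(1)] Cmp_assoc[OF f g g'(1)] by simp
    then show "Cmp C (Cmp C f' g') (Cmp C g f) = Ident C X"
      using f' g' Ident_Cmp[OF f] by simp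
    have "Cmp C (Cmp C g f) (Cmp C f' g') = Cmp C g (Cmp C (Cmp C f f') g')"
      using Cmp_assoc[OF fg' f g] Cmp_assoc[OF g'(1) f'(1) f] by simp
    then show "Cmp C (Cmp C g f) (Cmp C f' g') = Ident C Z"
      using f' g' Ident_Cmp[OF g'(1)] by simp
  qed
qed

text \<open>Serves pullbacks of groupoids, where the images of the two componentwise inverses have
  to agree.\<close>

lemma (in category) inverse_unique:
  assumes f: "f \<in> Hom C X Y" and g: "g \<in> Hom C Y X" and h: "h \<in> Hom C Y X"
    and "Cmp C g f = Ident C X" "Cmp C f h = Ident C Y"
  shows "g = h"
  using Cmp_assoc[OF h f g] assms(4,5) Cmp_Ident[OF g] Ident_Cmp[OF h] by simp

definition unital :: "('o, 'a) semicat \<Rightarrow> ('p, 'b) semicat \<Rightarrow> ('o \<Rightarrow> 'p) \<Rightarrow> ('a \<Rightarrow> 'b) \<Rightarrow> bool" where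
  "unital A B \<phi> \<psi> \<longleftrightarrow> (\<forall>x\<in>Obj A. \<psi> (Ident A x) = Ident B (\<phi> x))"

text \<open>A generating semifunctor preserves identities as soon as it makes no two identities at identified
  objects differ; this covers both images of functors and the quotient constructed for joins.\<close>

lemma generating_ident:
  assumes A: "category A" and B: "semicategory B" and e: "sfun A B \<phi> \<psi>" "generating A B \<phi> \<psi>"
    and id: "\<And>x x'. x \<in> Obj A \<Longrightarrow> x' \<in> Obj A \<Longrightarrow> \<phi> x = \<phi> x' \<Longrightarrow> \<psi> (Ident A x) = \<psi> (Ident A x')"
    and x: "x \<in> Obj A"
  shows "is_ident B (\<phi> x) (\<psi> (Ident A x))"
proof -
  interpret A: category A by fact
  interpret B: semicategory B by fact
  let ?i = "\<psi> (Ident A x)"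
  have i: "?i \<in> Hom B (\<phi> x) (\<phi> x)" by (rule sfun_Hom[OF e(1) A.Ident_Hom[OF x]])
  have ident: "Ident A y \<in> Arr A" "Src A (Ident A y) = y" "Tgt A (Ident A y) = y" if "y \<in> Obj A" for y
    using A.Ident_Hom[OF that] by (auto simp: Hom_def)
  have gen: "b \<in> generated B (\<psi> ` Arr A)" if "b \<in> Arr B" for b using that e(2) by (simp add: generating_def)
  have sub: "\<psi> ` Arr A \<subseteq> Arr B" using sfunD(2)[OF e(1)] by auto
  have right: "Src B b = \<phi> x \<longrightarrow> Cmp B b ?i = b" if "b \<in> generated B (\<psi> ` Arr A)" for b
    using that
  proof induction
    case (base b)
    then obtain a where a: "a \<in> Arr A" "b = \<psi> a" by blast
    have "Cmp B b (\<psi> (Ident A (Src A a))) = b"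
      using sfunD(5)[OF e(1) ident(1) a(1), of "Src A a"] A.Src_closed[OF a(1)] ident a A.Cmp_Ident[OF HomI[OF a(1)]] by simp
    moreover have "?i = \<psi> (Ident A (Src A a))" if "Src B b = \<phi> x"
      using id[OF x A.Src_closed[OF a(1)]] that sfunD(3)[OF e(1) a(1)] a(2) by simp
    ultimately show ?case by simp
  next
    case (step b c)
    then have "b \<in> Arr B" "c \<in> Arr B" using B.generated_Arr[OF _ sub] by auto
    then show ?case using step i B.assoc[of ?i b c] HomD[OF i] by (simp add: B.Cmp_Arr)
  qed
  have left: "Tgt B b = \<phi> x \<longrightarrow> Cmp B ?i b = b" if "b \<in> generated B (\<psi> ` Arr A)" for b
    using that
  proof induction
    case (base b)
    then obtain a where a: "a \<in> Arr A" "b = \<psi> a" by blast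
    have "Cmp B (\<psi> (Ident A (Tgt A a))) b = b"
      using sfunD(5)[OF e(1) a(1) ident(1), of "Tgt A a"] A.Tgt_closed[OF a(1)] ident a A.Ident_Cmp[OF HomI[OF a(1)]] by simp
    moreover have "?i = \<psi> (Ident A (Tgt A a))" if "Tgt B b = \<phi> x"
      using id[OF x A.Tgt_closed[OF a(1)]] that sfunD(4)[OF e(1) a(1)] a(2) by simp
    ultimately show ?case by simp
  next
    case (step b c)
    then have "b \<in> Arr B" "c \<in> Arr B" using B.generated_Arr[OF _ sub] by auto
    then show ?case using step i B.assoc[of b c ?i] HomD[OF i] by (simp add: B.Cmp_Arr)
  qed
  show ?thesis unfolding is_ident_def using i left right gen by blast
qed

lemma generating_category:
  assumes A: "category A" and B: "semicategory B" and e: "sfun A B \<phi> \<psi>" "generating A B \<phi> \<psi>"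
    and id: "\<And>x x'. x \<in> Obj A \<Longrightarrow> x' \<in> Obj A \<Longrightarrow> \<phi> x = \<phi> x' \<Longrightarrow> \<psi> (Ident A x) = \<psi> (Ident A x')"
  shows "category B" and "unital A B \<phi> \<psi>"
proof -
  have ident: "is_ident B (\<phi> x) (\<psi> (Ident A x))" if "x \<in> Obj A" for x
    by (rule generating_ident[OF A B e _ that]) (rule id)
  show "category B"
  proof (intro category.intro category_axioms.intro B)
    fix y assume "y \<in> Obj B"
    then obtain x where "x \<in> Obj A" "y = \<phi> x" using e(2) by (auto simp: generating_def)
    then show "\<exists>i. is_ident B y i" using ident by blast
  qed
  show "unital A B \<phi> \<psi>" unfolding unital_def using Ident_eqI[OF ident] by simp
qed

text \<open>Images of arrows of \<open>A\<close> are invertible because identities are preserved,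
  and composites of invertible arrows are invertible.\<close>

lemma generating_groupoid:
  assumes A: "groupoid A" and B: "category B" and e: "sfun A B \<phi> \<psi>" "generating A B \<phi> \<psi>"
    and u: "unital A B \<phi> \<psi>"
  shows "groupoid B"
proof -
  interpret A: groupoid A by fact
  interpret B: category B by fact
  have sub: "\<psi> ` Arr A \<subseteq> Arr B" using sfunD(2)[OF e(1)] by auto
  have "is_iso B b" if "b \<in> generated B (\<psi> ` Arr A)" for b
    using that
  proof induction
    case (base b)
    then obtain a where a: "a \<in> Arr A" "b = \<psi> a" by blast
    obtain a' where a': "a' \<in> Hom A (Tgt A a) (Src A a)"
      "Cmp A a' a = Ident A (Src A a)" "Cmp A a a' = Ident A (Tgt A a)"
      by (rule A.is_isoE[OF A.all_iso[OF a(1)] HomI[OF a(1)]])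
    have "Cmp B (\<psi> a') (\<psi> a) = Ident B (\<phi> (Src A a))"
      using sfunD(5)[OF e(1) a(1) HomD(1)[OF a'(1)]] HomD[OF a'(1)] a'(2) u A.Src_closed[OF a(1)]
      by (simp add: unital_def)
    moreover have "Cmp B (\<psi> a) (\<psi> a') = Ident B (\<phi> (Tgt A a))"
      using sfunD(5)[OF e(1) HomD(1)[OF a'(1)] a(1)] HomD[OF a'(1)] a'(3) u A.Tgt_closed[OF a(1)]
      by (simp add: unital_def)
    ultimately show ?case unfolding a(2)
      by (intro B.is_isoI[OF sfun_Hom[OF e(1) HomI[OF a(1)]] sfun_Hom[OF e(1) a'(1)]])
  next
    case (step b c)
    then have "b \<in> Arr B" "c \<in> Arr B" using B.generated_Arr[OF _ sub] by auto
    then show ?case using step by (intro B.is_iso_Cmp) (auto simp: Hom_def)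
  qed
  then show ?thesis
    using e(2) by (intro groupoid.intro B groupoid_axioms.intro) (simp add: generating_def)
qed

section \<open>Images, pullbacks and pushouts of semicategories\<close>

text \<open>The flag \<open>u\<close> asks for identities and \<open>g\<close> for inverses, so that semicategories, categories and
  groupoids are the three cases with \<open>g \<longrightarrow> u\<close>.\<close>

definition kind :: "bool \<Rightarrow> bool \<Rightarrow> ('o, 'a) semicat \<Rightarrow> bool" where
  "kind u g A \<longleftrightarrow> semicategory A \<and> (u \<longrightarrow> category A) \<and> (g \<longrightarrow> groupoid A)"

text \<open>Images, encoded copies and pushouts all receive a generating semifunctor from a
  structure of the right kind, so for each of them only the condition on identities has to be
  checked.\<close>

lemma generating_kind:
  assumes "kind u g A" "g \<longrightarrow> u" "semicategory B" "sfun A B \<phi> \<psi>" "generating A B \<phi> \<psi>"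
    and id: "\<And>x x'. u \<Longrightarrow> x \<in> Obj A \<Longrightarrow> x' \<in> Obj A \<Longrightarrow> \<phi> x = \<phi> x' \<Longrightarrow> \<psi> (Ident A x) = \<psi> (Ident A x')"
  shows "kind u g B" and "u \<Longrightarrow> unital A B \<phi> \<psi>"
proof -
  have *: "category B" "unital A B \<phi> \<psi>" if u
    using generating_category[OF _ assms(3,4,5)] assms(1) id[OF that] that unfolding kind_def by blast+
  then show "u \<Longrightarrow> unital A B \<phi> \<psi>" by blast
  have "groupoid B" if g
    using generating_groupoid[OF _ _ assms(4,5)] * assms(1,2) that unfolding kind_def by blast
  then show "kind u g B" using * assms(3) unfolding kind_def by blast
qed

text \<open>Source, target and composition are cut off outside the chosen arrows, as
  \<open>small_semicategory\<close> demands.\<close>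

definition subcat :: "('o, 'a) semicat \<Rightarrow> 'o set \<Rightarrow> 'a set \<Rightarrow> ('o, 'a) semicat" where
  "subcat B S R = \<lparr>Obj = S, Arr = R, Src = restrict (Src B) R, Tgt = restrict (Tgt B) R,
     Cmp = \<lambda>g f. if f \<in> R \<and> g \<in> R \<and> Src B g = Tgt B f then Cmp B g f else undefined\<rparr>"

lemma subcat_simps [simp]:
  "Obj (subcat B S R) = S" "Arr (subcat B S R) = R"
  "f \<in> R \<Longrightarrow> Src (subcat B S R) f = Src B f" "f \<in> R \<Longrightarrow> Tgt (subcat B S R) f = Tgt B f"
  "f \<in> R \<Longrightarrow> g \<in> R \<Longrightarrow> Src B g = Tgt B f \<Longrightarrow> Cmp (subcat B S R) g f = Cmp B g f"
  by (simp_all add: subcat_def)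

text \<open>For a semifunctor, the smallest subsemicategory of \<open>B\<close> through which it
  factors.\<close>

definition imcat :: "('o, 'a) semicat \<Rightarrow> ('p, 'b) semicat \<Rightarrow> ('o \<Rightarrow> 'p) \<Rightarrow> ('a \<Rightarrow> 'b) \<Rightarrow> ('p, 'b) semicat" where
  "imcat A B \<phi> \<psi> = subcat B (\<phi> ` Obj A) (generated B (\<psi> ` Arr A))"

lemma imcat:
  assumes A: "semicategory A" and B: "semicategory B" and e: "sfun A B \<phi> \<psi>"
  shows "semicategory (imcat A B \<phi> \<psi>)" and "sfun A (imcat A B \<phi> \<psi>) \<phi> \<psi>"
    and "generating A (imcat A B \<phi> \<psi>) \<phi> \<psi>" and "sfun (imcat A B \<phi> \<psi>) B (\<lambda>x. x) (\<lambda>f. f)"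
    and "Obj (imcat A B \<phi> \<psi>) \<subseteq> Obj B" and "Arr (imcat A B \<phi> \<psi>) \<subseteq> Arr B"
proof -
  interpret A: semicategory A by fact
  interpret B: semicategory B by fact
  let ?R = "generated B (\<psi> ` Arr A)"
  let ?I = "imcat A B \<phi> \<psi>"
  have sub: "\<psi> ` Arr A \<subseteq> Arr B" using sfunD(2)[OF e] by auto
  have R_sub: "?R \<subseteq> Arr B" using B.generated_Arr[OF _ sub] by blast
  have ends: "Src B b \<in> \<phi> ` Obj A \<and> Tgt B b \<in> \<phi> ` Obj A" if "b \<in> ?R" for b
    using that
  proof induction
    case (base b)
    then show ?case using sfunD(3,4)[OF e] A.Src_closed A.Tgt_closed by auto
  next
    case (step b c)
    moreover have "b \<in> Arr B" "c \<in> Arr B" using step.hyps R_sub by auto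
    ultimately show ?case by (simp add: B.Cmp_Arr)
  qed
  show I: "semicategory ?I"
  proof
    fix f g h X Y Z W
    show "f \<in> Arr ?I \<Longrightarrow> Src ?I f \<in> Obj ?I" "f \<in> Arr ?I \<Longrightarrow> Tgt ?I f \<in> Obj ?I"
      using ends by (simp_all add: imcat_def)
    assume f: "f \<in> Hom ?I X Y" and g: "g \<in> Hom ?I Y Z"
    have fg: "f \<in> ?R" "g \<in> ?R" "Src B f = X" "Tgt B f = Y" "Src B g = Y" "Tgt B g = Z"
      using HomD[OF f] HomD[OF g] by (simp_all add: imcat_def)
    then have gf: "Cmp B g f \<in> ?R" by (auto intro: generated.step)
    show "Cmp ?I g f \<in> Hom ?I X Z"
      using fg gf R_sub by (auto simp: imcat_def Hom_def B.Cmp_Arr subset_iff)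
    assume h: "h \<in> Hom ?I Z W"
    have hh: "h \<in> ?R" "Src B h = Z" "Tgt B h = W" using HomD[OF h] by (simp_all add: imcat_def)
    then have hg: "Cmp B h g \<in> ?R" using fg by (auto intro: generated.step)
    show "Cmp ?I h (Cmp ?I g f) = Cmp ?I (Cmp ?I h g) f"
      using fg hh gf hg R_sub B.assoc[of f g h] by (simp add: imcat_def B.Cmp_Arr subset_iff)
  qed
  show "sfun A ?I \<phi> \<psi>"
    using sfunD[OF e] by (intro sfunI) (auto simp: imcat_def generated.base)
  show "sfun ?I B (\<lambda>x. x) (\<lambda>f. f)"
    using sfunD(1)[OF e] R_sub by (intro sfunI) (auto simp: imcat_def)
  show "Obj ?I \<subseteq> Obj B" "Arr ?I \<subseteq> Arr B" using R_sub sfunD(1)[OF e] by (auto simp: imcat_def)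
  have "Arr ?I = generated ?I (\<psi> ` Arr A)"
  proof (intro equalityI subsetI)
    fix b assume "b \<in> Arr ?I"
    then have "b \<in> ?R" by (simp add: imcat_def)
    then show "b \<in> generated ?I (\<psi> ` Arr A)"
    proof induction
      case (step b c)
      then show ?case using generated.step[of b ?I "\<psi> ` Arr A" c] by (simp add: imcat_def)
    qed (rule generated.base)
  next
    fix b assume "b \<in> generated ?I (\<psi> ` Arr A)"
    then show "b \<in> Arr ?I"
      by (rule semicategory.generated_Arr[OF I]) (auto simp: imcat_def generated.base)
  qed
  moreover have "\<phi> ` Obj A = Obj ?I" by (simp add: imcat_def)
  ultimately show "generating A ?I \<phi> \<psi>" unfolding generating_def by (rule conjI[rotated])
qed

text \<open>A copy of \<open>P\<close> on other types: pullbacks and pushouts have pairs and triples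
  as arrows, whereas the objects of the large categories live on \<open>'u\<close>. The values
  \<open>undefined\<close> bring the copy into the canonical form of
  \<open>small_semicategory\<close>.\<close>

definition encode :: "('o \<Rightarrow> 'p) \<Rightarrow> ('a \<Rightarrow> 'b) \<Rightarrow> ('o, 'a) semicat \<Rightarrow> ('p, 'b) semicat" where
  "encode \<alpha> \<beta> P = \<lparr>Obj = \<alpha> ` Obj P, Arr = \<beta> ` Arr P,
     Src = restrict (\<lambda>b. \<alpha> (Src P (inv_into (Arr P) \<beta> b))) (\<beta> ` Arr P),
     Tgt = restrict (\<lambda>b. \<alpha> (Tgt P (inv_into (Arr P) \<beta> b))) (\<beta> ` Arr P),
     Cmp = \<lambda>g f. if f \<in> \<beta> ` Arr P \<and> g \<in> \<beta> ` Arr P \<and>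
         Src P (inv_into (Arr P) \<beta> g) = Tgt P (inv_into (Arr P) \<beta> f)
       then \<beta> (Cmp P (inv_into (Arr P) \<beta> g) (inv_into (Arr P) \<beta> f)) else undefined\<rparr>"

lemma encode:
  assumes P: "semicategory P" and \<alpha>: "inj_on \<alpha> (Obj P)" and \<beta>: "inj_on \<beta> (Arr P)"
  shows "semicategory (encode \<alpha> \<beta> P)" and "sfun P (encode \<alpha> \<beta> P) \<alpha> \<beta>"
    and "generating P (encode \<alpha> \<beta> P) \<alpha> \<beta>"
    and "sfun (encode \<alpha> \<beta> P) P (inv_into (Obj P) \<alpha>) (inv_into (Arr P) \<beta>)"
proof -
  interpret semicategory P by fact
  let ?Q = "encode \<alpha> \<beta> P"
  have simps: "Obj ?Q = \<alpha> ` Obj P" "Arr ?Q = \<beta> ` Arr P"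
    "\<And>f. f \<in> Arr P \<Longrightarrow> Src ?Q (\<beta> f) = \<alpha> (Src P f)" "\<And>f. f \<in> Arr P \<Longrightarrow> Tgt ?Q (\<beta> f) = \<alpha> (Tgt P f)"
    "\<And>f g. f \<in> Arr P \<Longrightarrow> g \<in> Arr P \<Longrightarrow> Src P g = Tgt P f \<Longrightarrow> Cmp ?Q (\<beta> g) (\<beta> f) = \<beta> (Cmp P g f)"
    using \<beta> by (simp_all add: encode_def)
  have \<alpha>_iff: "\<alpha> x = \<alpha> y \<longleftrightarrow> x = y" if "x \<in> Obj P" "y \<in> Obj P" for x y
    using that \<alpha> by (simp add: inj_on_eq_iff)
  show "semicategory ?Q"
  proof
    fix f g h X Y Z W
    show "f \<in> Arr ?Q \<Longrightarrow> Src ?Q f \<in> Obj ?Q" "f \<in> Arr ?Q \<Longrightarrow> Tgt ?Q f \<in> Obj ?Q"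
      using Src_closed Tgt_closed by (auto simp: simps)
    assume "f \<in> Hom ?Q X Y" "g \<in> Hom ?Q Y Z"
    then obtain f' g' where f: "f = \<beta> f'" "f' \<in> Arr P" "X = \<alpha> (Src P f')" "Y = \<alpha> (Tgt P f')"
      and g: "g = \<beta> g'" "g' \<in> Arr P" "Y = \<alpha> (Src P g')" "Z = \<alpha> (Tgt P g')"
      by (auto simp: Hom_def simps)
    have gf: "Src P g' = Tgt P f'" using f g \<alpha>_iff Src_closed Tgt_closed by metis
    show "Cmp ?Q g f \<in> Hom ?Q X Z"
      using f g gf by (auto simp: Hom_def simps Cmp_Arr)
    assume "h \<in> Hom ?Q Z W"
    then obtain h' where h: "h = \<beta> h'" "h' \<in> Arr P" "Z = \<alpha> (Src P h')"
      by (auto simp: Hom_def simps)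
    have hg: "Src P h' = Tgt P g'" using h g \<alpha>_iff Src_closed Tgt_closed by metis
    show "Cmp ?Q h (Cmp ?Q g f) = Cmp ?Q (Cmp ?Q h g) f"
      using f g h gf hg assoc[of f' g' h'] by (simp add: simps Cmp_Arr)
  qed
  show "sfun P ?Q \<alpha> \<beta>" by (intro sfunI) (simp_all add: simps)
  have "Arr ?Q = generated ?Q (\<beta> ` Arr P)"
  proof (intro equalityI subsetI)
    show "b \<in> generated ?Q (\<beta> ` Arr P)" if "b \<in> Arr ?Q" for b
      using that by (auto simp: simps intro: generated.base)
    show "b \<in> Arr ?Q" if "b \<in> generated ?Q (\<beta> ` Arr P)" for b
      by (rule semicategory.generated_Arr[OF \<open>semicategory ?Q\<close> that]) (simp add: simps)
  qed
  moreover have "\<alpha> ` Obj P = Obj ?Q" by (simp add: simps)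
  ultimately show "generating P ?Q \<alpha> \<beta>" unfolding generating_def by (rule conjI[rotated])
  show "sfun ?Q P (inv_into (Obj P) \<alpha>) (inv_into (Arr P) \<beta>)"
  proof (rule sfunI)
    fix x assume "x \<in> Obj ?Q"
    then show "inv_into (Obj P) \<alpha> x \<in> Obj P" by (auto simp: simps \<alpha>)
  next
    fix f assume "f \<in> Arr ?Q"
    then obtain f' where f: "f = \<beta> f'" "f' \<in> Arr P" by (auto simp: simps)
    then show "inv_into (Arr P) \<beta> f \<in> Arr P"
      "Src P (inv_into (Arr P) \<beta> f) = inv_into (Obj P) \<alpha> (Src ?Q f)"
      "Tgt P (inv_into (Arr P) \<beta> f) = inv_into (Obj P) \<alpha> (Tgt ?Q f)"
      using Src_closed Tgt_closed by (simp_all add: simps \<alpha> \<beta>)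
  next
    fix f g assume "f \<in> Arr ?Q" "g \<in> Arr ?Q" and gf: "Src ?Q g = Tgt ?Q f"
    then obtain f' g' where f: "f = \<beta> f'" "f' \<in> Arr P" and g: "g = \<beta> g'" "g' \<in> Arr P"
      by (auto simp: simps)
    then have "Src P g' = Tgt P f'"
      using gf \<alpha>_iff[OF Src_closed Tgt_closed, of g' f'] by (simp add: simps)
    then show "inv_into (Arr P) \<beta> (Cmp ?Q g f) = Cmp P (inv_into (Arr P) \<beta> g) (inv_into (Arr P) \<beta> f)"
      using f g by (simp add: simps \<beta> Cmp_Arr)
  qed
qed

lemma encode_simps:
  "Obj (encode \<alpha> \<beta> P) = \<alpha> ` Obj P" "Arr (encode \<alpha> \<beta> P) = \<beta> ` Arr P"
  by (simp_all add: encode_def)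

lemma encode_small:
  fixes \<alpha> :: "'o \<Rightarrow> 'u" and \<beta> :: "'a \<Rightarrow> 'u"
  assumes P: "semicategory P" and \<alpha>: "inj_on \<alpha> (Obj P)" and \<beta>: "inj_on \<beta> (Arr P)"
    and small: "small TYPE('u) (Obj P)" "small TYPE('u) (Arr P)"
  shows "small_semicategory (encode \<alpha> \<beta> P)"
proof -
  interpret semicategory P by fact
  \<comment> \<open>The copy tests composability on preimages; injectivity of \<alpha> turns this
    into the test on encoded endpoints.\<close>
  have "Src P g = Tgt P f \<longleftrightarrow> \<alpha> (Src P g) = \<alpha> (Tgt P f)" if "f \<in> Arr P" "g \<in> Arr P" for f g
    using that \<alpha> Src_closed Tgt_closed by (simp add: inj_on_eq_iff)
  then show ?thesis
    unfolding small_semicategory_def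
    using encode(1)[OF P \<alpha> \<beta>] small_image[OF small(1)] small_image[OF small(2)] \<beta>
    by (auto simp: encode_def)
qed

section \<open>Pullbacks, with their identities and inverses\<close>

definition pullback ::
  "('o, 'a) semicat \<Rightarrow> ('p, 'b) semicat \<Rightarrow> ('o \<Rightarrow> 'q) \<Rightarrow> ('a \<Rightarrow> 'c) \<Rightarrow> ('p \<Rightarrow> 'q) \<Rightarrow> ('b \<Rightarrow> 'c) \<Rightarrow> ('o \<times> 'p, 'a \<times> 'b) semicat"
  where
  "pullback A A' \<phi> \<psi> \<phi>' \<psi>' = \<lparr>Obj = {(x, y). x \<in> Obj A \<and> y \<in> Obj A' \<and> \<phi> x = \<phi>' y},
     Arr = {(f, g). f \<in> Arr A \<and> g \<in> Arr A' \<and> \<psi> f = \<psi>' g},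
     Src = \<lambda>(f, g). (Src A f, Src A' g), Tgt = \<lambda>(f, g). (Tgt A f, Tgt A' g),
     Cmp = \<lambda>(h, k) (f, g). (Cmp A h f, Cmp A' k g)\<rparr>"

lemma pullback:
  assumes A: "semicategory A" and A': "semicategory A'"
    and f: "sfun A B \<phi> \<psi>" and f': "sfun A' B \<phi>' \<psi>'"
  shows "semicategory (pullback A A' \<phi> \<psi> \<phi>' \<psi>')"
    and "sfun (pullback A A' \<phi> \<psi> \<phi>' \<psi>') A fst fst" and "sfun (pullback A A' \<phi> \<psi> \<phi>' \<psi>') A' snd snd"
proof -
  interpret A: semicategory A by fact
  interpret A': semicategory A' by fact
  let ?P = "pullback A A' \<phi> \<psi> \<phi>' \<psi>'"
  have ends: "\<phi> (Src A a) = \<phi>' (Src A' b)" "\<phi> (Tgt A a) = \<phi>' (Tgt A' b)"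
    if "a \<in> Arr A" "b \<in> Arr A'" "\<psi> a = \<psi>' b" for a b
    using sfunD(3,4)[OF f that(1)] sfunD(3,4)[OF f' that(2)] that(3) by simp_all
  have cmp: "\<psi> (Cmp A c a) = \<psi>' (Cmp A' d b)"
    if "a \<in> Arr A" "b \<in> Arr A'" "\<psi> a = \<psi>' b" "c \<in> Arr A" "d \<in> Arr A'" "\<psi> c = \<psi>' d"
      "Src A c = Tgt A a" "Src A' d = Tgt A' b" for a b c d
    using that by (simp add: sfunD(5)[OF f] sfunD(5)[OF f'])
  show "semicategory ?P"
  proof
    fix f g h X Y Z W
    show "f \<in> Arr ?P \<Longrightarrow> Src ?P f \<in> Obj ?P" "f \<in> Arr ?P \<Longrightarrow> Tgt ?P f \<in> Obj ?P"
      using ends A.Src_closed A.Tgt_closed A'.Src_closed A'.Tgt_closed by (auto simp: pullback_def)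
    assume f: "f \<in> Hom ?P X Y" and g: "g \<in> Hom ?P Y Z"
    then show "Cmp ?P g f \<in> Hom ?P X Z"
      using cmp by (auto simp: pullback_def Hom_def A.Cmp_Arr A'.Cmp_Arr)
    assume "h \<in> Hom ?P Z W"
    with f g show "Cmp ?P h (Cmp ?P g f) = Cmp ?P (Cmp ?P h g) f"
      by (auto simp: pullback_def Hom_def A.assoc A'.assoc)
  qed
  show "sfun ?P A fst fst" "sfun ?P A' snd snd"
    by (intro sfunI; auto simp: pullback_def)+
qed

text \<open>Identities and inverses are formed componentwise. They belong to the pullback because
  the two maps preserve identities and because inverses in \<open>B\<close> are unique.\<close>

lemma pullback_kind:
  assumes A: "kind u g A" and A': "kind u g A'" and B: "kind u g B" and gu: "g \<longrightarrow> u"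
    and f: "sfun A B \<phi> \<psi>" and f': "sfun A' B \<phi>' \<psi>'"
    and unital: "u \<Longrightarrow> unital A B \<phi> \<psi>" "u \<Longrightarrow> unital A' B \<phi>' \<psi>'"
  shows "kind u g (pullback A A' \<phi> \<psi> \<phi>' \<psi>')"
    and "u \<Longrightarrow> unital (pullback A A' \<phi> \<psi> \<phi>' \<psi>') A fst fst"
    and "u \<Longrightarrow> unital (pullback A A' \<phi> \<psi> \<phi>' \<psi>') A' snd snd"
proof -
  let ?P = "pullback A A' \<phi> \<psi> \<phi>' \<psi>'"
  have semi: "semicategory ?P"
    using pullback(1)[OF _ _ f f'] A A' by (simp add: kind_def)
  have ident: "is_ident ?P (x, y) (Ident A x, Ident A' y)" if u "(x, y) \<in> Obj ?P" for x y
  proof -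
    interpret A: category A using A \<open>u\<close> by (simp add: kind_def)
    interpret A': category A' using A' \<open>u\<close> by (simp add: kind_def)
    have xy: "x \<in> Obj A" "y \<in> Obj A'" "\<phi> x = \<phi>' y" using that by (auto simp: pullback_def)
    then have "\<psi> (Ident A x) = \<psi>' (Ident A' y)" using unital[OF \<open>u\<close>] by (simp add: unital_def)
    then show ?thesis
      using A.Ident_is_ident[OF xy(1)] A'.Ident_is_ident[OF xy(2)]
      by (auto simp: is_ident_def pullback_def Hom_def)
  qed
  then have Ident_P: "Ident ?P (x, y) = (Ident A x, Ident A' y)" if u "(x, y) \<in> Obj ?P" for x y
    using that by (intro Ident_eqI)
  then show "u \<Longrightarrow> unital ?P A fst fst" "u \<Longrightarrow> unital ?P A' snd snd"
    by (auto simp: unital_def)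
  have cat: "category ?P" if u
    using ident[OF that] semi by (intro category.intro category_axioms.intro) auto
  have "groupoid ?P" if g
  proof -
    have u using gu that by simp
    interpret P: category ?P by (rule cat[OF \<open>u\<close>])
    interpret A: groupoid A using A that by (simp add: kind_def)
    interpret A': groupoid A' using A' that by (simp add: kind_def)
    interpret B: groupoid B using B that by (simp add: kind_def)
    show ?thesis
    proof (intro groupoid.intro P.category_axioms groupoid_axioms.intro)
      fix p assume p: "p \<in> Arr ?P"
      then obtain a b where ab: "p = (a, b)" "a \<in> Arr A" "b \<in> Arr A'" "\<psi> a = \<psi>' b"
        by (auto simp: pullback_def)
      obtain a' where a': "a' \<in> Hom A (Tgt A a) (Src A a)"
        "Cmp A a' a = Ident A (Src A a)" "Cmp A a a' = Ident A (Tgt A a)"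
        by (rule A.is_isoE[OF A.all_iso[OF ab(2)] HomI[OF ab(2)]])
      obtain b' where b': "b' \<in> Hom A' (Tgt A' b) (Src A' b)"
        "Cmp A' b' b = Ident A' (Src A' b)" "Cmp A' b b' = Ident A' (Tgt A' b)"
        by (rule A'.is_isoE[OF A'.all_iso[OF ab(3)] HomI[OF ab(3)]])
      have ends: "\<phi> (Src A a) = \<phi>' (Src A' b)" "\<phi> (Tgt A a) = \<phi>' (Tgt A' b)"
        using sfunD(3,4)[OF f ab(2)] sfunD(3,4)[OF f' ab(3)] ab(4) by simp_all
      have "Cmp B (\<psi> a') (\<psi> a) = Ident B (\<phi> (Src A a))"
        using sfunD(5)[OF f ab(2) HomD(1)[OF a'(1)]] HomD[OF a'(1)] a'(2) unital(1)[OF \<open>u\<close>] A.Src_closed[OF ab(2)]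
        by (simp add: unital_def)
      moreover have "Cmp B (\<psi>' b) (\<psi>' b') = Ident B (\<phi>' (Tgt A' b))"
        using sfunD(5)[OF f' HomD(1)[OF b'(1)] ab(3)] HomD[OF b'(1)] b'(3) unital(2)[OF \<open>u\<close>] A'.Tgt_closed[OF ab(3)]
        by (simp add: unital_def)
      ultimately have eq: "\<psi> a' = \<psi>' b'"
        using B.inverse_unique[OF sfun_Hom[OF f HomI[OF ab(2)]] sfun_Hom[OF f a'(1)], of "\<psi>' b'"]
          sfun_Hom[OF f' b'(1)] ab(4) ends by simp
      have p': "(a', b') \<in> Hom ?P (Tgt ?P p) (Src ?P p)"
        using HomD[OF a'(1)] HomD[OF b'(1)] eq ab by (simp add: Hom_def pullback_def)
      have "Cmp ?P (a', b') p = Ident ?P (Src ?P p)" "Cmp ?P p (a', b') = Ident ?P (Tgt ?P p)"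
        using Ident_P[OF \<open>u\<close>] P.Src_closed[OF p] P.Tgt_closed[OF p] a' b' ab
        by (simp_all add: pullback_def)
      then show "is_iso ?P p" by (intro P.is_isoI[OF HomI[OF p] p'])
    qed
  qed
  then show "kind u g ?P" using semi cat by (simp add: kind_def)
qed

text \<open>Injectivity on objects prevents new composable pairs, so \<open>red\<close> performs the
  same multiplications before and after mapping. This is how normal forms turn injectivity on
  objects and arrows into injectivity on words.\<close>

lemma red_map_inj:
  assumes A: "semicategory A" and F: "sfun A B \<phi> \<psi>" and inj: "inj_on \<phi> (Obj A)" and w: "w \<in> lists (Arr A)"
  shows "red B (map \<psi> w) = map \<psi> (red A w)"
  using w
proof (induction w)
  interpret semicategory A by fact
  case (Cons a w)
  then have a: "a \<in> Arr A" and w: "w \<in> lists (Arr A)" by auto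
  note IH = Cons.IH
  show ?case
  proof (cases "red A w")
    case Nil
    then show ?thesis using IH by (simp add: rcons_simps)
  next
    case (Cons b v)
    then have "b \<in> Arr A" using red_closed[OF w] by auto
    moreover from this a have "\<phi> (Src A a) = \<phi> (Tgt A b) \<longleftrightarrow> Src A a = Tgt A b"
      using inj Src_closed Tgt_closed by (simp add: inj_on_eq_iff)
    ultimately show ?thesis
      using a Cons IH sfunD[OF F] by (simp add: rcons_def)
  qed
qed simp

text \<open>The product of the chaotic category on the classes of objects with the semigroup of classes of
  words; \<open>co\<close> and \<open>cw\<close> choose the representatives.  The pushout of two quotients of \<open>A\<close> is the part
  of it that is generated by \<open>A\<close>.\<close>

definition joincat :: "('o, 'a) semicat \<Rightarrow> ('o \<Rightarrow> 'o) \<Rightarrow> ('a list \<Rightarrow> 'a list) \<Rightarrow> ('o, 'o \<times> 'a list \<times> 'o) semicat" where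
  "joincat A co cw = \<lparr>Obj = co ` Obj A,
     Arr = co ` Obj A \<times> cw ` lists (Arr A) \<times> co ` Obj A,
     Src = snd \<circ> snd, Tgt = fst, Cmp = \<lambda>(z, t, _) (_, s, x). (z, cw (t @ s), x)\<rparr>"

definition join_arr :: "('o, 'a) semicat \<Rightarrow> ('o \<Rightarrow> 'o) \<Rightarrow> ('a list \<Rightarrow> 'a list) \<Rightarrow> 'a \<Rightarrow> 'o \<times> 'a list \<times> 'o" where
  "join_arr A co cw a = (co (Tgt A a), cw [a], co (Src A a))"

text \<open>\<open>cw\<close> chooses representatives for a congruence on words:
  \<open>cw_left\<close> and \<open>cw_right\<close> express compatibility with concatenation, and
  \<open>cw_Cmp\<close> says that the relations of the semigroup are contained in it.
  \<open>co\<close> may be any map, as objects only label endpoints.\<close>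

locale word_congruence = semicategory A for A :: "('o, 'a) semicat" +
  fixes co :: "'o \<Rightarrow> 'o" and cw :: "'a list \<Rightarrow> 'a list"
  assumes cw_closed: "w \<in> lists (Arr A) \<Longrightarrow> cw w \<in> lists (Arr A)"
    and cw_left: "v \<in> lists (Arr A) \<Longrightarrow> w \<in> lists (Arr A) \<Longrightarrow> cw (cw v @ w) = cw (v @ w)"
    and cw_right: "v \<in> lists (Arr A) \<Longrightarrow> w \<in> lists (Arr A) \<Longrightarrow> cw (v @ cw w) = cw (v @ w)"
    and cw_Cmp: "f \<in> Arr A \<Longrightarrow> g \<in> Arr A \<Longrightarrow> Src A g = Tgt A f \<Longrightarrow> cw [Cmp A g f] = cw [g, f]"
begin

abbreviation (input) "D \<equiv> joincat A co cw"
abbreviation (input) "\<pi> \<equiv> join_arr A co cw"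

lemma cw_cw: "v \<in> lists (Arr A) \<Longrightarrow> w \<in> lists (Arr A) \<Longrightarrow> cw (cw v @ cw w) = cw (v @ w)"
  by (simp add: cw_left cw_right cw_closed del: in_lists_conv_set)

lemma join_HomE:
  assumes "f \<in> Hom D X Y"
  obtains s where "f = (Y, cw s, X)" "s \<in> lists (Arr A)" "X \<in> co ` Obj A" "Y \<in> co ` Obj A"
proof -
  obtain y s' x where f: "f = (y, s', x)" by (cases f)
  have *: "s' \<in> cw ` lists (Arr A)" "y = Y" "x = X" "X \<in> co ` Obj A" "Y \<in> co ` Obj A"
    using assms unfolding f Hom_def joincat_def by auto
  from *(1) obtain s where "s' = cw s" "s \<in> lists (Arr A)" by (rule imageE)
  then show thesis using that * f by simp
qed

lemma join_semicategory: "semicategory D"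
proof
  fix f g h X Y Z W
  show "f \<in> Arr D \<Longrightarrow> Src D f \<in> Obj D" "f \<in> Arr D \<Longrightarrow> Tgt D f \<in> Obj D"
    by (auto simp: joincat_def)
  assume fH: "f \<in> Hom D X Y" and gH: "g \<in> Hom D Y Z"
  obtain s where f: "f = (Y, cw s, X)" "s \<in> lists (Arr A)" "X \<in> co ` Obj A" by (rule join_HomE[OF fH])
  obtain t where g: "g = (Z, cw t, Y)" "t \<in> lists (Arr A)" "Z \<in> co ` Obj A" by (rule join_HomE[OF gH])
  have ts: "t @ s \<in> lists (Arr A)" using f g by (simp del: in_lists_conv_set)
  have "cw (t @ s) \<in> cw ` lists (Arr A)" using ts by (rule imageI)
  then show "Cmp D g f \<in> Hom D X Z"
    using f g cw_cw[OF g(2) f(2)] by (simp add: Hom_def joincat_def del: in_lists_conv_set)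
  assume hH: "h \<in> Hom D Z W"
  obtain r where h: "h = (W, cw r, Z)" "r \<in> lists (Arr A)" by (rule join_HomE[OF hH])
  have "r @ t \<in> lists (Arr A)" using h g by (simp del: in_lists_conv_set)
  then show "Cmp D h (Cmp D g f) = Cmp D (Cmp D h g) f"
    using f g h ts by (simp add: joincat_def cw_cw del: in_lists_conv_set)
qed

lemma join_sfun: "sfun A D co \<pi>"
proof (rule sfunI)
  fix f g assume "f \<in> Arr A" "g \<in> Arr A" "Src A g = Tgt A f"
  then show "\<pi> (Cmp A g f) = Cmp D (\<pi> g) (\<pi> f)"
    using cw_cw[of "[g]" "[f]"] by (simp add: joincat_def join_arr_def Cmp_Arr cw_Cmp)
qed (auto simp: joincat_def join_arr_def Src_closed Tgt_closed)

text \<open>Taking middle components is a semifunctor from \<open>joincat\<close> to the one-object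
  semigroup of word classes, so multiplying adjacent letters does not change the class of the
  concatenated middle words.\<close>

lemma cw_red:
  assumes "w \<in> lists (Arr D)"
  shows "cw (concat (map (fst \<circ> snd) (red D w))) = cw (concat (map (fst \<circ> snd) w))"
proof -
  interpret D: semicategory D by (rule join_semicategory)
  have mid1: "fst (snd a) \<in> lists (Arr A)" if "a \<in> Arr D" for a
  proof -
    have "fst (snd a) \<in> cw ` lists (Arr A)" using that by (auto simp: joincat_def)
    then obtain s where "fst (snd a) = cw s" "s \<in> lists (Arr A)" by (rule imageE)
    then show ?thesis using cw_closed[of s] by simp
  qed
  have mid: "concat (map (fst \<circ> snd) w) \<in> lists (Arr A)" if "w \<in> lists (Arr D)" for w
    using that by (induction w rule: lists.induct) (use mid1 in auto)
  have step: "cw (concat (map (fst \<circ> snd) (rcons D a w))) = cw (fst (snd a) @ concat (map (fst \<circ> snd) w))"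
    if "a \<in> Arr D" "w \<in> lists (Arr D)" for a w
  proof (cases w)
    case (Cons b v)
    then have b: "b \<in> Arr D" "v \<in> lists (Arr D)" using that by auto
    have "fst (snd (Cmp D a b)) = cw (fst (snd a) @ fst (snd b))"
      by (simp add: joincat_def split: prod.split)
    moreover have "cw (cw (fst (snd a) @ fst (snd b)) @ concat (map (fst \<circ> snd) v)) =
        cw ((fst (snd a) @ fst (snd b)) @ concat (map (fst \<circ> snd) v))"
      using mid1[OF that(1)] mid1[OF b(1)] mid[OF b(2)] by (intro cw_left) simp_all
    ultimately show ?thesis using Cons by (simp add: rcons_def)
  qed (simp add: rcons_simps)
  show ?thesis
    using assms
  proof (induction w)
    case (Cons a w)
    then have a: "a \<in> Arr D" and w: "w \<in> lists (Arr D)" by auto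
    note lists = mid1[OF a] mid[OF w] mid[OF D.red_closed[OF w]]
    have "cw (concat (map (fst \<circ> snd) (red D (a # w)))) = cw (fst (snd a) @ concat (map (fst \<circ> snd) (red D w)))"
      using step[OF a D.red_closed[OF w]] by simp
    also have "\<dots> = cw (fst (snd a) @ cw (concat (map (fst \<circ> snd) (red D w))))"
      by (rule cw_right[OF lists(1,3), symmetric])
    also have "\<dots> = cw (fst (snd a) @ cw (concat (map (fst \<circ> snd) w)))"
      by (simp only: Cons.IH)
    also have "\<dots> = cw (fst (snd a) @ concat (map (fst \<circ> snd) w))"
      by (rule cw_right[OF lists(1,2)])
    finally have eq: "cw (concat (map (fst \<circ> snd) (red D (a # w)))) = cw (fst (snd a) @ concat (map (fst \<circ> snd) w))" .
    have "concat (map (fst \<circ> snd) (a # w)) = fst (snd a) @ concat (map (fst \<circ> snd) w)" by simp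
    then show ?case by (rule ssubst) (rule eq)
  qed simp
qed

lemma cw_concat: "w \<in> lists (Arr A) \<Longrightarrow> cw (concat (map (\<lambda>a. cw [a]) w)) = cw w"
proof (induction w)
  case (Cons a w)
  then have a: "[a] \<in> lists (Arr A)" and w: "w \<in> lists (Arr A)" by auto
  have "concat (map (\<lambda>a. cw [a]) w) \<in> lists (Arr A)"
    using w by (induction w) (use cw_closed[of "[_]"] in auto)
  then have "cw (cw [a] @ concat (map (\<lambda>a. cw [a]) w)) = cw ([a] @ cw (concat (map (\<lambda>a. cw [a]) w)))"
    using cw_left[OF a] cw_right[OF a] by simp
  also have "\<dots> = cw (a # w)" using Cons.IH[OF w] cw_right[OF a w] by simp
  finally show ?case by simp
qed simp

text \<open>The upper bound for the kernel: the class of a word is recovered from its reduced image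
  by concatenating middle components.\<close>

lemma join_kernel:
  assumes u: "u \<in> lists (Arr A)" and v: "v \<in> lists (Arr A)"
    and eq: "red D (map \<pi> u) = red D (map \<pi> v)"
  shows "cw u = cw v"
proof -
  have *: "cw (concat (map (fst \<circ> snd) (red D (map \<pi> w)))) = cw w" if "w \<in> lists (Arr A)" for w
  proof -
    have "map \<pi> w \<in> lists (Arr D)" using that sfunD(2)[OF join_sfun] by auto
    moreover have "(fst \<circ> snd) \<circ> \<pi> = (\<lambda>a. cw [a])" by (auto simp: join_arr_def)
    ultimately show ?thesis using cw_red[of "map \<pi> w"] cw_concat[OF that] by (simp add: comp_def join_arr_def)
  qed
  show ?thesis using *[OF u] *[OF v] eq by simp
qed

text \<open>The lower bound: the map into \<open>joincat\<close> factors, by \<open>\<phi>h\<close>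
  and \<open>\<psi>h\<close>, through the image of any semifunctor whose identifications are
  contained in those of \<open>co\<close> and \<open>cw\<close>. Functoriality of reduction then
  transfers equalities of words.\<close>

lemma join_kernel_ge:
  assumes B: "semicategory B" and f: "sfun A B \<phi> \<psi>"
    and obj: "\<And>x y. x \<in> Obj A \<Longrightarrow> y \<in> Obj A \<Longrightarrow> \<phi> x = \<phi> y \<Longrightarrow> co x = co y"
    and word: "\<And>u v. u \<in> lists (Arr A) \<Longrightarrow> v \<in> lists (Arr A) \<Longrightarrow>
      red B (map \<psi> u) = red B (map \<psi> v) \<Longrightarrow> cw u = cw v"
    and u: "u \<in> lists (Arr A)" and v: "v \<in> lists (Arr A)" and eq: "red B (map \<psi> u) = red B (map \<psi> v)"
  shows "red D (map \<pi> u) = red D (map \<pi> v)"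
proof -
  let ?I = "imcat A B \<phi> \<psi>"
  note imcat = imcat[OF semicategory_axioms B f]
  interpret I: semicategory ?I by (rule imcat(1))
  have red_I: "red ?I (map \<psi> w) = red B (map \<psi> w)" if "w \<in> lists (Arr A)" for w
  proof -
    have "map \<psi> w \<in> lists (Arr ?I)" using that sfunD(2)[OF imcat(2)] by auto
    from red_map_inj[OF imcat(1) imcat(4) _ this] show ?thesis by (simp add: inj_on_def)
  qed
  define \<phi>h where "\<phi>h y = co (SOME x. x \<in> Obj A \<and> \<phi> x = y)" for y
  have \<phi>h: "\<phi>h (\<phi> x) = co x" if "x \<in> Obj A" for x
    unfolding \<phi>h_def by (rule someI2[of _ x]) (use that in simp, use that in \<open>blast intro: obj\<close>)
  \<comment> \<open>The factorization cannot be taken from \<open>generated_factor\<close>, whose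
    hypothesis on words is the present conclusion. The middle component at \<open>b\<close> is
    instead the class of a word representing \<open>b\<close>, which is well defined because
    \<open>word\<close> yields an equality of \<open>cw\<close>-values.\<close>
  define wd where "wd b = (SOME w. w \<in> lists (Arr A) \<and> red ?I (map \<psi> w) = [b])" for b
  have wd: "wd b \<in> lists (Arr A)" "red ?I (map \<psi> (wd b)) = [b]" if "b \<in> Arr ?I" for b
  proof -
    have "b \<in> generated ?I (\<psi> ` Arr A)" using that imcat(3) by (simp add: generating_def)
    from generated_word[OF imcat(1,2) this]
    have "\<exists>w. w \<in> lists (Arr A) \<and> red ?I (map \<psi> w) = [b]" by blast
    from someI_ex[OF this] show "wd b \<in> lists (Arr A)" "red ?I (map \<psi> (wd b)) = [b]"
      by (simp_all add: wd_def)
  qed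
  have cw_wd: "cw (wd b) = cw w" if "b \<in> Arr ?I" "w \<in> lists (Arr A)" "red ?I (map \<psi> w) = [b]" for b w
    using that wd[OF that(1)] red_I by (intro word) simp_all
  define \<psi>h where "\<psi>h b = (\<phi>h (Tgt ?I b), cw (wd b), \<phi>h (Src ?I b))" for b
  have \<psi>h: "\<psi>h (\<psi> a) = \<pi> a" if "a \<in> Arr A" for a
    using that cw_wd[of "\<psi> a" "[a]"] sfunD[OF imcat(2)] \<phi>h Src_closed Tgt_closed
    by (simp add: \<psi>h_def join_arr_def rcons_simps)
  have obj_I: "\<phi>h y \<in> co ` Obj A" if "y \<in> Obj ?I" for y
  proof -
    have "y \<in> \<phi> ` Obj A" using that by (simp add: imcat_def)
    then show ?thesis using \<phi>h by auto
  qed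
  have h: "sfun ?I D \<phi>h \<psi>h"
  proof (rule sfunI)
    fix b assume "b \<in> Arr ?I"
    then show "\<psi>h b \<in> Arr D" "Src D (\<psi>h b) = \<phi>h (Src ?I b)" "Tgt D (\<psi>h b) = \<phi>h (Tgt ?I b)"
      using wd(1)[of b] obj_I I.Src_closed I.Tgt_closed by (simp_all add: joincat_def \<psi>h_def)
  next
    fix b c assume bc: "b \<in> Arr ?I" "c \<in> Arr ?I" "Src ?I c = Tgt ?I b"
    have wdbc: "wd c @ wd b \<in> lists (Arr A)" using wd(1) bc by (simp del: in_lists_conv_set)
    have lists: "map \<psi> (wd b) \<in> lists (Arr ?I)" "map \<psi> (wd c) \<in> lists (Arr ?I)"
      using wd(1)[OF bc(1)] wd(1)[OF bc(2)] sfunD(2)[OF imcat(2)] by auto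
    have "red ?I (map \<psi> (wd c @ wd b)) = [Cmp ?I c b]"
      using wd(2)[OF bc(1)] wd(2)[OF bc(2)] bc(3) I.red_append[OF lists(2,1)] by (simp add: rcons_simps)
    then have "cw (wd (Cmp ?I c b)) = cw (wd c @ wd b)"
      using bc by (intro cw_wd wdbc) (simp_all add: I.Cmp_Arr)
    also have "\<dots> = cw (cw (wd c) @ cw (wd b))" using wd(1) bc by (intro cw_cw[symmetric])
    finally show "\<psi>h (Cmp ?I c b) = Cmp D (\<psi>h c) (\<psi>h b)"
      using bc by (simp add: \<psi>h_def joincat_def I.Cmp_Arr)
  qed (simp add: joincat_def obj_I)
  have "red D (map \<pi> w) = red D (map \<psi>h (red ?I (map \<psi> w)))" if "w \<in> lists (Arr A)" for w
  proof -
    have "map \<psi> w \<in> lists (Arr ?I)" using that sfunD(2)[OF imcat(2)] by auto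
    from I.red_map_red[OF join_semicategory h this]
    have "red D (map \<psi>h (red ?I (map \<psi> w))) = red D (map (\<psi>h \<circ> \<psi>) w)" by simp
    also have "map (\<psi>h \<circ> \<psi>) w = map \<pi> w" using that \<psi>h by auto
    finally show ?thesis by simp
  qed
  then show ?thesis using u v eq red_I by simp
qed

end

section \<open>The representation by objects and reduced words\<close>

text \<open>The disjoint sum separates the identifications of objects from those of words. Words
  occur in normal form, not as classes, and the empty word is among them.\<close>

definition points :: "('o, 'a) semicat \<Rightarrow> ('o + 'a list) set" where
  "points A = Inl ` Obj A \<union> Inr ` {w \<in> lists (Arr A). red A w = w}"

text \<open>Words are reduced again in the codomain, since letters can become composable
  there.\<close>

definition pmap :: "'u semimap \<Rightarrow> 'u + 'u list \<Rightarrow> 'u + 'u list" where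
  "pmap F = case_sum (\<lambda>x. Inl (OMap F x)) (\<lambda>w. Inr (red (Cod F) (map (AMap F) w)))"

definition mk_map :: "('u, 'u) semicat \<Rightarrow> ('u, 'u) semicat \<Rightarrow> ('u \<Rightarrow> 'u) \<Rightarrow> ('u \<Rightarrow> 'u) \<Rightarrow> 'u semimap" where
  "mk_map A B \<phi> \<psi> = \<lparr>Dom = A, Cod = B, OMap = restrict \<phi> (Obj A), AMap = restrict \<psi> (Arr A)\<rparr>"

lemma mk_map_simps [simp]:
  "Dom (mk_map A B \<phi> \<psi>) = A" "Cod (mk_map A B \<phi> \<psi>) = B"
  "x \<in> Obj A \<Longrightarrow> OMap (mk_map A B \<phi> \<psi>) x = \<phi> x" "f \<in> Arr A \<Longrightarrow> AMap (mk_map A B \<phi> \<psi>) f = \<psi> f"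
  by (simp_all add: mk_map_def)

lemma pmap_simps [simp]:
  "pmap F (Inl x) = Inl (OMap F x)" "pmap F (Inr w) = Inr (red (Cod F) (map (AMap F) w))"
  by (simp_all add: pmap_def)

lemma unital_compose:
  "unital A B \<phi> \<psi> \<Longrightarrow> unital B D \<phi>' \<psi>' \<Longrightarrow> sfun A B \<phi> \<psi> \<Longrightarrow> unital A D (\<phi>' \<circ> \<phi>) (\<psi>' \<circ> \<psi>)"
  using sfunD(1)[of A B \<phi> \<psi>] by (simp add: unital_def)

lemma points_InlI: "x \<in> Obj A \<Longrightarrow> Inl x \<in> points A"
  by (simp add: points_def)

lemma points_Inl_iff: "Inl x \<in> points A \<longleftrightarrow> x \<in> Obj A"
  by (auto simp: points_def)

lemma points_Inr_iff: "Inr w \<in> points A \<longleftrightarrow> w \<in> lists (Arr A) \<and> red A w = w"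
  by (auto simp: points_def)

lemma points_cases:
  assumes "p \<in> points A"
  obtains (Obj) x where "p = Inl x" "x \<in> Obj A" | (Word) w where "p = Inr w" "w \<in> lists (Arr A)" "red A w = w"
  using assms by (auto simp: points_def)

text \<open>Functors enter as semifunctors that are \<open>unital\<close> when \<open>u\<close>
  holds, so that one locale describes the three categories.\<close>

locale kind_category =
  fixes u g :: bool and C :: "(('u, 'u) semicat, 'u semimap) semicat"
  assumes univ: "universe TYPE('u)" and gu: "g \<longrightarrow> u"
    and C_eq: "C = category_of (\<lambda>A. small_semicategory A \<and> kind u g A)
      (\<lambda>F. semifunctor F \<and> (u \<longrightarrow> unital (Dom F) (Cod F) (OMap F) (AMap F)))"
begin

lemma Obj_C: "A \<in> Obj C \<longleftrightarrow> small_semicategory A \<and> kind u g A"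
  by (simp add: C_eq category_of_def)

lemma ObjD:
  assumes "A \<in> Obj C"
  shows "small_semicategory A" "kind u g A" "semicategory A" "u \<Longrightarrow> category A"
    "small TYPE('u) (Obj A)" "small TYPE('u) (Arr A)"
  using assms by (simp_all add: Obj_C kind_def small_semicategory_def)

lemma Hom_C: "F \<in> Hom C A B \<longleftrightarrow> A \<in> Obj C \<and> B \<in> Obj C \<and> Dom F = A \<and> Cod F = B \<and>
    OMap F \<in> extensional (Obj A) \<and> AMap F \<in> extensional (Arr A) \<and>
    sfun A B (OMap F) (AMap F) \<and> (u \<longrightarrow> unital A B (OMap F) (AMap F))"
  by (auto simp: C_eq category_of_def Hom_def semifunctor_def sfun_def PiE_iff)

lemma HomE:
  assumes "F \<in> Hom C A B"
  shows "A \<in> Obj C" "B \<in> Obj C" "Dom F = A" "Cod F = B" "sfun A B (OMap F) (AMap F)"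
    "u \<Longrightarrow> unital A B (OMap F) (AMap F)"
  using assms by (simp_all add: Hom_C)

lemma hom_eqI:
  assumes "F \<in> Hom C A B" "G \<in> Hom C A B"
    and "\<And>x. x \<in> Obj A \<Longrightarrow> OMap F x = OMap G x" "\<And>f. f \<in> Arr A \<Longrightarrow> AMap F f = AMap G f"
  shows "F = G"
proof -
  have "OMap F = OMap G" "AMap F = AMap G"
    using assms unfolding Hom_C by (blast intro: extensionalityI)+
  then show ?thesis using HomE[OF assms(1)] HomE[OF assms(2)] by (intro semimap.equality) simp_all
qed

lemma mk_map_Hom:
  assumes "A \<in> Obj C" "B \<in> Obj C" "sfun A B \<phi> \<psi>" "u \<Longrightarrow> unital A B \<phi> \<psi>"
  shows "mk_map A B \<phi> \<psi> \<in> Hom C A B"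
proof -
  have "sfun A B (OMap (mk_map A B \<phi> \<psi>)) (AMap (mk_map A B \<phi> \<psi>))"
    by (rule sfun_cong[OF ObjD(3)[OF assms(1)] assms(3)]) simp_all
  moreover have "unital A B (OMap (mk_map A B \<phi> \<psi>)) (AMap (mk_map A B \<phi> \<psi>))" if u
    using assms(4)[OF that] HomD(1)[OF category.Ident_Hom[OF ObjD(4)[OF assms(1) that]]] by (simp add: unital_def)
  ultimately show ?thesis using assms by (simp add: Hom_C) (simp add: mk_map_def)
qed

lemma Cmp_C:
  assumes "F \<in> Hom C A B" "G \<in> Hom C B D"
  shows "Cmp C G F \<in> Hom C A D"
    and "x \<in> Obj A \<Longrightarrow> OMap (Cmp C G F) x = OMap G (OMap F x)"
    and "f \<in> Arr A \<Longrightarrow> AMap (Cmp C G F) f = AMap G (AMap F f)"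
proof -
  have eq: "Cmp C G F = mk_map A D (OMap G \<circ> OMap F) (AMap G \<circ> AMap F)"
    using HomE(3,4)[OF assms(1)] HomE(3,4)[OF assms(2)]
    by (simp add: C_eq category_of_def semimap_comp_def mk_map_def compose_def comp_def)
  show "Cmp C G F \<in> Hom C A D"
    unfolding eq using HomE[OF assms(1)] HomE[OF assms(2)] by (intro mk_map_Hom sfun_compose unital_compose)
  show "x \<in> Obj A \<Longrightarrow> OMap (Cmp C G F) x = OMap G (OMap F x)"
    "f \<in> Arr A \<Longrightarrow> AMap (Cmp C G F) f = AMap G (AMap F f)" by (simp_all add: eq)
qed

lemma sfun_id: "sfun A A (\<lambda>x. x) (\<lambda>f. f)"
  by (intro sfunI) simp_all

lemma semicategory_C: "semicategory C"
proof
  fix F G H X Y Z W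
  show "F \<in> Arr C \<Longrightarrow> Src C F \<in> Obj C" "F \<in> Arr C \<Longrightarrow> Tgt C F \<in> Obj C"
    by (simp_all add: C_eq category_of_def)
  assume F: "F \<in> Hom C X Y" and G: "G \<in> Hom C Y Z"
  show GF: "Cmp C G F \<in> Hom C X Z" by (rule Cmp_C(1)[OF F G])
  assume H: "H \<in> Hom C Z W"
  have HG: "Cmp C H G \<in> Hom C Y W" by (rule Cmp_C(1)[OF G H])
  show "Cmp C H (Cmp C G F) = Cmp C (Cmp C H G) F"
  proof (rule hom_eqI[OF Cmp_C(1)[OF GF H] Cmp_C(1)[OF F HG]])
    show "OMap (Cmp C H (Cmp C G F)) x = OMap (Cmp C (Cmp C H G) F) x" if "x \<in> Obj X" for x
      using that sfunD(1)[OF HomE(5)[OF F]]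
      by (simp add: Cmp_C(2)[OF GF H] Cmp_C(2)[OF F HG] Cmp_C(2)[OF F G] Cmp_C(2)[OF G H])
    show "AMap (Cmp C H (Cmp C G F)) x = AMap (Cmp C (Cmp C H G) F) x" if "x \<in> Arr X" for x
      using that sfunD(2)[OF HomE(5)[OF F]]
      by (simp add: Cmp_C(3)[OF GF H] Cmp_C(3)[OF F HG] Cmp_C(3)[OF F G] Cmp_C(3)[OF G H])
  qed
qed

lemma ident_C:
  assumes "A \<in> Obj C"
  shows "is_ident C A (mk_map A A (\<lambda>x. x) (\<lambda>f. f))"
proof -
  let ?i = "mk_map A A (\<lambda>x. x) (\<lambda>f. f)"
  have i: "?i \<in> Hom C A A" using assms by (intro mk_map_Hom sfun_id) (simp_all add: unital_def)
  have 1: "Cmp C F ?i = F" if "F \<in> Hom C A B" for F B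
    by (rule hom_eqI[OF Cmp_C(1)[OF i that] that]) (simp_all add: Cmp_C(2,3)[OF i that])
  have 2: "Cmp C ?i F = F" if F: "F \<in> Hom C B A" for F B
    by (rule hom_eqI[OF Cmp_C(1)[OF F i] F])
      (simp_all add: Cmp_C(2,3)[OF F i] sfunD(1,2)[OF HomE(5)[OF F]])
  show ?thesis
    unfolding is_ident_def
  proof (intro conjI ballI impI i)
    fix F assume "F \<in> Arr C"
    then have F: "F \<in> Hom C (Src C F) (Tgt C F)" by (rule HomI)
    show "Src C F = A \<Longrightarrow> Cmp C F ?i = F" "Tgt C F = A \<Longrightarrow> Cmp C ?i F = F"
      using F 1 2 by simp_all
  qed
qed

lemma category_C: "category C"
  using semicategory_C ident_C by (intro category.intro category_axioms.intro) blast+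

sublocale category C by (rule category_C)

lemma Ident_C: "A \<in> Obj C \<Longrightarrow> Ident C A = mk_map A A (\<lambda>x. x) (\<lambda>f. f)"
  by (rule Ident_eqI[OF ident_C])

section \<open>Functoriality and smallness of the points\<close>

lemma map_closed: "F \<in> Hom C A B \<Longrightarrow> w \<in> lists (Arr A) \<Longrightarrow> map (AMap F) w \<in> lists (Arr B)"
  using sfunD(2)[OF HomE(5)] by auto

lemma pmap_closed:
  assumes F: "F \<in> Hom C A B" and p: "p \<in> points A"
  shows "pmap F p \<in> points B"
proof -
  interpret B: semicategory B using ObjD(3)[OF HomE(2)[OF F]] .
  show ?thesis
    using p
  proof (cases rule: points_cases)
    case (Obj x)
    then show ?thesis using sfunD(1)[OF HomE(5)[OF F]] by (simp add: points_Inl_iff)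
  next
    case (Word w)
    then show ?thesis using HomE(4)[OF F] B.red_closed[OF map_closed[OF F]] B.red_red[OF map_closed[OF F]]
      by (simp add: points_Inr_iff del: in_lists_conv_set)
  qed
qed

lemma red_map:
  assumes F: "F \<in> Hom C A B" and w: "w \<in> lists (Arr A)"
  shows "red B (map (AMap F) (red A w)) = red B (map (AMap F) w)"
  by (rule semicategory.red_map_red[OF ObjD(3)[OF HomE(1)[OF F]] ObjD(3)[OF HomE(2)[OF F]] HomE(5)[OF F] w])

lemma red_point: "A \<in> Obj C \<Longrightarrow> w \<in> lists (Arr A) \<Longrightarrow> Inr (red A w) \<in> points A"
  using semicategory.red_closed[OF ObjD(3)] semicategory.red_red[OF ObjD(3)]
  by (simp add: points_Inr_iff del: in_lists_conv_set)

lemma pmap_red: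
  assumes F: "F \<in> Hom C A B" and w: "w \<in> lists (Arr A)"
  shows "pmap F (Inr (red A w)) = Inr (red B (map (AMap F) w))"
  using red_map[OF assms] HomE(4)[OF F] by simp

lemma pmap_Cmp:
  assumes F: "F \<in> Hom C A B" and G: "G \<in> Hom C B D" and p: "p \<in> points A"
  shows "pmap (Cmp C G F) p = pmap G (pmap F p)"
  using p
proof (cases rule: points_cases)
  case (Obj x)
  then show ?thesis by (simp add: Cmp_C(2)[OF F G])
next
  case (Word w)
  have "map (AMap (Cmp C G F)) w = map (AMap G) (map (AMap F) w)"
    using Word Cmp_C(3)[OF F G] by auto
  then show ?thesis
    using red_map[OF G map_closed[OF F Word(2)]] HomE(4)[OF F] HomE(4)[OF G] HomE(4)[OF Cmp_C(1)[OF F G]] Word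
    by (simp del: map_eq_conv map_map)
qed

lemma pmap_Ident:
  assumes A: "A \<in> Obj C" and p: "p \<in> points A"
  shows "pmap (Ident C A) p = p"
  using p
proof (cases rule: points_cases)
  case (Word w)
  then have "map (AMap (mk_map A A (\<lambda>x. x) (\<lambda>f. f))) w = w" by (intro map_idI) auto
  then show ?thesis using Word by (simp add: Ident_C[OF A])
qed (simp add: Ident_C[OF A])

lemma small_points: "A \<in> Obj C \<Longrightarrow> small TYPE('u) (points A)"
proof -
  assume A: "A \<in> Obj C"
  have "points A \<subseteq> Obj A <+> lists (Arr A)" by (auto simp: points_def)
  then show ?thesis
    by (rule small_subset) (intro small_Plus small_lists univ ObjD[OF A])
qed

lemma small_point_subgroups:
  assumes "A \<in> Obj C"
  shows "small TYPE('u) (subgroups_of (free_on (points A)))"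
proof (rule small_subset)
  show "subgroups_of (free_on (points A)) \<subseteq> Pow (free_on (points A))"
    by (auto simp: subgroups_of_def)
  show "small TYPE('u) (Pow (free_on (points A)))"
    unfolding free_on_def by (intro small_Pow small_frag small_points univ assms)
qed

definition point_encoding :: "('u, 'u) semicat \<Rightarrow> ('u + 'u list \<Rightarrow>\<^sub>0 int) set \<Rightarrow> 'u" where
  "point_encoding A = (SOME e. inj_on e (subgroups_of (free_on (points A))))"

lemma point_encoding_inj:
  assumes "A \<in> Obj C"
  shows "inj_on (point_encoding A) (subgroups_of (free_on (points A)))"
proof -
  obtain e :: "('u + 'u list \<Rightarrow>\<^sub>0 int) set \<Rightarrow> 'u" where "inj_on e (subgroups_of (free_on (points A)))"
    by (rule small_obtain_inj[OF small_point_subgroups[OF assms]])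
  then show ?thesis unfolding point_encoding_def by (rule someI[where P = "\<lambda>e. inj_on e (subgroups_of (free_on (points A)))"])
qed

lemma small_Hom_C:
  assumes A: "A \<in> Obj C" and B: "B \<in> Obj C"
  shows "small TYPE('u) (Hom C A B)"
proof (rule small_inj)
  let ?f = "\<lambda>F. ((\<lambda>x. (x, OMap F x)) ` Obj A, (\<lambda>x. (x, AMap F x)) ` Arr A)"
  show "inj_on ?f (Hom C A B)"
  proof (rule inj_onI)
    fix F G assume FG: "F \<in> Hom C A B" "G \<in> Hom C A B" and eq: "?f F = ?f G"
    show "F = G"
    proof (rule hom_eqI[OF FG])
      fix x assume "x \<in> Obj A"
      then have "(x, OMap F x) \<in> fst (?f F)" by simp
      then have "(x, OMap F x) \<in> fst (?f G)" by (simp only: eq)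
      then show "OMap F x = OMap G x" by auto
    next
      fix x assume "x \<in> Arr A"
      then have "(x, AMap F x) \<in> snd (?f F)" by simp
      then have "(x, AMap F x) \<in> snd (?f G)" by (simp only: eq)
      then show "AMap F x = AMap G x" by auto
    qed
  qed
  show "?f ` Hom C A B \<subseteq> Pow (Obj A \<times> Obj B) \<times> Pow (Arr A \<times> Arr B)"
    using sfunD(1,2)[OF HomE(5)] by auto
  show "small TYPE('u) (Pow (Obj A \<times> Obj B) \<times> Pow (Arr A \<times> Arr B))"
    by (intro small_Times small_Pow univ ObjD[OF A] ObjD[OF B])
qed

lemma subcat_small:
  assumes "small_semicategory B" "S \<subseteq> Obj B" "R \<subseteq> Arr B" "semicategory (subcat B S R)"
  shows "small_semicategory (subcat B S R)"
  using assms small_subset[of S "Obj B"] small_subset[of R "Arr B"]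
  unfolding small_semicategory_def by (auto simp: subcat_def)

text \<open>The factorization through the generated image. A functor \<open>F\<close> sends the
  identities of identified objects to the same identity of \<open>B\<close>, so the image is again
  of the required kind, with the identities of \<open>B\<close>.\<close>

lemma imcat_C:
  assumes F: "F \<in> Hom C A B"
  defines "I \<equiv> imcat A B (OMap F) (AMap F)"
  shows "I \<in> Obj C" and "mk_map A I (OMap F) (AMap F) \<in> Hom C A I" and "mk_map I B (\<lambda>x. x) (\<lambda>f. f) \<in> Hom C I B"
    and "F = Cmp C (mk_map I B (\<lambda>x. x) (\<lambda>f. f)) (mk_map A I (OMap F) (AMap F))"
    and "u \<Longrightarrow> x \<in> Obj I \<Longrightarrow> Ident I x = Ident B x"
proof -
  note HF = HomE[OF F]
  note imcat = imcat[OF ObjD(3)[OF HF(1)] ObjD(3)[OF HF(2)] HF(5), folded I_def]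
  have id: "AMap F (Ident A x) = AMap F (Ident A x')"
    if u "x \<in> Obj A" "x' \<in> Obj A" "OMap F x = OMap F x'" for x x'
    using HF(6)[OF that(1)] that by (simp add: unital_def)
  have kind: "kind u g I" and un: "u \<Longrightarrow> unital A I (OMap F) (AMap F)"
    using generating_kind[OF ObjD(2)[OF HF(1)] gu imcat(1-3)] id by blast+
  have "small_semicategory I"
    using imcat ObjD(1)[OF HF(2)] unfolding I_def imcat_def by (intro subcat_small) simp_all
  then show I: "I \<in> Obj C" using kind by (simp add: Obj_C)
  show Ident: "Ident I x = Ident B x" if uu: u and x: "x \<in> Obj I" for x
  proof -
    obtain y where "y \<in> Obj A" "x = OMap F y" using x by (auto simp: I_def imcat_def)
    then show ?thesis using un[OF uu] HF(6)[OF uu] by (simp add: unital_def)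
  qed
  show e: "mk_map A I (OMap F) (AMap F) \<in> Hom C A I" by (intro mk_map_Hom HF I imcat un)
  show m: "mk_map I B (\<lambda>x. x) (\<lambda>f. f) \<in> Hom C I B"
    by (intro mk_map_Hom HF I imcat) (simp_all add: unital_def Ident)
  show "F = Cmp C (mk_map I B (\<lambda>x. x) (\<lambda>f. f)) (mk_map A I (OMap F) (AMap F))"
    by (rule hom_eqI[OF F Cmp_C(1)[OF e m]]) (simp_all add: Cmp_C(2,3)[OF e m] sfunD(1,2)[OF imcat(2)])
qed

text \<open>Surjectivity on words: each letter over \<open>I\<close> is replaced by a word over
  \<open>A\<close> representing it, and reduction is compatible with this substitution.\<close>

lemma generated_words:
  assumes I: "semicategory I" and e: "sfun A I \<phi> \<psi>" "generating A I \<phi> \<psi>" and w: "w \<in> lists (Arr I)"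
  shows "\<exists>v\<in>lists (Arr A). red I (map \<psi> v) = red I w"
  using w
proof (induction w)
  case Nil
  show ?case by (intro bexI[of _ "[]"]) simp_all
next
  interpret semicategory I by fact
  case (Cons b w)
  obtain v where v: "v \<in> lists (Arr A)" "red I (map \<psi> v) = red I w" using Cons.IH by blast
  have "b \<in> generated I (\<psi> ` Arr A)" using e(2) Cons.hyps by (simp add: generating_def)
  then obtain u where u: "u \<in> lists (Arr A)" "red I (map \<psi> u) = [b]" by (rule generated_word[OF I e(1)])
  have "map \<psi> u \<in> lists (Arr I)" "map \<psi> v \<in> lists (Arr I)" using u v sfunD(2)[OF e(1)] by auto
  then have "red I (map \<psi> (u @ v)) = red I ([b] @ red I w)"
    using red_append[of "map \<psi> u" "map \<psi> v"] u v by simp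
  also have "\<dots> = red I (b # w)" using red_append_red[of w "[b]"] Cons.hyps by simp
  finally show ?case using u v by (intro bexI[of _ "u @ v"]) auto
qed

lemma points_subset:
  assumes I: "I \<in> Obj C" and m: "sfun I B (\<lambda>x. x) (\<lambda>f. f)"
  shows "w \<in> lists (Arr I) \<Longrightarrow> red B w = red I w"
  using red_map_inj[OF ObjD(3)[OF I] m, of w] by (simp add: inj_on_def)

text \<open>The inclusion of the image fixes points because it creates no new composable pairs. The
  last equation describes the image inside the points of \<open>B\<close> by objects and arrows
  alone, the form in which meets are computed.\<close>

lemma image_points:
  assumes F: "F \<in> Hom C A B"
  defines "I \<equiv> imcat A B (OMap F) (AMap F)"
  shows "pmap (mk_map A I (OMap F) (AMap F)) ` points A = points I"
    and "p \<in> points I \<Longrightarrow> pmap (mk_map I B (\<lambda>x. x) (\<lambda>f. f)) p = p"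
    and "pmap F ` points A = points I"
    and "points I = Inl ` OMap F ` Obj A \<union> Inr ` {w \<in> lists (generated B (AMap F ` Arr A)). red B w = w}"
proof -
  note HF = HomE[OF F]
  note imcat = imcat[OF ObjD(3)[OF HF(1)] ObjD(3)[OF HF(2)] HF(5), folded I_def]
  note imC = imcat_C[OF F, folded I_def]
  let ?e = "mk_map A I (OMap F) (AMap F)" and ?m = "mk_map I B (\<lambda>x. x) (\<lambda>f. f)"
  have red_I: "red B w = red I w" if "w \<in> lists (Arr I)" for w
    by (rule points_subset[OF imC(1) imcat(4) that])
  show e: "pmap ?e ` points A = points I"
  proof
    show "pmap ?e ` points A \<subseteq> points I" using pmap_closed[OF imC(2)] by blast
    show "points I \<subseteq> pmap ?e ` points A"
    proof
      fix p assume "p \<in> points I"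
      then show "p \<in> pmap ?e ` points A"
      proof (cases rule: points_cases)
        case (Obj x)
        then obtain y where "y \<in> Obj A" "x = OMap F y" by (auto simp: I_def imcat_def)
        then show ?thesis using Obj by (intro image_eqI[of _ _ "Inl y"]) (simp_all add: points_Inl_iff)
      next
        case (Word w)
        obtain v where v: "v \<in> lists (Arr A)" "red I (map (AMap F) v) = w"
          using generated_words[OF imcat(1-3) Word(2)] Word(3) by auto
        have "map (AMap ?e) v = map (AMap F) v" using v by auto
        then have "pmap ?e (Inr (red A v)) = p"
          using pmap_red[OF imC(2) v(1)] v Word by (simp del: map_eq_conv)
        then show ?thesis using red_point[OF HF(1) v(1)] by (intro image_eqI[of _ _ "Inr (red A v)"]) simp_all
      qed
    qed
  qed
  show m: "pmap ?m p = p" if "p \<in> points I" for p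
    using that
  proof (cases rule: points_cases)
    case (Word w)
    have "map (AMap ?m) w = w" using Word by (intro map_idI) auto
    then show ?thesis using Word red_I by simp
  qed simp
  have "pmap F p = pmap ?e p" if "p \<in> points A" for p
    using pmap_Cmp[OF imC(2,3) that] imC(4) m pmap_closed[OF imC(2) that] by simp
  then show "pmap F ` points A = points I" using e by auto
  have "{w \<in> lists (Arr I). red I w = w} = {w \<in> lists (Arr I). red B w = w}"
    by (intro Collect_cong conj_cong refl) (simp only: red_I)
  then show "points I = Inl ` OMap F ` Obj A \<union> Inr ` {w \<in> lists (generated B (AMap F ` Arr A)). red B w = w}"
    unfolding points_def by (simp add: I_def imcat_def)
qed

text \<open>The condition on points splits into one on objects and one on words, the hypotheses of
  \<open>generated_factor\<close>. Arbitrary words are covered by passing to their normal forms,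
  which are points.\<close>

lemma image_quotient:
  assumes F: "F \<in> Hom C A B"
  defines "I \<equiv> imcat A B (OMap F) (AMap F)"
  defines "e \<equiv> mk_map A I (OMap F) (AMap F)"
  assumes G: "G \<in> Hom C A D"
    and ker: "\<And>x y. x \<in> points A \<Longrightarrow> y \<in> points A \<Longrightarrow> pmap e x = pmap e y \<Longrightarrow> pmap G x = pmap G y"
  shows "\<exists>!h. h \<in> Hom C I D \<and> G = Cmp C h e"
proof -
  note HF = HomE[OF F]
  note HG = HomE[OF G]
  note imcat = imcat[OF ObjD(3)[OF HF(1)] ObjD(3)[OF HF(2)] HF(5), folded I_def]
  note imC = imcat_C[OF F, folded I_def, folded e_def]
  have e_simps: "\<And>x. x \<in> Obj A \<Longrightarrow> OMap e x = OMap F x" "\<And>f. f \<in> Arr A \<Longrightarrow> AMap e f = AMap F f"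
    by (simp_all add: e_def)
  have obj: "OMap G x = OMap G y" if "x \<in> Obj A" "y \<in> Obj A" "OMap F x = OMap F y" for x y
    using ker[of "Inl x" "Inl y"] that by (simp add: points_Inl_iff e_simps)
  have word: "red D (map (AMap G) v) = red D (map (AMap G) w)"
    if "v \<in> lists (Arr A)" "w \<in> lists (Arr A)" "red I (map (AMap F) v) = red I (map (AMap F) w)" for v w
  proof -
    have "map (AMap e) v = map (AMap F) v" "map (AMap e) w = map (AMap F) w" using that e_simps by auto
    then have "pmap e (Inr (red A v)) = pmap e (Inr (red A w))"
      using pmap_red[OF imC(2) that(1)] pmap_red[OF imC(2) that(2)] that(3) by (simp del: map_eq_conv)
    then have "pmap G (Inr (red A v)) = pmap G (Inr (red A w))"
      by (intro ker red_point[OF HF(1)] that(1,2))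
    then show ?thesis using pmap_red[OF G that(1)] pmap_red[OF G that(2)] by simp
  qed
  obtain \<phi>h \<psi>h where h: "sfun I D \<phi>h \<psi>h" "\<And>x. x \<in> Obj A \<Longrightarrow> \<phi>h (OMap F x) = OMap G x"
    "\<And>a. a \<in> Arr A \<Longrightarrow> \<psi>h (AMap F a) = AMap G a"
    by (rule generated_factor[OF imcat(1) ObjD(3)[OF HG(2)] imcat(2,3) HG(5) _ _ ObjD(3)[OF HF(1)]])
      ((rule obj; assumption) | (rule word; assumption) | (rule that, assumption, simp, simp))+
  have un: "unital I D \<phi>h \<psi>h" if u
    unfolding unital_def
  proof
    fix y assume y: "y \<in> Obj I"
    obtain x where x: "x \<in> Obj A" "y = OMap F x" using y by (auto simp: I_def imcat_def)
    have "Ident I y = AMap F (Ident A x)"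
      using HF(6)[OF that] imC(5)[OF that y] x by (simp add: unital_def)
    moreover have "Ident A x \<in> Arr A"
      using HomD(1)[OF category.Ident_Hom[OF ObjD(4)[OF HF(1) that] x(1)]] .
    ultimately show "\<psi>h (Ident I y) = Ident D (\<phi>h y)"
      using h x HG(6)[OF that] by (simp add: unital_def)
  qed
  have hh: "mk_map I D \<phi>h \<psi>h \<in> Hom C I D" by (intro mk_map_Hom imC HG h un)
  have F_I: "\<And>x. x \<in> Obj A \<Longrightarrow> OMap F x \<in> Obj I" "\<And>f. f \<in> Arr A \<Longrightarrow> AMap F f \<in> Arr I"
    using sfunD(1,2)[OF imcat(2)] by simp_all
  show ?thesis
  proof (rule ex1I[of _ "mk_map I D \<phi>h \<psi>h"], intro conjI hh)
    show "G = Cmp C (mk_map I D \<phi>h \<psi>h) e"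
      by (rule hom_eqI[OF G Cmp_C(1)[OF imC(2) hh]]) (simp_all add: Cmp_C(2,3)[OF imC(2) hh] e_simps F_I h)
    fix k assume k: "k \<in> Hom C I D \<and> G = Cmp C k e"
    then have kH: "k \<in> Hom C I D" by simp
    have k_e: "OMap k (OMap F x) = OMap G x" if "x \<in> Obj A" for x
      using k Cmp_C(2)[OF imC(2) kH that] that by (simp add: e_simps)
    have k_a: "AMap k (AMap F f) = AMap G f" if "f \<in> Arr A" for f
      using k Cmp_C(3)[OF imC(2) kH that] that by (simp add: e_simps)
    show "k = mk_map I D \<phi>h \<psi>h"
    proof (rule hom_eqI[OF kH hh])
      fix y assume y: "y \<in> Obj I"
      then obtain x where "x \<in> Obj A" "y = OMap F x" by (auto simp: I_def imcat_def)
      then show "OMap k y = OMap (mk_map I D \<phi>h \<psi>h) y" using y k_e h by simp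
    next
      fix b assume "b \<in> Arr I"
      then show "AMap k b = AMap (mk_map I D \<phi>h \<psi>h) b"
        using generating_unique[OF imcat(2,3,1) HomE(5)[OF kH] HomE(5)[OF hh], of b] k_a h F_I by simp
    qed
  qed
qed

text \<open>The points \<open>Inl x\<close> and the one-letter words \<open>Inr [f]\<close> already
  show that \<open>G\<close> sends objects and arrows of \<open>W\<close> into the image.\<close>

lemma image_embedding:
  assumes F: "F \<in> Hom C A B"
  defines "I \<equiv> imcat A B (OMap F) (AMap F)"
  defines "m \<equiv> mk_map I B (\<lambda>x. x) (\<lambda>f. f)"
  assumes G: "G \<in> Hom C W B" and im: "pmap G ` points W \<subseteq> pmap m ` points I"
  shows "\<exists>!h. h \<in> Hom C W I \<and> G = Cmp C m h"
proof -
  note HF = HomE[OF F]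
  note HG = HomE[OF G]
  note imcat = imcat[OF ObjD(3)[OF HF(1)] ObjD(3)[OF HF(2)] HF(5), folded I_def]
  note imC = imcat_C[OF F, folded I_def, folded m_def]
  have "pmap m ` points I = points I" using image_points(2)[OF F, folded I_def, folded m_def] by force
  then have im': "pmap G ` points W \<subseteq> points I" using im by simp
  have G_obj: "OMap G x \<in> Obj I" if "x \<in> Obj W" for x
  proof -
    have "pmap G (Inl x) \<in> points I" using im' points_InlI[OF that] by blast
    then show ?thesis by (simp add: points_Inl_iff)
  qed
  have G_arr: "AMap G f \<in> Arr I" if "f \<in> Arr W" for f
  proof -
    have "Inr [f] \<in> points W" using that by (simp add: points_Inr_iff rcons_simps)
    then have "pmap G (Inr [f]) \<in> points I" using im' by blast
    then show ?thesis using HG(4) by (simp add: points_Inr_iff rcons_simps)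
  qed
  have m_simps: "\<And>x. x \<in> Obj I \<Longrightarrow> OMap m x = x" "\<And>f. f \<in> Arr I \<Longrightarrow> AMap m f = f"
    by (simp_all add: m_def)
  have I_simps: "Src I f = Src B f" "Tgt I f = Tgt B f" if "f \<in> Arr I" for f
    using that by (simp_all add: I_def imcat_def)
  have I_Cmp: "Cmp I c b = Cmp B c b" if "b \<in> Arr I" "c \<in> Arr I" "Src B c = Tgt B b" for b c
    using that by (simp add: I_def imcat_def)
  have sf: "sfun W I (OMap G) (AMap G)"
    using sfunD[OF HG(5)] G_obj G_arr by (intro sfunI) (simp_all add: I_simps I_Cmp)
  have h: "mk_map W I (OMap G) (AMap G) \<in> Hom C W I" (is "?h \<in> _")
    using HG(6) G_obj imC(5) by (intro mk_map_Hom HG(1) imC(1) sf) (simp add: unital_def)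
  show ?thesis
  proof (rule ex1I[of _ ?h], intro conjI h)
    show "G = Cmp C m ?h"
      by (rule hom_eqI[OF G Cmp_C(1)[OF h imC(3)]]) (simp_all add: Cmp_C(2,3)[OF h imC(3)] m_simps G_obj G_arr)
    fix k assume k: "k \<in> Hom C W I \<and> G = Cmp C m k"
    then have kH: "k \<in> Hom C W I" by simp
    show "k = ?h"
    proof (rule hom_eqI[OF kH h])
      show "OMap k x = OMap ?h x" if "x \<in> Obj W" for x
        using k Cmp_C(2)[OF kH imC(3) that] that sfunD(1)[OF HomE(5)[OF kH]] by (simp add: m_simps)
      show "AMap k f = AMap ?h f" if "f \<in> Arr W" for f
        using k Cmp_C(3)[OF kH imC(3) that] that sfunD(2)[OF HomE(5)[OF kH]] by (simp add: m_simps)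
    qed
  qed
qed

section \<open>Pullbacks inside the category, monomorphisms and meets of images\<close>

lemma encode_C:
  assumes P: "kind u g P" and small: "small TYPE('u) (Obj P)" "small TYPE('u) (Arr P)"
    and \<alpha>: "inj_on \<alpha> (Obj P)" and \<beta>: "inj_on \<beta> (Arr P)"
  shows "encode \<alpha> \<beta> P \<in> Obj C" and "u \<Longrightarrow> unital P (encode \<alpha> \<beta> P) \<alpha> \<beta>"
    and "u \<Longrightarrow> unital (encode \<alpha> \<beta> P) P (inv_into (Obj P) \<alpha>) (inv_into (Arr P) \<beta>)"
proof -
  have semi: "semicategory P" using P by (simp add: kind_def)
  note encode = encode[OF semi \<alpha> \<beta>]
  have id: "\<beta> (Ident P x) = \<beta> (Ident P x')" if "x \<in> Obj P" "x' \<in> Obj P" "\<alpha> x = \<alpha> x'" for x x'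
    using that \<alpha> by (simp add: inj_on_eq_iff)
  have kind: "kind u g (encode \<alpha> \<beta> P)" and un: "u \<Longrightarrow> unital P (encode \<alpha> \<beta> P) \<alpha> \<beta>"
    using generating_kind[OF P gu encode(1-3)] id by blast+
  show "encode \<alpha> \<beta> P \<in> Obj C" using kind encode_small[OF semi \<alpha> \<beta> small] by (simp add: Obj_C)
  show "u \<Longrightarrow> unital P (encode \<alpha> \<beta> P) \<alpha> \<beta>" by (rule un)
  show "unital (encode \<alpha> \<beta> P) P (inv_into (Obj P) \<alpha>) (inv_into (Arr P) \<beta>)" if u
    unfolding unital_def
  proof
    fix y assume "y \<in> Obj (encode \<alpha> \<beta> P)"
    then obtain x where x: "x \<in> Obj P" "y = \<alpha> x" by (auto simp: encode_simps)
    have arr: "Ident P x \<in> Arr P"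
      using P that HomD(1)[OF category.Ident_Hom[OF _ x(1)]] by (simp add: kind_def)
    have "Ident (encode \<alpha> \<beta> P) y = \<beta> (Ident P x)" using un[OF that] x by (simp add: unital_def)
    then show "inv_into (Arr P) \<beta> (Ident (encode \<alpha> \<beta> P) y) = Ident P (inv_into (Obj P) \<alpha> y)"
      using arr x \<alpha> \<beta> by simp
  qed
qed

text \<open>The two projections together hit exactly the compatible pairs of objects and of arrows;
  monomorphisms and meets are treated by this description instead of the universal property.\<close>

lemma pullback_C:
  assumes F: "F \<in> Hom C A B" and G: "G \<in> Hom C A' B"
  obtains Q p q where "Q \<in> Obj C" "p \<in> Hom C Q A" "q \<in> Hom C Q A'"
    "Cmp C F p = Cmp C G q"
    "(\<lambda>x. (OMap p x, OMap q x)) ` Obj Q = {(x, y). x \<in> Obj A \<and> y \<in> Obj A' \<and> OMap F x = OMap G y}"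
    "(\<lambda>x. (AMap p x, AMap q x)) ` Arr Q = {(x, y). x \<in> Arr A \<and> y \<in> Arr A' \<and> AMap F x = AMap G y}"
proof -
  note HF = HomE[OF F]
  note HG = HomE[OF G]
  let ?P = "pullback A A' (OMap F) (AMap F) (OMap G) (AMap G)"
  note pb = pullback[OF ObjD(3)[OF HF(1)] ObjD(3)[OF HG(1)] HF(5) HG(5)]
  note pbk = pullback_kind[OF ObjD(2)[OF HF(1)] ObjD(2)[OF HG(1)] ObjD(2)[OF HF(2)] gu HF(5) HG(5) HF(6) HG(6)]
  have P_obj: "Obj ?P = {(x, y). x \<in> Obj A \<and> y \<in> Obj A' \<and> OMap F x = OMap G y}"
    and P_arr: "Arr ?P = {(x, y). x \<in> Arr A \<and> y \<in> Arr A' \<and> AMap F x = AMap G y}"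
    by (simp_all add: pullback_def)
  have "Obj ?P \<subseteq> Obj A \<times> Obj A'" "Arr ?P \<subseteq> Arr A \<times> Arr A'" by (auto simp: P_obj P_arr)
  then have small: "small TYPE('u) (Obj ?P)" "small TYPE('u) (Arr ?P)"
    using small_subset small_Times[OF univ] ObjD(5,6)[OF HF(1)] ObjD(5,6)[OF HG(1)] by blast+
  obtain \<alpha> :: "'u \<times> 'u \<Rightarrow> 'u" where \<alpha>: "inj_on \<alpha> (Obj ?P)" by (rule small_obtain_inj[OF small(1)])
  obtain \<beta> :: "'u \<times> 'u \<Rightarrow> 'u" where \<beta>: "inj_on \<beta> (Arr ?P)" by (rule small_obtain_inj[OF small(2)])
  let ?Q = "encode \<alpha> \<beta> ?P"
  let ?i = "inv_into (Obj ?P) \<alpha>" and ?j = "inv_into (Arr ?P) \<beta>"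
  note enc = encode[OF pb(1) \<alpha> \<beta>]
  note encC = encode_C[OF pbk(1) small \<alpha> \<beta>]
  let ?p = "mk_map ?Q A (fst \<circ> ?i) (fst \<circ> ?j)" and ?q = "mk_map ?Q A' (snd \<circ> ?i) (snd \<circ> ?j)"
  have p: "?p \<in> Hom C ?Q A"
    by (intro mk_map_Hom encC HF sfun_compose[OF enc(4) pb(2)] unital_compose[OF encC(3) pbk(2) enc(4)])
  have q: "?q \<in> Hom C ?Q A'"
    by (intro mk_map_Hom encC HG sfun_compose[OF enc(4) pb(3)] unital_compose[OF encC(3) pbk(3) enc(4)])
  have obj: "?i x \<in> Obj ?P" if "x \<in> Obj ?Q" for x by (rule sfunD(1)[OF enc(4) that])
  have arr: "?j x \<in> Arr ?P" if "x \<in> Arr ?Q" for x by (rule sfunD(2)[OF enc(4) that])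
  have "Cmp C F ?p = Cmp C G ?q"
  proof (rule hom_eqI[OF Cmp_C(1)[OF p F] Cmp_C(1)[OF q G]])
    show "OMap (Cmp C F ?p) x = OMap (Cmp C G ?q) x" if "x \<in> Obj ?Q" for x
    proof -
      obtain a b where ab: "?i x = (a, b)" by (cases "?i x")
      with obj[OF that] have "OMap F a = OMap G b" unfolding P_obj by simp
      then show ?thesis using that ab by (simp add: Cmp_C(2)[OF p F] Cmp_C(2)[OF q G])
    qed
    show "AMap (Cmp C F ?p) x = AMap (Cmp C G ?q) x" if "x \<in> Arr ?Q" for x
    proof -
      obtain a b where ab: "?j x = (a, b)" by (cases "?j x")
      with arr[OF that] have "AMap F a = AMap G b" unfolding P_arr by simp
      then show ?thesis using that ab by (simp add: Cmp_C(3)[OF p F] Cmp_C(3)[OF q G])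
    qed
  qed
  moreover have "(\<lambda>x. (OMap ?p x, OMap ?q x)) ` Obj ?Q = Obj ?P"
  proof -
    have "(\<lambda>x. (OMap ?p x, OMap ?q x)) ` Obj ?Q = ?i ` Obj ?Q" by (intro image_cong refl) simp
    also have "\<dots> = Obj ?P" using \<alpha> by (simp add: encode_simps image_image)
    finally show ?thesis .
  qed
  moreover have "(\<lambda>x. (AMap ?p x, AMap ?q x)) ` Arr ?Q = Arr ?P"
  proof -
    have "(\<lambda>x. (AMap ?p x, AMap ?q x)) ` Arr ?Q = ?j ` Arr ?Q" by (intro image_cong refl) simp
    also have "\<dots> = Arr ?P" using \<beta> by (simp add: encode_simps image_image)
    finally show ?thesis .
  qed
  ultimately show thesis using that[OF encC(1) p q] unfolding P_obj P_arr by blast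
qed

text \<open>The two projections from the kernel pair of a monomorphism are equal.\<close>

lemma monic_inj:
  assumes m: "m \<in> monics C"
  shows "inj_on (pmap m) (points (Src C m))"
proof -
  define A where "A = Src C m"
  have mH: "m \<in> Hom C A (Tgt C m)" using monicsD(1)[OF m] by (simp add: A_def HomI)
  note Hm = HomE[OF mH]
  obtain Q p q where Q: "Q \<in> Obj C" and p: "p \<in> Hom C Q A" and q: "q \<in> Hom C Q A"
    and eq: "Cmp C m p = Cmp C m q"
    and obj: "(\<lambda>x. (OMap p x, OMap q x)) ` Obj Q = {(x, y). x \<in> Obj A \<and> y \<in> Obj A \<and> OMap m x = OMap m y}"
    and arr: "(\<lambda>x. (AMap p x, AMap q x)) ` Arr Q = {(x, y). x \<in> Arr A \<and> y \<in> Arr A \<and> AMap m x = AMap m y}"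
    by (rule pullback_C[OF mH mH])
  have pq: "p = q" by (rule monicsD(2)[OF m mH p q eq])
  have inj_o: "inj_on (OMap m) (Obj A)"
  proof (rule inj_onI)
    fix x y assume "x \<in> Obj A" "y \<in> Obj A" "OMap m x = OMap m y"
    then have "(x, y) \<in> (\<lambda>x. (OMap p x, OMap q x)) ` Obj Q" unfolding obj by simp
    then show "x = y" unfolding pq by auto
  qed
  have inj_a: "inj_on (AMap m) (Arr A)"
  proof (rule inj_onI)
    fix x y assume "x \<in> Arr A" "y \<in> Arr A" "AMap m x = AMap m y"
    then have "(x, y) \<in> (\<lambda>x. (AMap p x, AMap q x)) ` Arr Q" unfolding arr by simp
    then show "x = y" unfolding pq by auto
  qed
  have word: "pmap m (Inr w) = Inr (map (AMap m) w)" if "w \<in> lists (Arr A)" "red A w = w" for w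
    using red_map_inj[OF ObjD(3)[OF Hm(1)] Hm(5) inj_o that(1)] that(2) Hm(4) by simp
  have "inj_on (pmap m) (points A)"
  proof (rule inj_onI)
    fix x y assume x: "x \<in> points A" and y: "y \<in> points A" and eq: "pmap m x = pmap m y"
    show "x = y"
    proof (rule points_cases[OF x])
      fix a assume a: "x = Inl a" "a \<in> Obj A"
      then obtain b where "y = Inl b" "b \<in> Obj A" using eq by (cases rule: points_cases[OF y]) auto
      then show ?thesis using a eq inj_o by (simp add: inj_on_eq_iff)
    next
      fix v assume v: "x = Inr v" "v \<in> lists (Arr A)" "red A v = v"
      then obtain w where w: "y = Inr w" "w \<in> lists (Arr A)" "red A w = w"
        using eq by (cases rule: points_cases[OF y]) auto
      then have "map (AMap m) v = map (AMap m) w" using v eq word by simp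
      moreover have "inj_on (AMap m) (set v \<union> set w)"
        using v w by (intro inj_on_subset[OF inj_a]) auto
      ultimately show ?thesis using v w by (simp add: inj_on_map_eq_map)
    qed
  qed
  then show ?thesis by (simp add: A_def)
qed

lemma generated_Int:
  "generated B (generated B S \<inter> generated B S') = generated B S \<inter> generated B S'"
proof (intro equalityI subsetI)
  fix b assume "b \<in> generated B (generated B S \<inter> generated B S')"
  then show "b \<in> generated B S \<inter> generated B S'"
    by induction (auto intro: generated.step)
qed (rule generated.base)

text \<open>The pullback is taken along the inclusions of the generated images, not along
  \<open>F\<close> and \<open>G\<close>: an arrow in both images may be a composite of values on
  each side without being a value of either. The common arrows are closed under composition, and
  words over them are the words over both sets.\<close>

lemma image_meet:
  assumes F: "F \<in> Hom C A X" and G: "G \<in> Hom C A' X"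
  shows "\<exists>W. \<exists>k\<in>Hom C W X. pmap k ` points W = pmap F ` points A \<inter> pmap G ` points A'"
proof -
  let ?I = "imcat A X (OMap F) (AMap F)" and ?J = "imcat A' X (OMap G) (AMap G)"
  let ?m = "mk_map ?I X (\<lambda>x. x) (\<lambda>f. f)" and ?n = "mk_map ?J X (\<lambda>x. x) (\<lambda>f. f)"
  note m = imcat_C(3)[OF F] and n = imcat_C(3)[OF G]
  obtain Q p q where Q: "Q \<in> Obj C" and p: "p \<in> Hom C Q ?I" and q: "q \<in> Hom C Q ?J"
    and eq: "Cmp C ?m p = Cmp C ?n q"
    and obj: "(\<lambda>x. (OMap p x, OMap q x)) ` Obj Q = {(x, y). x \<in> Obj ?I \<and> y \<in> Obj ?J \<and> OMap ?m x = OMap ?n y}"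
    and arr: "(\<lambda>x. (AMap p x, AMap q x)) ` Arr Q = {(x, y). x \<in> Arr ?I \<and> y \<in> Arr ?J \<and> AMap ?m x = AMap ?n y}"
    by (rule pullback_C[OF m n])
  let ?k = "Cmp C ?m p"
  have k: "?k \<in> Hom C Q X" by (rule Cmp_C(1)[OF p m])
  have "OMap ?k ` Obj Q = fst ` (\<lambda>x. (OMap p x, OMap q x)) ` Obj Q"
    unfolding image_image using sfunD(1)[OF HomE(5)[OF p]] by (intro image_cong refl) (simp add: Cmp_C(2)[OF p m])
  also have "\<dots> = Obj ?I \<inter> Obj ?J" unfolding obj by force
  finally have k_obj: "OMap ?k ` Obj Q = OMap F ` Obj A \<inter> OMap G ` Obj A'" by (simp add: imcat_def)
  have "AMap ?k ` Arr Q = fst ` (\<lambda>x. (AMap p x, AMap q x)) ` Arr Q"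
    unfolding image_image using sfunD(2)[OF HomE(5)[OF p]] by (intro image_cong refl) (simp add: Cmp_C(3)[OF p m])
  also have "\<dots> = Arr ?I \<inter> Arr ?J" unfolding arr by force
  finally have k_arr: "AMap ?k ` Arr Q = generated X (AMap F ` Arr A) \<inter> generated X (AMap G ` Arr A')"
    by (simp add: imcat_def)
  have "pmap ?k ` points Q = pmap F ` points A \<inter> pmap G ` points A'"
    unfolding image_points(3)[OF k] image_points(3)[OF F] image_points(3)[OF G]
      image_points(4)[OF k] image_points(4)[OF F] image_points(4)[OF G] k_obj k_arr generated_Int
    by (auto simp del: in_lists_conv_set simp: lists_Int_eq)
  then show ?thesis using k by blast
qed

end

text \<open>This congruence property carries an identification of subwords, made by \<open>F\<close>
  or \<open>G\<close>, to the words containing them.\<close>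

lemma (in semicategory) red_context:
  assumes "a \<in> lists (Arr C)" "b \<in> lists (Arr C)" "b' \<in> lists (Arr C)" "c \<in> lists (Arr C)" "red C b = red C b'"
  shows "red C (a @ b @ c) = red C (a @ b' @ c)"
proof -
  have "red C (b @ c) = red C (b' @ c)"
    using red_red_append[OF assms(2,4)] red_red_append[OF assms(3,4)] assms(5) by simp
  then show ?thesis
    using red_append_red[of "b @ c" a] red_append_red[of "b' @ c" a] assms by simp
qed

context kind_category
begin

section \<open>Joins of kernels\<close>

lemma pmap_eq_Inl: "pmap F p = pmap F (Inl x) \<Longrightarrow> \<exists>y. p = Inl y \<and> OMap F y = OMap F x"
  by (cases p) simp_all

lemma pmap_eq_Inr:
  "pmap F p = pmap F (Inr w) \<Longrightarrow> \<exists>v. p = Inr v \<and> red (Cod F) (map (AMap F) v) = red (Cod F) (map (AMap F) w)"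
  by (cases p) simp_all

text \<open>\<open>co\<close> and \<open>cw\<close> choose representatives for the join relation on
  objects and on words. The join is a congruence, so \<open>joincat\<close> applies, and the part
  generated by \<open>A\<close>, encoded on \<open>'u\<close>, receives the morphism sought. Its
  kernel contains \<open>R\<close> by \<open>join_kernel_ge\<close>, used for \<open>F\<close> and
  for \<open>G\<close>, and lies in the closure of \<open>R\<close> by
  \<open>join_kernel\<close>.\<close>

lemma image_join:
  assumes F: "F \<in> Hom C A B" and G: "G \<in> Hom C A B'"
  shows "\<exists>W. \<exists>k\<in>Hom C A W. \<forall>p\<in>points A. \<forall>q\<in>points A. pmap k p = pmap k q \<longleftrightarrow>
    (p, q) \<in> {(p, q). p \<in> points A \<and> q \<in> points A \<and> (pmap F p = pmap F q \<or> pmap G p = pmap G q)}\<^sup>*"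
proof -
  define R where "R = {(p, q). p \<in> points A \<and> q \<in> points A \<and> (pmap F p = pmap F q \<or> pmap G p = pmap G q)}"
  have R_iff: "(p, q) \<in> R \<longleftrightarrow> p \<in> points A \<and> q \<in> points A \<and> (pmap F p = pmap F q \<or> pmap G p = pmap G q)" for p q
    by (simp add: R_def)
  have A: "A \<in> Obj C" by (rule HomE(1)[OF F])
  interpret A: semicategory A by (rule ObjD(3)[OF A])
  have R_sym: "(q, p) \<in> R\<^sup>*" if "(p, q) \<in> R\<^sup>*" for p q
  proof -
    have "sym R" by (auto simp: sym_def R_iff)
    from symD[OF sym_rtrancl[OF this] that] show ?thesis .
  qed
  \<comment> \<open>Each step of \<open>R\<close> comes from \<open>F\<close> or from
    \<open>G\<close>; calling that morphism \<open>H\<close> lets one argument treat both.\<close>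
  have R_cases: "\<exists>H E. H \<in> Hom C A E \<and> pmap H p = pmap H q \<and>
      (\<forall>p\<in>points A. \<forall>q\<in>points A. pmap H p = pmap H q \<longrightarrow> (p, q) \<in> R)" if "(p, q) \<in> R" for p q
  proof (cases "pmap F p = pmap F q")
    case True
    then show ?thesis using F by (intro exI[of _ F] exI[of _ B]) (simp add: R_iff)
  next
    case False
    then show ?thesis using G that by (intro exI[of _ G] exI[of _ B']) (simp add: R_iff)
  qed
  define co where "co x = (SOME y. y \<in> Obj A \<and> (Inl x, Inl y) \<in> R\<^sup>*)" for x
  \<comment> \<open>Arbitrary words are compared through their normal forms, since these are the
    points.\<close>
  define cw where "cw w = (SOME v. v \<in> lists (Arr A) \<and> (Inr (red A w), Inr (red A v)) \<in> R\<^sup>*)" for w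
  have co: "co x \<in> Obj A" "(Inl x, Inl (co x)) \<in> R\<^sup>*" if "x \<in> Obj A" for x
    using someI[of "\<lambda>y. y \<in> Obj A \<and> (Inl x, Inl y) \<in> R\<^sup>*" x] that unfolding co_def by blast+
  have cw: "cw w \<in> lists (Arr A)" "(Inr (red A w), Inr (red A (cw w))) \<in> R\<^sup>*" if "w \<in> lists (Arr A)" for w
    using someI[of "\<lambda>v. v \<in> lists (Arr A) \<and> (Inr (red A w), Inr (red A v)) \<in> R\<^sup>*" w] that
    unfolding cw_def by blast+
  have co_eqI: "co x = co y" if "(Inl x, Inl y) \<in> R\<^sup>*" for x y
  proof -
    have "(Inl x, Inl z) \<in> R\<^sup>* \<longleftrightarrow> (Inl y, Inl z) \<in> R\<^sup>*" for z
      using that R_sym[OF that] by (auto intro: rtrancl_trans)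
    then show ?thesis by (simp only: co_def)
  qed
  have co_eqD: "(Inl x, Inl y) \<in> R\<^sup>*" if "x \<in> Obj A" "y \<in> Obj A" "co x = co y" for x y
    using co(2)[OF that(1)] R_sym[OF co(2)[OF that(2)]] that(3) by (auto intro: rtrancl_trans)
  have cw_eqI: "cw v = cw w" if "(Inr (red A v), Inr (red A w)) \<in> R\<^sup>*" for v w
  proof -
    have "(Inr (red A v), Inr z) \<in> R\<^sup>* \<longleftrightarrow> (Inr (red A w), Inr z) \<in> R\<^sup>*" for z
      using that R_sym[OF that] by (auto intro: rtrancl_trans)
    then show ?thesis by (simp only: cw_def)
  qed
  have cw_eqD: "(Inr (red A v), Inr (red A w)) \<in> R\<^sup>*"
    if "v \<in> lists (Arr A)" "w \<in> lists (Arr A)" "cw v = cw w" for v w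
    using cw(2)[OF that(1)] R_sym[OF cw(2)[OF that(2)]] that(3) by (auto intro: rtrancl_trans)
  \<comment> \<open>The closure of \<open>R\<close> is compatible with contexts: a chain starting at
    a word consists of words throughout, and each step, being an equality under some
    \<open>H\<close>, survives between \<open>s\<close> and \<open>t\<close>.\<close>
  have ctxt: "(Inr (red A (s @ v @ t)), Inr (red A (s @ w @ t))) \<in> R\<^sup>*"
    if st: "s \<in> lists (Arr A)" "t \<in> lists (Arr A)" and v: "v \<in> lists (Arr A)" "red A v = v"
      and vw: "(Inr v, Inr w) \<in> R\<^sup>*" for s t v w
  proof -
    have "\<exists>w. q = Inr w \<and> w \<in> lists (Arr A) \<and> (Inr (red A (s @ v @ t)), Inr (red A (s @ w @ t))) \<in> R\<^sup>*"
      if "(Inr v, q) \<in> R\<^sup>*" for q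
      using that
    proof induction
      case base
      show ?case using v(1) by (intro exI[of _ v]) simp
    next
      case (step q r)
      then obtain w where w: "q = Inr w" "w \<in> lists (Arr A)"
        "(Inr (red A (s @ v @ t)), Inr (red A (s @ w @ t))) \<in> R\<^sup>*" by blast
      obtain H E where H: "H \<in> Hom C A E" "pmap H q = pmap H r"
        "\<forall>p\<in>points A. \<forall>q\<in>points A. pmap H p = pmap H q \<longrightarrow> (p, q) \<in> R"
        using R_cases[OF step.hyps(2)] by blast
      obtain w' where w': "r = Inr w'" "red E (map (AMap H) w') = red E (map (AMap H) w)"
        using pmap_eq_Inr[of H r w] H(2) w(1) HomE(4)[OF H(1)] by auto
      have "r \<in> points A" using step.hyps(2) by (simp add: R_iff)
      then have w'_lists: "w' \<in> lists (Arr A)" using w' by (simp add: points_Inr_iff)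
      interpret E: semicategory E by (rule ObjD(3)[OF HomE(2)[OF H(1)]])
      have "red E (map (AMap H) (s @ w @ t)) = red E (map (AMap H) (s @ w' @ t))"
        using E.red_context[OF map_closed[OF H(1) st(1)] map_closed[OF H(1) w(2)] map_closed[OF H(1) w'_lists]
          map_closed[OF H(1) st(2)] w'(2)[symmetric]] by simp
      moreover have lists: "s @ w @ t \<in> lists (Arr A)" "s @ w' @ t \<in> lists (Arr A)"
        using st w(2) w'_lists by auto
      ultimately have "pmap H (Inr (red A (s @ w @ t))) = pmap H (Inr (red A (s @ w' @ t)))"
        using pmap_red[OF H(1)] by simp
      then have "(Inr (red A (s @ w @ t)), Inr (red A (s @ w' @ t))) \<in> R"
        using H(3) red_point[OF A lists(1)] red_point[OF A lists(2)] by blast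
      from rtrancl_into_rtrancl[OF w(3) this] show ?case
        using w' w'_lists by (intro exI[of _ w']) simp
    qed
    from this[OF vw] show ?thesis by blast
  qed
  interpret word_congruence A co cw
  proof
    fix v w assume v: "v \<in> lists (Arr A)" and w: "w \<in> lists (Arr A)"
    show "cw w \<in> lists (Arr A)" by (rule cw(1)[OF w])
    have "(Inr (red A ([] @ red A v @ w)), Inr (red A ([] @ red A (cw v) @ w))) \<in> R\<^sup>*"
      using w A.red_closed[OF v] A.red_red[OF v] cw(2)[OF v] by (intro ctxt) simp_all
    from R_sym[OF this] show "cw (cw v @ w) = cw (v @ w)"
      using A.red_red_append[OF v w] A.red_red_append[OF cw(1)[OF v] w] by (intro cw_eqI) simp
    have "(Inr (red A (v @ red A w @ [])), Inr (red A (v @ red A (cw w) @ []))) \<in> R\<^sup>*"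
      using v A.red_closed[OF w] A.red_red[OF w] cw(2)[OF w] by (intro ctxt) simp_all
    from R_sym[OF this] show "cw (v @ cw w) = cw (v @ w)"
      using A.red_append_red[OF w, of v] A.red_append_red[OF cw(1)[OF w], of v] by (intro cw_eqI) simp
  next
    fix f g assume "f \<in> Arr A" "g \<in> Arr A" "Src A g = Tgt A f"
    then show "cw [Cmp A g f] = cw [g, f]" by (intro cw_eqI) (simp add: rcons_simps)
  qed
  let ?D = "joincat A co cw" and ?\<pi> = "join_arr A co cw"
  \<comment> \<open>\<open>joincat\<close> itself will not do: its identities are the triples on the
    class of the empty word, and identity arrows of \<open>A\<close> are not sent there. The part
    generated by \<open>A\<close> inherits identities and inverses from \<open>A\<close>.\<close>
  let ?I = "imcat A ?D co ?\<pi>"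
  note imcat = imcat[OF A.semicategory_axioms join_semicategory join_sfun]
  \<comment> \<open>Along a chain of identified objects, each \<open>H\<close> sends the identities
    of consecutive objects to the same arrow, so a parallel chain joins the one-letter words of
    these identities.\<close>
  have ident: "?\<pi> (Ident A x) = ?\<pi> (Ident A y)"
    if u: u and xy: "x \<in> Obj A" "y \<in> Obj A" "co x = co y" for x y
  proof -
    interpret A: category A by (rule ObjD(4)[OF A u])
    have id: "Ident A z \<in> Arr A" "Src A (Ident A z) = z" "Tgt A (Ident A z) = z" if "z \<in> Obj A" for z
      using HomD[OF A.Ident_Hom[OF that]] by simp_all
    have id_point: "Inr [Ident A z] \<in> points A" if "z \<in> Obj A" for z
      using id[OF that] by (simp add: points_Inr_iff rcons_simps)
    have "\<exists>z. q = Inl z \<and> z \<in> Obj A \<and> (Inr [Ident A x], Inr [Ident A z]) \<in> R\<^sup>*" if "(Inl x, q) \<in> R\<^sup>*" for q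
      using that
    proof induction
      case base
      show ?case using xy by (intro exI[of _ x]) simp
    next
      case (step q r)
      then obtain z where z: "q = Inl z" "z \<in> Obj A" "(Inr [Ident A x], Inr [Ident A z]) \<in> R\<^sup>*" by blast
      obtain H E where H: "H \<in> Hom C A E" "pmap H q = pmap H r"
        "\<forall>p\<in>points A. \<forall>q\<in>points A. pmap H p = pmap H q \<longrightarrow> (p, q) \<in> R"
        using R_cases[OF step.hyps(2)] by blast
      obtain z' where z': "r = Inl z'" "OMap H z' = OMap H z"
        using pmap_eq_Inl[of H r z] H(2) z(1) by auto
      have z'_obj: "z' \<in> Obj A" using step.hyps(2) z' by (simp add: R_iff points_Inl_iff)
      have "AMap H (Ident A z') = AMap H (Ident A z)"
        using HomE(6)[OF H(1) u] z' z'_obj z by (simp add: unital_def)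
      then have "(Inr [Ident A z], Inr [Ident A z']) \<in> R"
        using H(3) id_point[OF z(2)] id_point[OF z'_obj] by simp
      from rtrancl_into_rtrancl[OF z(3) this] show ?case
        using z' z'_obj by (intro exI[of _ z']) simp
    qed
    from this[OF co_eqD[OF xy]] have "(Inr [Ident A x], Inr [Ident A y]) \<in> R\<^sup>*" by blast
    then have "cw [Ident A x] = cw [Ident A y]" by (intro cw_eqI) (simp add: rcons_simps)
    then show ?thesis using id xy by (simp add: join_arr_def)
  qed
  have kind: "kind u g ?I" and un: "u \<Longrightarrow> unital A ?I co ?\<pi>"
    using generating_kind[OF ObjD(2)[OF A] gu imcat(1-3)] ident by blast+
  have small: "small TYPE('u) (Obj ?I)" "small TYPE('u) (Arr ?I)"
  proof -
    show "small TYPE('u) (Obj ?I)"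
      using small_image[OF ObjD(5)[OF A], of co] by (simp add: imcat_def)
    have "small TYPE('u) (Arr ?D)"
      unfolding joincat_def semicat.simps
      by (intro small_Times small_image small_lists univ ObjD[OF A])
    then show "small TYPE('u) (Arr ?I)" by (rule small_subset[OF imcat(6)])
  qed
  obtain \<alpha> :: "'u \<Rightarrow> 'u" where \<alpha>: "inj_on \<alpha> (Obj ?I)" by (rule small_obtain_inj[OF small(1)])
  obtain \<beta> :: "'u \<times> 'u list \<times> 'u \<Rightarrow> 'u" where \<beta>: "inj_on \<beta> (Arr ?I)" by (rule small_obtain_inj[OF small(2)])
  let ?Q = "encode \<alpha> \<beta> ?I"
  note enc = encode[OF imcat(1) \<alpha> \<beta>]
  note encC = encode_C[OF kind small \<alpha> \<beta>]
  let ?k = "mk_map A ?Q (\<alpha> \<circ> co) (\<beta> \<circ> ?\<pi>)"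
  have k: "?k \<in> Hom C A ?Q"
    by (intro mk_map_Hom A encC sfun_compose[OF imcat(2) enc(2)] unital_compose[OF un encC(2) imcat(2)])
  have k_obj: "pmap ?k (Inl x) = pmap ?k (Inl y) \<longleftrightarrow> co x = co y" if "x \<in> Obj A" "y \<in> Obj A" for x y
    using that sfunD(1)[OF imcat(2)] \<alpha> by (simp add: inj_on_eq_iff)
  \<comment> \<open>The inclusion into \<open>joincat\<close> and the encoding are injective on
    objects, so reduction can be computed in \<open>joincat\<close>, where the two bounds
    apply.\<close>
  have k_word: "pmap ?k (Inr v) = pmap ?k (Inr w) \<longleftrightarrow> red ?D (map ?\<pi> v) = red ?D (map ?\<pi> w)"
    if v: "v \<in> lists (Arr A)" and w: "w \<in> lists (Arr A)" for v w
  proof -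
    interpret I: semicategory ?I by (rule imcat(1))
    have closed: "map ?\<pi> w \<in> lists (Arr ?I)" if "w \<in> lists (Arr A)" for w
      using that sfunD(2)[OF imcat(2)] by auto
    have red_D: "red ?D (map ?\<pi> w) = red ?I (map ?\<pi> w)" if "w \<in> lists (Arr A)" for w
      using red_map_inj[OF imcat(1,4) _ closed[OF that]] by (simp add: inj_on_def)
    have red_Q: "pmap ?k (Inr w) = Inr (map \<beta> (red ?D (map ?\<pi> w)))" if "w \<in> lists (Arr A)" for w
    proof -
      have "map (AMap ?k) w = map \<beta> (map ?\<pi> w)" using that by auto
      then have "pmap ?k (Inr w) = Inr (red ?Q (map \<beta> (map ?\<pi> w)))" by (simp only: pmap_simps mk_map_simps)
      then show ?thesis
        using red_map_inj[OF imcat(1) enc(2) \<alpha> closed[OF that]] red_D[OF that] by (simp only:)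
    qed
    have "inj_on (map \<beta>) (lists (Arr ?I))" by (rule inj_on_map_lists[OF \<beta>])
    then show ?thesis
      unfolding red_Q[OF v] red_Q[OF w] using I.red_closed[OF closed[OF v]] I.red_closed[OF closed[OF w]]
      by (simp only: red_D[OF v] red_D[OF w] sum.inject inj_on_eq_iff)
  qed
  have ker_ge: "pmap ?k p = pmap ?k q" if pq: "(p, q) \<in> R" for p q
  proof -
    obtain H E where H: "H \<in> Hom C A E" "pmap H p = pmap H q"
      and HR: "\<forall>p\<in>points A. \<forall>q\<in>points A. pmap H p = pmap H q \<longrightarrow> (p, q) \<in> R"
      using R_cases[OF pq] by blast
    have obj: "co x = co y" if "x \<in> Obj A" "y \<in> Obj A" "OMap H x = OMap H y" for x y
    proof -
      have "(Inl x, Inl y) \<in> R" using HR that by (simp add: points_Inl_iff)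
      then show ?thesis by (intro co_eqI r_into_rtrancl)
    qed
    have word: "cw v = cw w"
      if v: "v \<in> lists (Arr A)" and w: "w \<in> lists (Arr A)"
        and vw: "red E (map (AMap H) v) = red E (map (AMap H) w)" for v w
    proof -
      have "pmap H (Inr (red A v)) = pmap H (Inr (red A w))"
        unfolding pmap_red[OF H(1) v] pmap_red[OF H(1) w] vw ..
      then have "(Inr (red A v), Inr (red A w)) \<in> R" using HR red_point[OF A v] red_point[OF A w] by blast
      then show ?thesis by (intro cw_eqI r_into_rtrancl)
    qed
    have p: "p \<in> points A" and q: "q \<in> points A" using pq by (simp_all add: R_iff)
    show ?thesis
    proof (rule points_cases[OF p])
      fix x assume x: "p = Inl x" "x \<in> Obj A"
      then obtain y where y: "q = Inl y" "y \<in> Obj A" "OMap H y = OMap H x"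
        using pmap_eq_Inl[of H q x] H(2) q by (auto simp: points_Inl_iff)
      then show ?thesis using obj[of x y] x k_obj by (simp del: pmap_simps)
    next
      fix v assume v: "p = Inr v" "v \<in> lists (Arr A)"
      then obtain w where w: "q = Inr w" "w \<in> lists (Arr A)" "red E (map (AMap H) w) = red E (map (AMap H) v)"
        using pmap_eq_Inr[of H q v] H(2) q HomE(4)[OF H(1)] by (auto simp: points_Inr_iff)
      have "red ?D (map ?\<pi> v) = red ?D (map ?\<pi> w)"
        by (rule join_kernel_ge[OF ObjD(3)[OF HomE(2)[OF H(1)]] HomE(5)[OF H(1)] _ _ v(2) w(2) w(3)[symmetric]])
          ((rule obj; assumption) | (rule word; assumption))+
      then show ?thesis using k_word[OF v(2) w(2)] v w by (simp del: pmap_simps)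
    qed
  qed
  have "pmap ?k p = pmap ?k q \<longleftrightarrow> (p, q) \<in> R\<^sup>*" if p: "p \<in> points A" and q: "q \<in> points A" for p q
  proof
    assume "(p, q) \<in> R\<^sup>*"
    then show "pmap ?k p = pmap ?k q"
    proof induction
      case (step q r)
      show ?case by (rule trans[OF step.IH ker_ge[OF step.hyps(2)]])
    qed (rule refl)
  next
    assume eq: "pmap ?k p = pmap ?k q"
    show "(p, q) \<in> R\<^sup>*"
    proof (rule points_cases[OF p])
      fix x assume x: "p = Inl x" "x \<in> Obj A"
      then obtain y where y: "q = Inl y" "y \<in> Obj A"
        using pmap_eq_Inl[of ?k q x] eq q by (auto simp: points_Inl_iff)
      then show ?thesis using co_eqD[OF x(2) y(2)] k_obj[OF x(2) y(2)] eq x by simp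
    next
      fix v assume v: "p = Inr v" "v \<in> lists (Arr A)" "red A v = v"
      then obtain w where w: "q = Inr w" "w \<in> lists (Arr A)" "red A w = w"
        using pmap_eq_Inr[of ?k q v] eq q by (auto simp: points_Inr_iff)
      have "red ?D (map ?\<pi> v) = red ?D (map ?\<pi> w)"
        using k_word[OF v(2) w(2)] eq unfolding v(1) w(1) by blast
      from cw_eqD[OF v(2) w(2) join_kernel[OF v(2) w(2) this]]
      show ?thesis unfolding v(1,3) w(1,3) .
    qed
  qed
  then show ?thesis using k unfolding R_def by blast
qed

section \<open>Assembling the representation and the three cases\<close>

lemma image_factorization:
  assumes F: "F \<in> Hom C A B"
  shows "\<exists>I e m. e \<in> Hom C A I \<and> m \<in> Hom C I B \<and> F = Cmp C m e \<and>
      pmap e ` points A = points I \<and> inj_on (pmap m) (points I) \<and>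
      (\<forall>Z. \<forall>G\<in>Hom C A Z. (\<forall>x\<in>points A. \<forall>y\<in>points A. pmap e x = pmap e y \<longrightarrow> pmap G x = pmap G y) \<longrightarrow>
        (\<exists>!h. h \<in> Hom C I Z \<and> G = Cmp C h e)) \<and>
      (\<forall>W. \<forall>G\<in>Hom C W B. pmap G ` points W \<subseteq> pmap m ` points I \<longrightarrow> (\<exists>!h. h \<in> Hom C W I \<and> G = Cmp C m h))"
proof (intro exI conjI allI ballI impI)
  let ?I = "imcat A B (OMap F) (AMap F)"
  let ?e = "mk_map A ?I (OMap F) (AMap F)" and ?m = "mk_map ?I B (\<lambda>x. x) (\<lambda>f. f)"
  show "?e \<in> Hom C A ?I" "?m \<in> Hom C ?I B" "F = Cmp C ?m ?e" by (rule imcat_C[OF F])+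
  show "pmap ?e ` points A = points ?I" by (rule image_points(1)[OF F])
  show "inj_on (pmap ?m) (points ?I)"
    by (rule inj_onI) (simp only: image_points(2)[OF F])
  show "\<exists>!h. h \<in> Hom C ?I Z \<and> G = Cmp C h ?e"
    if "G \<in> Hom C A Z" "\<forall>x\<in>points A. \<forall>y\<in>points A. pmap ?e x = pmap ?e y \<longrightarrow> pmap G x = pmap G y" for Z G
    using that(2) by (intro image_quotient[OF F that(1)]) blast
  show "\<exists>!h. h \<in> Hom C W ?I \<and> G = Cmp C ?m h"
    if "G \<in> Hom C W B" "pmap G ` points W \<subseteq> pmap ?m ` points ?I" for W G
    by (rule image_embedding[OF F that])
qed

lemma set_representation: "set_representation C points pmap point_encoding"
proof (intro set_representation.intro set_representation_axioms.intro category_C)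
  fix F X Y p assume "F \<in> Hom C X Y" "p \<in> points X"
  then show "pmap F p \<in> points Y" by (rule pmap_closed)
next
  fix F X Y G Z p assume "F \<in> Hom C X Y" "G \<in> Hom C Y Z" "p \<in> points X"
  then show "pmap (Cmp C G F) p = pmap G (pmap F p)" by (rule pmap_Cmp)
qed (fact pmap_Ident point_encoding_inj small_point_subgroups small_Hom_C image_factorization image_join
      image_meet monic_inj)+

theorem noetherian_form_exists:
  "\<exists>F :: (('u, 'u) semicat, 'u semimap, 'u) form. noetherian_form C F \<and>
    induces C F (strong_epics C) (monics C) \<and>
    (\<forall>X\<in>Obj C. algebraic_lattice (fib F X) \<and> modular_lattice (fib F X))"
proof -
  interpret set_representation C points pmap point_encoding by (rule set_representation)
  show ?thesis
    using noetherian_form induces_strong_epi_mono algebraic_fibre modular_fibre by blast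
qed

end

theorem corollary3p28:
  fixes C :: "(('u, 'u) semicat, 'u semimap) semicat"
  assumes "universe TYPE('u)"
    and "C = Cat \<or> C = Grpd \<or> C = SemiCat"
  shows "\<exists>F :: (('u, 'u) semicat, 'u semimap, 'u) form.
    noetherian_form C F \<and>
    induces C F (strong_epics C) (monics C) \<and>
    (\<forall>X\<in>Obj C. algebraic_lattice (fib F X) \<and> modular_lattice (fib F X))"
proof -
  have unital: "functr F \<longleftrightarrow> semifunctor F \<and> unital (Dom F) (Cod F) (OMap F) (AMap F)" for F :: "'u semimap"
    by (simp add: functr_def unital_def)
  \<comment> \<open>The flags ask for identities only, for identities and inverses, and for neither.
    The conditions on objects agree because \<open>category\<close> and \<open>groupoid\<close>
    contain the weaker structures.\<close>
  have "kind_category True False (Cat :: (('u, 'u) semicat, 'u semimap) semicat)"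
    unfolding kind_category_def Cat_def small_category_def unital kind_def
    using assms(1) by (auto simp: category_def intro!: arg_cong2[where f = category_of])
  moreover have "kind_category True True (Grpd :: (('u, 'u) semicat, 'u semimap) semicat)"
    unfolding kind_category_def Grpd_def small_groupoid_def unital kind_def
    using assms(1) by (auto simp: groupoid_def category_def intro!: arg_cong2[where f = category_of])
  moreover have "kind_category False False (SemiCat :: (('u, 'u) semicat, 'u semimap) semicat)"
    unfolding kind_category_def SemiCat_def kind_def
    using assms(1) by (auto simp: small_semicategory_def intro!: arg_cong2[where f = category_of])
  ultimately show ?thesis
    using assms(2) kind_category.noetherian_form_exists by metis
qed

end
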